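(* Let $H\in(\frac14,\frac13)$, $\lambda>0$, let $[a,b]$ be a compact interval, let $f:\mathbb{R}^d\to\mathbb{R}^d$ be globally Lipschitz continuous, and let $g\in C^3_b(\mathbb{R}^d,\mathcal{L}(\mathbb{R}^m,\mathbb{R}^d))$. Then for every $y_a\in\mathbb{R}^d$ there exists a solution on $[a,b]$, with initial value $y_a$, of the rough differential equation $$dy_t=f(y_t)\,dt+g(y_t)\,dB^{H,\lambda}_t,\qquad t\in[a,b].$$
   Context: Tempered fractional Brownian motion (TFBM): the one-dimensional TFBM is the centered Gaussian process with continuous paths and $\mathbb{E}[B^{H,\lambda}_sB^{H,\lambda}_t]=\frac12\big[C_t^2|t|^{2H}+C_s^2|s|^{2H}-C_{t-s}^2|t-s|^{2H}\big]$, $s,t\ge0$, where $C_0^2=0$ and, for $t\ne0$, $C_t^2=\frac{2\Gamma(2H)}{(2\lambda)^{2H}|t|^{2H}}-\frac{2\Gamma(H+\frac12)}{\sqrt{\pi}(2\lambda)^H|t|^H}K_H(\lambda|t|)$, with $K_v(t)=\int_0^\infty e^{-t\cosh x}\cosh(vx)\,dx$. The driver $B^{H,\lambda}$ is the $m$-dimensional TFBM (independent components, each a one-dimensional TFBM with the same $H,\lambda$). Rough path lift: fix $\alpha\in(\frac14,H)$ and $p=1/\alpha$. Almost surely $B^{H,\lambda}$ lifts, as limit of the canonical lifts (iterated integrals) of its dyadic piecewise linear approximations, to a three-level geometric rough path $\mathbf{B}^{H,\lambda}=(B^{H,\lambda;1},B^{H,\lambda;2},B^{H,\lambda;3})$ on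 $[a,b]$, where $B^{H,\lambda;1}_{s,t}=B^{H,\lambda}_t-B^{H,\lambda}_s$, $\|B^{H,\lambda;j}_{s,t}\|\le \mathrm{const}\,(t-s)^{j\alpha}$ for $j=1,2,3$, and Chen's relations hold. The equation is understood pathwise, for a fixed realization of this rough path. Controlled paths: $y\in C^\alpha([a,b],W)$ is controlled by $B^{H,\lambda}$ if there are $y',y''\in C^\alpha$ with values in the appropriate spaces of linear maps such that $y_{s,t}:=y_t-y_s=y'_sB^{H,\lambda;1}_{s,t}+y''_sB^{H,\lambda;2}_{s,t}+R^{y\sharp}_{s,t}$ and $y'_t-y'_s=y''_sB^{H,\lambda;1}_{s,t}+R^{y\sharp\sharp}_{s,t}$ with $\|R^{y\sharp}_{s,t}\|\le\mathrm{const}\,(t-s)^{3\alpha}$, $\|R^{y\sharp\sharp}_{s,t}\|\le\mathrm{const}\,(t-s)^{2\alpha}$. The rough integral of a controlled path is $\int_s^ty_u\,dB^{H,\lambda}_u:=\lim_{|\Pi|\to0}\sum_{[u,v]\in\Pi}\big(y_u\otimes B^{H,\lambda;1}_{u,v}+y'_uB^{H,\lambda;2}_{u,v}+y''_uB^{H,\lambda;3}_{u,v}\big)$, over finite partitions $\Pi$ of $[s,t]$. A solution on $[a,b]$ with initial value $y_a$ is a path $y$ starting at $y_a$ at time $a$, controlled by $B^{H,\lambda}$ with $y'=g(y)$, $y''=Dg(y)g(y)$, such that $y_{s,t}=\int_s^tf(y_u)\,du+\int_s^tg(y_u)\,dB^{H,\lambda}_u$ for all $a\le s\le t\le b$, where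 $g(y)$ is regarded as controlled by $B^{H,\lambda}$ with $[g(y)]'=Dg(y)g(y)$ and $[g(y)]''=Dg(y)Dg(y)g(y)+D^2g(y)g^2(y)$. $C_b^3$ means that $g$ and its derivatives up to order $3$ exist, are continuous and bounded. *)

theory Defs
  imports "HOL-Probability.Probability"
begin

section \<open>Tempered fractional Brownian motion\<close>

definition bessel_K :: "real \<Rightarrow> real \<Rightarrow> real" where
  "bessel_K v t = (LBINT x:{0..}. exp (- t * cosh x) * cosh (v * x))"

(* The quantity C_t^2 (not C_t). *)
definition C_sq :: "real \<Rightarrow> real \<Rightarrow> real \<Rightarrow> real" where
  "C_sq H lam t =
     (if t = 0 then 0
      else 2 * Gamma (2 * H) / ((2 * lam) powr (2 * H) * \<bar>t\<bar> powr (2 * H))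
           - 2 * Gamma (H + 1 / 2) / (sqrt pi * (2 * lam) powr H * \<bar>t\<bar> powr H)
             * bessel_K H (lam * \<bar>t\<bar>))"

definition tfbm_cov :: "real \<Rightarrow> real \<Rightarrow> real \<Rightarrow> real \<Rightarrow> real" where
  "tfbm_cov H lam s t =
     1 / 2 * (C_sq H lam t * \<bar>t\<bar> powr (2 * H) + C_sq H lam s * \<bar>s\<bar> powr (2 * H)
              - C_sq H lam (t - s) * \<bar>t - s\<bar> powr (2 * H))"

(* The degenerate law (unit mass at 0) counts as Gaussian. *)
definition centered_gaussian :: "'w measure \<Rightarrow> ('w \<Rightarrow> real) \<Rightarrow> bool" where
  "centered_gaussian M X \<longleftrightarrow>
     X \<in> borel_measurable M \<and>
     ((AE \<omega> in M. X \<omega> = 0) \<or>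
      (\<exists>\<sigma>>0. distributed M lborel X (normal_density 0 \<sigma>)))"

definition centered_gaussian_process :: "'w measure \<Rightarrow> (real \<Rightarrow> 'w \<Rightarrow> real) \<Rightarrow> bool" where
  "centered_gaussian_process M X \<longleftrightarrow>
     (\<forall>T c. finite T \<and> T \<subseteq> {0..} \<longrightarrow> centered_gaussian M (\<lambda>\<omega>. \<Sum>t\<in>T. c t * X t \<omega>))"

definition tfbm1 :: "'w measure \<Rightarrow> real \<Rightarrow> real \<Rightarrow> (real \<Rightarrow> 'w \<Rightarrow> real) \<Rightarrow> bool" where
  "tfbm1 M H lam X \<longleftrightarrow>
     centered_gaussian_process M X \<and>
     (\<forall>\<omega>\<in>space M. continuous_on {0..} (\<lambda>t. X t \<omega>)) \<and>
     (\<forall>s\<ge>0. \<forall>t\<ge>0. (\<integral>\<omega>. X s \<omega> * X t \<omega> \<partial>M) = tfbm_cov H lam s t)"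

(* The components are independent as processes, i.e. as random elements of the path
   space with its product sigma-algebra. *)
definition tfbm :: "'w measure \<Rightarrow> real \<Rightarrow> real \<Rightarrow> (real \<Rightarrow> 'w \<Rightarrow> real ^ 'm) \<Rightarrow> bool" where
  "tfbm M H lam B \<longleftrightarrow>
     (\<forall>i. tfbm1 M H lam (\<lambda>t \<omega>. B t \<omega> $ i)) \<and>
     prob_space.indep_vars M (\<lambda>i::'m. Pi\<^sub>M {0..} (\<lambda>t::real. borel :: real measure))
       (\<lambda>i \<omega>. \<lambda>t\<in>{0..}. B t \<omega> $ i) UNIV"

section \<open>Three-level rough paths\<close>

(* The second and third tensor powers of R^m are represented by coordinates: the (i,j) entry
   of an element of real^'m^'m is the coefficient of e_i (x) e_j, and the (i,j,k) entry of an
   element of real^'m^'m^'m that of e_i (x) e_j (x) e_k.  In an iterated integral the first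
   index belongs to the innermost (earliest) differential. *)
record ('m::finite) rough_path =
  lev1 :: "real \<Rightarrow> real \<Rightarrow> real ^ 'm"
  lev2 :: "real \<Rightarrow> real \<Rightarrow> real ^ 'm ^ 'm"
  lev3 :: "real \<Rightarrow> real \<Rightarrow> real ^ 'm ^ 'm ^ 'm"

definition tensor11 :: "real ^ 'm \<Rightarrow> real ^ 'm \<Rightarrow> real ^ 'm ^ 'm" where
  "tensor11 x y = (\<chi> i j. x $ i * y $ j)"

definition tensor21 :: "real ^ 'm ^ 'm \<Rightarrow> real ^ 'm \<Rightarrow> real ^ 'm ^ 'm ^ 'm" where
  "tensor21 A x = (\<chi> i j k. A $ i $ j * x $ k)"

definition tensor12 :: "real ^ 'm \<Rightarrow> real ^ 'm ^ 'm \<Rightarrow> real ^ 'm ^ 'm ^ 'm" where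
  "tensor12 x A = (\<chi> i j k. x $ i * A $ j $ k)"

definition is_partition :: "nat \<Rightarrow> (nat \<Rightarrow> real) \<Rightarrow> real \<Rightarrow> real \<Rightarrow> bool" where
  "is_partition n D s t \<longleftrightarrow> D 0 = s \<and> D n = t \<and> (\<forall>i<n. D i < D (Suc i))"

definition p_variation ::
  "real \<Rightarrow> real \<Rightarrow> real \<Rightarrow> (real \<Rightarrow> real \<Rightarrow> 'v::real_normed_vector) \<Rightarrow> ennreal" where
  "p_variation q a b Z =
     (SUP (n, D)\<in>{(n, D). is_partition n D a b}.
        ennreal ((\<Sum>i<n. norm (Z (D i) (D (Suc i))) powr q) powr (1 / q)))"

definition dyadic_point :: "real \<Rightarrow> real \<Rightarrow> nat \<Rightarrow> nat \<Rightarrow> real" where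
  "dyadic_point a b n k = a + real k * (b - a) / 2 ^ n"

(* Linear interpolation of x on [a,b] through the dyadic points of level n. *)
definition dyadic_approx ::
  "real \<Rightarrow> real \<Rightarrow> nat \<Rightarrow> (real \<Rightarrow> 'v::real_normed_vector) \<Rightarrow> real \<Rightarrow> 'v" where
  "dyadic_approx a b n x t =
     (let k = nat \<lfloor>2 ^ n * (t - a) / (b - a)\<rfloor>;
          u = dyadic_point a b n k;
          v = dyadic_point a b n (Suc k)
      in x u + ((t - u) / (v - u)) *\<^sub>R (x v - x u))"

(* Iterated integrals of a piecewise smooth path; dx is x'(v) dv, the derivative being
   defined off the finitely many break points. *)
definition iter_int2 :: "(real \<Rightarrow> real ^ 'm) \<Rightarrow> real \<Rightarrow> real \<Rightarrow> real ^ 'm ^ 'm" where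
  "iter_int2 x s t = integral {s..t} (\<lambda>v. tensor11 (x v - x s) (vector_derivative x (at v)))"

definition iter_int3 :: "(real \<Rightarrow> real ^ 'm) \<Rightarrow> real \<Rightarrow> real \<Rightarrow> real ^ 'm ^ 'm ^ 'm" where
  "iter_int3 x s t = integral {s..t} (\<lambda>v. tensor21 (iter_int2 x s v) (vector_derivative x (at v)))"

definition canonical_lift :: "(real \<Rightarrow> real ^ 'm) \<Rightarrow> 'm::finite rough_path" where
  "canonical_lift x = \<lparr>lev1 = (\<lambda>s t. x t - x s), lev2 = iter_int2 x, lev3 = iter_int3 x\<rparr>"

definition chen_relations :: "real \<Rightarrow> real \<Rightarrow> 'm::finite rough_path \<Rightarrow> bool" where
  "chen_relations a b X \<longleftrightarrow>
     (\<forall>s u t. a \<le> s \<and> s \<le> u \<and> u \<le> t \<and> t \<le> b \<longrightarrow>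
        lev1 X s t = lev1 X s u + lev1 X u t \<and>
        lev2 X s t = lev2 X s u + lev2 X u t + tensor11 (lev1 X s u) (lev1 X u t) \<and>
        lev3 X s t = lev3 X s u + lev3 X u t
          + tensor21 (lev2 X s u) (lev1 X u t) + tensor12 (lev1 X s u) (lev2 X u t))"

definition holder2 ::
  "real \<Rightarrow> real \<Rightarrow> real \<Rightarrow> (real \<Rightarrow> real \<Rightarrow> 'v::real_normed_vector) \<Rightarrow> bool" where
  "holder2 \<beta> a b Z \<longleftrightarrow>
     (\<exists>K. \<forall>s t. a \<le> s \<and> s \<le> t \<and> t \<le> b \<longrightarrow> norm (Z s t) \<le> K * (t - s) powr \<beta>)"

(* X is the geometric rough path lift of the path x on [a,b]: the limit, in the
   p-variation rough path distance with p = 1/\<alpha>, of the canonical lifts of the dyadic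
   piecewise linear approximations of x. *)
definition geometric_lift ::
  "real \<Rightarrow> real \<Rightarrow> real \<Rightarrow> (real \<Rightarrow> real ^ 'm) \<Rightarrow> 'm::finite rough_path \<Rightarrow> bool" where
  "geometric_lift \<alpha> a b x X \<longleftrightarrow>
     (\<forall>s t. a \<le> s \<and> s \<le> t \<and> t \<le> b \<longrightarrow> lev1 X s t = x t - x s) \<and>
     holder2 \<alpha> a b (lev1 X) \<and> holder2 (2 * \<alpha>) a b (lev2 X) \<and> holder2 (3 * \<alpha>) a b (lev3 X) \<and>
     chen_relations a b X \<and>
     (let p = 1 / \<alpha>; L = (\<lambda>n. canonical_lift (dyadic_approx a b n x)) in
        (\<lambda>n. p_variation p a b (\<lambda>s t. lev1 (L n) s t - lev1 X s t)) \<longlonglongrightarrow> 0 \<and>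
        (\<lambda>n. p_variation (p / 2) a b (\<lambda>s t. lev2 (L n) s t - lev2 X s t)) \<longlonglongrightarrow> 0 \<and>
        (\<lambda>n. p_variation (p / 3) a b (\<lambda>s t. lev3 (L n) s t - lev3 X s t)) \<longlonglongrightarrow> 0)"

section \<open>Controlled paths and rough integrals\<close>

(* Linear maps on a tensor power of R^m are represented in curried form, the outermost
   argument being the first tensor factor; app2 and app3 apply them to tensors. *)
definition app2 ::
  "((real ^ 'm) \<Rightarrow>\<^sub>L ((real ^ 'm) \<Rightarrow>\<^sub>L 'v::real_normed_vector)) \<Rightarrow> real ^ 'm ^ 'm \<Rightarrow> 'v" where
  "app2 A T = (\<Sum>i\<in>UNIV. \<Sum>j\<in>UNIV. (T $ i $ j) *\<^sub>R A (axis i 1) (axis j 1))"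

definition app3 ::
  "((real ^ 'm) \<Rightarrow>\<^sub>L ((real ^ 'm) \<Rightarrow>\<^sub>L ((real ^ 'm) \<Rightarrow>\<^sub>L 'v::real_normed_vector)))
     \<Rightarrow> real ^ 'm ^ 'm ^ 'm \<Rightarrow> 'v" where
  "app3 A T = (\<Sum>i\<in>UNIV. \<Sum>j\<in>UNIV. \<Sum>k\<in>UNIV.
      (T $ i $ j $ k) *\<^sub>R A (axis i 1) (axis j 1) (axis k 1))"

definition holder ::
  "real \<Rightarrow> real \<Rightarrow> real \<Rightarrow> (real \<Rightarrow> 'v::real_normed_vector) \<Rightarrow> bool" where
  "holder \<beta> a b y \<longleftrightarrow> holder2 \<beta> a b (\<lambda>s t. y t - y s)"

definition controlled ::
  "real \<Rightarrow> real \<Rightarrow> real \<Rightarrow> 'm::finite rough_path \<Rightarrow> (real \<Rightarrow> 'v::real_normed_vector)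
     \<Rightarrow> (real \<Rightarrow> ((real ^ 'm) \<Rightarrow>\<^sub>L 'v)) \<Rightarrow> (real \<Rightarrow> ((real ^ 'm) \<Rightarrow>\<^sub>L ((real ^ 'm) \<Rightarrow>\<^sub>L 'v))) \<Rightarrow> bool" where
  "controlled \<alpha> a b X y y' y'' \<longleftrightarrow>
     holder \<alpha> a b y \<and> holder \<alpha> a b y' \<and> holder \<alpha> a b y'' \<and>
     holder2 (3 * \<alpha>) a b (\<lambda>s t. y t - y s - y' s (lev1 X s t) - app2 (y'' s) (lev2 X s t)) \<and>
     holder2 (2 * \<alpha>) a b (\<lambda>s t. y' t - y' s - y'' s (lev1 X s t))"

(* The integrand takes values in linear maps R^m -> 'v, so its product with the first
   level is evaluation and the integral is 'v-valued. *)
definition has_rough_integral ::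
  "'m::finite rough_path \<Rightarrow> (real \<Rightarrow> ((real ^ 'm) \<Rightarrow>\<^sub>L 'v::real_normed_vector))
     \<Rightarrow> (real \<Rightarrow> ((real ^ 'm) \<Rightarrow>\<^sub>L ((real ^ 'm) \<Rightarrow>\<^sub>L 'v)))
     \<Rightarrow> (real \<Rightarrow> ((real ^ 'm) \<Rightarrow>\<^sub>L ((real ^ 'm) \<Rightarrow>\<^sub>L ((real ^ 'm) \<Rightarrow>\<^sub>L 'v))))
     \<Rightarrow> real \<Rightarrow> real \<Rightarrow> 'v \<Rightarrow> bool" where
  "has_rough_integral X y y' y'' s t I \<longleftrightarrow>
     (\<forall>\<epsilon>>0. \<exists>\<delta>>0. \<forall>n D. is_partition n D s t \<and> (\<forall>i<n. D (Suc i) - D i < \<delta>) \<longrightarrow>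
        norm ((\<Sum>i<n. let u = D i; v = D (Suc i) in
                 y u (lev1 X u v) + app2 (y' u) (lev2 X u v) + app3 (y'' u) (lev3 X u v)) - I) < \<epsilon>)"

section \<open>The rough differential equation\<close>

definition fderiv ::
  "('a::real_normed_vector \<Rightarrow> 'b::real_normed_vector) \<Rightarrow> 'a \<Rightarrow> ('a \<Rightarrow>\<^sub>L 'b)" where
  "fderiv h x = Blinfun (frechet_derivative h (at x))"

lemma fderiv_works:
  assumes "h differentiable (at x)"
  shows "(h has_derivative blinfun_apply (fderiv h x)) (at x)"
  using assms unfolding fderiv_def
  by (metis bounded_linear_Blinfun_apply frechet_derivative_works has_derivative_bounded_linear)

definition C3_b :: "('a::real_normed_vector \<Rightarrow> 'b::real_normed_vector) \<Rightarrow> bool" where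
  "C3_b h \<longleftrightarrow>
     (\<forall>x. h differentiable (at x)) \<and>
     (\<forall>x. fderiv h differentiable (at x)) \<and>
     (\<forall>x. fderiv (fderiv h) differentiable (at x)) \<and>
     continuous_on UNIV h \<and> bounded (range h) \<and>
     continuous_on UNIV (fderiv h) \<and> bounded (range (fderiv h)) \<and>
     continuous_on UNIV (fderiv (fderiv h)) \<and> bounded (range (fderiv (fderiv h))) \<and>
     continuous_on UNIV (fderiv (fderiv (fderiv h))) \<and>
       bounded (range (fderiv (fderiv (fderiv h))))"

definition Dg_g ::
  "(real ^ 'd \<Rightarrow> ((real ^ 'm) \<Rightarrow>\<^sub>L (real ^ 'd))) \<Rightarrow> real ^ 'd
     \<Rightarrow> ((real ^ 'm) \<Rightarrow>\<^sub>L ((real ^ 'm) \<Rightarrow>\<^sub>L (real ^ 'd)))" where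
  "Dg_g g z = fderiv g z o\<^sub>L g z"

(* Dg Dg g + D^2g g^2 at z, evaluated at u, v, w in R^m (see Dg_g2_apply). *)
definition Dg_g2 ::
  "(real ^ 'd \<Rightarrow> ((real ^ 'm) \<Rightarrow>\<^sub>L (real ^ 'd))) \<Rightarrow> real ^ 'd
     \<Rightarrow> ((real ^ 'm) \<Rightarrow>\<^sub>L ((real ^ 'm) \<Rightarrow>\<^sub>L ((real ^ 'm) \<Rightarrow>\<^sub>L (real ^ 'd))))" where
  "Dg_g2 g z = Blinfun (\<lambda>u. (fderiv g z o\<^sub>L fderiv g z (g z u))
                          + (fderiv (fderiv g) z (g z u) o\<^sub>L g z))"

lemma Dg_g_apply: "Dg_g g z u v = fderiv g z (g z u) v"
  by (simp add: Dg_g_def)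

lemma Dg_g2_apply:
  "Dg_g2 g z u v w =
     fderiv g z (fderiv g z (g z u) v) w + fderiv (fderiv g) z (g z u) (g z v) w"
proof -
  have "bounded_linear (\<lambda>u. (fderiv g z o\<^sub>L fderiv g z (g z u))
                          + (fderiv (fderiv g) z (g z u) o\<^sub>L g z))"
    by (intro bounded_linear_intros)
  then show ?thesis
    by (simp add: Dg_g2_def bounded_linear_Blinfun_apply blinfun.add_left)
qed

definition rde_solution ::
  "real \<Rightarrow> real \<Rightarrow> real \<Rightarrow> 'm::finite rough_path \<Rightarrow> (real ^ 'd \<Rightarrow> real ^ 'd)
     \<Rightarrow> (real ^ 'd \<Rightarrow> ((real ^ 'm) \<Rightarrow>\<^sub>L (real ^ 'd))) \<Rightarrow> real ^ 'd \<Rightarrow> (real \<Rightarrow> real ^ 'd) \<Rightarrow> bool" where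
  "rde_solution \<alpha> a b X f g y\<^sub>a y \<longleftrightarrow>
     y a = y\<^sub>a \<and>
     controlled \<alpha> a b X y (\<lambda>t. g (y t)) (\<lambda>t. Dg_g g (y t)) \<and>
     controlled \<alpha> a b X (\<lambda>t. g (y t)) (\<lambda>t. Dg_g g (y t)) (\<lambda>t. Dg_g2 g (y t)) \<and>
     (\<forall>s t. a \<le> s \<and> s \<le> t \<and> t \<le> b \<longrightarrow>
        (\<exists>J I. ((\<lambda>u. f (y u)) has_integral J) {s..t} \<and>
               has_rough_integral X (\<lambda>u. g (y u)) (\<lambda>u. Dg_g g (y u)) (\<lambda>u. Dg_g2 g (y u)) s t I \<and>
               y t - y s = J + I))"

end

(* The statement is pathwise: every geometric lift X of any path admits solutions, whatever
   its law.  Solutions are obtained by Davie's method.  The third order Euler step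
     mu s t y = y + f(y) (t-s) + g(y) X1 + Dg g(y) X2 + (Dg Dg g + D^2g g^2)(y) X3
   is an almost flow: by Chen's relations and Taylor expansion,
   |mu u t (mu s u y) - mu s t y| <= C (1 + |f y|) (t-s)^(4 alpha), with 4 alpha > 1.
   The expansion of g needs the symmetric part of X2 to be X1 (x) X1 / 2, which holds for the
   lifts of piecewise linear paths and passes to the limit.  Since f is only Lipschitz, all
   estimates carry the weight 1 + |f y|.  Iterating mu along uniform grids gives step functions
   that are bounded and satisfy |y_t - mu s t y_s| <= K (t-s)^(4 alpha) up to an error
   vanishing with the mesh, and any pointwise cluster point y satisfies it without error.
   Expanding mu turns this bound into the controlled path estimates for y and g(y), and
   because 4 alpha > 1 it also forces the compensated Riemann sums to converge to
   y_t - y_s - int f(y). *)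
theory Submission
  imports Defs
begin

section \<open>Taylor expansions\<close>

text \<open>As 3\<alpha> < 1, the time increment t - s is O((t-s)^(3\<alpha>)), so the drift
  f(y)(t-s) is treated like a term of the third level. The defect has order four because level k
  always meets a coefficient remainder of order 4 - k. The linear growth of f is the obstacle. The
  iteration closes only if all estimates are linear in the weight, so those parts of an increment
  that carry the weight are never raised to a power: Lipschitz bounds split them off before anything
  is expanded to higher order. The approximations are step functions, so compactness is taken from a
  product of balls rather than from equicontinuity. This suffices because the estimate for a fixed
  pair s, t is a closed condition on two coordinates. Finally, the value of the rough integral is
  dictated by the equation once y is known, so Riemann sums are compared with a given path and no
  convergence by refinement has to be proved.\<close>

lemma norm_increment_le:
  fixes \<phi> :: "real \<Rightarrow> 'b::real_normed_vector"
  assumes "\<And>t. (\<phi> has_vector_derivative \<phi>' t) (at t)"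
    and "\<And>t. 0 \<le> t \<Longrightarrow> t \<le> 1 \<Longrightarrow> norm (\<phi>' t) \<le> C"
  shows "norm (\<phi> 1 - \<phi> 0) \<le> C"
proof -
  have "norm (\<phi> 1 - \<phi> 0) \<le> C * norm (1 - 0 :: real)"
  proof (rule differentiable_bound)
    show "convex {0..1::real}" by simp
    fix t :: real assume t: "t \<in> {0..1}"
    show "(\<phi> has_derivative (\<lambda>x. x *\<^sub>R \<phi>' t)) (at t within {0..1})"
      using assms(1)[of t] unfolding has_vector_derivative_def
      by (rule has_derivative_at_withinI)
    show "onorm (\<lambda>x. x *\<^sub>R \<phi>' t) \<le> C"
      using assms(2)[of t] t by (simp add: onorm_scaleR_left onorm_id)
  qed auto
  then show ?thesis by simp
qed

lemma has_vector_derivative_along_line: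
  assumes "\<And>x. (h has_derivative blinfun_apply (D x)) (at x)"
  shows "((\<lambda>t. h (y + t *\<^sub>R k)) has_vector_derivative D (y + t *\<^sub>R k) k) (at t)"
proof -
  have 1: "((\<lambda>t. y + t *\<^sub>R k) has_derivative (\<lambda>t. t *\<^sub>R k)) (at t)"
    by (auto intro!: derivative_eq_intros)
  have "((\<lambda>t. h (y + t *\<^sub>R k)) has_derivative (\<lambda>s. D (y + t *\<^sub>R k) (s *\<^sub>R k))) (at t)"
    by (rule has_derivative_compose[OF 1 assms])
  then show ?thesis
    by (simp add: has_vector_derivative_def blinfun.scaleR_right)
qed

lemma derivative_bound_lipschitz:
  assumes "\<And>x. (h has_derivative blinfun_apply (D x)) (at x)" and "\<And>x. norm (D x) \<le> C"
  shows "norm (h (y + k) - h y) \<le> C * norm k"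
proof -
  have "norm (h (y + 1 *\<^sub>R k) - h (y + 0 *\<^sub>R k)) \<le> C * norm k"
  proof (rule norm_increment_le)
    show "((\<lambda>t. h (y + t *\<^sub>R k)) has_vector_derivative D (y + t *\<^sub>R k) k) (at t)" for t
      by (rule has_vector_derivative_along_line[OF assms(1)])
    show "norm (D (y + t *\<^sub>R k) k) \<le> C * norm k" for t
      by (meson assms(2) mult_right_mono norm_blinfun norm_ge_zero order_trans)
  qed
  then show ?thesis by simp
qed

text \<open>Subtracting the linear part first reduces the remainder to a bound on its derivative
  along the segment from \<open>y\<close> to \<open>y + k\<close>. The factor 1/2 is given away;
  only the order in \<open>k\<close> counts later.\<close>

lemma taylor_order2:
  assumes der: "\<And>x. (h has_derivative blinfun_apply (D x)) (at x)"
    and lip: "\<And>x k. norm (D (x + k) - D x) \<le> C * norm k" and C: "0 \<le> C"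
  shows "norm (h (y + k) - h y - D y k) \<le> C * (norm k)\<^sup>2"
proof -
  let ?\<phi> = "\<lambda>t. h (y + t *\<^sub>R k) - t *\<^sub>R D y k"
  have "norm (?\<phi> 1 - ?\<phi> 0) \<le> C * (norm k)\<^sup>2"
  proof (rule norm_increment_le)
    show "(?\<phi> has_vector_derivative (D (y + t *\<^sub>R k) k - D y k)) (at t)" for t
      by (auto intro!: derivative_eq_intros has_vector_derivative_along_line[OF der])
    fix t :: real assume t: "0 \<le> t" "t \<le> 1"
    have "norm (D (y + t *\<^sub>R k) k - D y k) \<le> norm (D (y + t *\<^sub>R k) - D y) * norm k"
      by (metis blinfun.diff_left norm_blinfun)
    also have "\<dots> \<le> (C * norm (t *\<^sub>R k)) * norm k"
      by (intro mult_right_mono lip) auto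
    also have "\<dots> = t * (C * (norm k)\<^sup>2)"
      using t by (simp add: power2_eq_square)
    also have "\<dots> \<le> 1 * (C * (norm k)\<^sup>2)"
      using t C by (intro mult_right_mono) auto
    finally show "norm (D (y + t *\<^sub>R k) k - D y k) \<le> C * (norm k)\<^sup>2" by simp
  qed
  then show ?thesis by (simp add: algebra_simps)
qed

lemma taylor_order3:
  assumes der: "\<And>x. (h has_derivative blinfun_apply (D x)) (at x)"
    and der2: "\<And>x. (D has_derivative blinfun_apply (D2 x)) (at x)"
    and lip: "\<And>x k. norm (D2 (x + k) - D2 x) \<le> C * norm k" and C: "0 \<le> C"
  shows "norm (h (y + k) - h y - D y k - (1/2) *\<^sub>R D2 y k k) \<le> C * norm k ^ 3"
proof -
  let ?\<phi> = "\<lambda>t. h (y + t *\<^sub>R k) - t *\<^sub>R D y k - (t\<^sup>2 / 2) *\<^sub>R D2 y k k"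
  have "norm (?\<phi> 1 - ?\<phi> 0) \<le> C * norm k ^ 3"
  proof (rule norm_increment_le)
    show "(?\<phi> has_vector_derivative (D (y + t *\<^sub>R k) k - D y k - t *\<^sub>R D2 y k k)) (at t)" for t
      by (auto intro!: derivative_eq_intros has_vector_derivative_along_line[OF der])
    fix t :: real assume t: "0 \<le> t" "t \<le> 1"
    have "D (y + t *\<^sub>R k) k - D y k - t *\<^sub>R D2 y k k
        = (D (y + t *\<^sub>R k) - D y - D2 y (t *\<^sub>R k)) k"
      by (simp add: blinfun.bilinear_simps)
    also have "norm \<dots> \<le> norm (D (y + t *\<^sub>R k) - D y - D2 y (t *\<^sub>R k)) * norm k"
      by (rule norm_blinfun)
    also have "\<dots> \<le> (C * (norm (t *\<^sub>R k))\<^sup>2) * norm k"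
      by (intro mult_right_mono taylor_order2[OF der2 lip C]) auto
    also have "\<dots> = t\<^sup>2 * (C * norm k ^ 3)"
      using t by (simp add: power2_eq_square power3_eq_cube)
    also have "\<dots> \<le> 1 * (C * norm k ^ 3)"
      using t C by (intro mult_right_mono) (auto simp: power_le_one)
    finally show "norm (D (y + t *\<^sub>R k) k - D y k - t *\<^sub>R D2 y k k) \<le> C * norm k ^ 3" by simp
  qed
  then show ?thesis by (simp add: algebra_simps)
qed

text \<open>The mixed second difference is symmetric in \<open>k\<close> and \<open>l\<close>, hence so is the second derivative.\<close>

lemma mixed_difference_bound:
  assumes der: "\<And>x. (h has_derivative blinfun_apply (D x)) (at x)"
    and der2: "\<And>x. (D has_derivative blinfun_apply (D2 x)) (at x)"
    and lip: "\<And>x k. norm (D2 (x + k) - D2 x) \<le> C * norm k" and C: "0 \<le> C"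
  shows "norm (h (y + k + l) - h (y + k) - h (y + l) + h y - D2 y l k)
           \<le> 2 * C * (norm k + norm l) ^ 3"
proof -
  \<comment> \<open>Only direction \<open>k\<close> is differentiated; the difference in direction
    \<open>l\<close> is kept, so the derivative is an increment of \<open>D\<close> and two Taylor
    remainders bound it.\<close>
  let ?\<phi> = "\<lambda>t. h (y + l + t *\<^sub>R k) - h (y + t *\<^sub>R k) - t *\<^sub>R D2 y l k"
  have "norm (?\<phi> 1 - ?\<phi> 0) \<le> 2 * C * (norm k + norm l) ^ 3"
  proof (rule norm_increment_le)
    show "(?\<phi> has_vector_derivative (D (y + l + t *\<^sub>R k) k - D (y + t *\<^sub>R k) k - D2 y l k)) (at t)" for t
      by (auto intro!: derivative_eq_intros has_vector_derivative_along_line[OF der])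
    fix t :: real assume t: "0 \<le> t" "t \<le> 1"
    let ?K = "norm k + norm l"
    have "t * norm k \<le> 1 * norm k" using t by (intro mult_right_mono) auto
    then have le: "norm (t *\<^sub>R k) \<le> ?K" "norm (l + t *\<^sub>R k) \<le> ?K"
      using t norm_triangle_ineq[of l "t *\<^sub>R k"] norm_ge_zero[of l] by (auto simp del: norm_ge_zero)
    have "norm (D (y + (l + t *\<^sub>R k)) - D y - D2 y (l + t *\<^sub>R k)) \<le> C * (norm (l + t *\<^sub>R k))\<^sup>2"
      by (rule taylor_order2[OF der2 lip C])
    also have "\<dots> \<le> C * ?K\<^sup>2"
      using C le by (intro mult_left_mono power_mono) auto
    finally have 1: "norm (D (y + (l + t *\<^sub>R k)) - D y - D2 y (l + t *\<^sub>R k)) \<le> C * ?K\<^sup>2" .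
    have "norm (D (y + t *\<^sub>R k) - D y - D2 y (t *\<^sub>R k)) \<le> C * (norm (t *\<^sub>R k))\<^sup>2"
      by (rule taylor_order2[OF der2 lip C])
    also have "\<dots> \<le> C * ?K\<^sup>2"
      using C le by (intro mult_left_mono power_mono) auto
    finally have 2: "norm (D (y + t *\<^sub>R k) - D y - D2 y (t *\<^sub>R k)) \<le> C * ?K\<^sup>2" .
    have "D (y + l + t *\<^sub>R k) k - D (y + t *\<^sub>R k) k - D2 y l k
       = ((D (y + (l + t *\<^sub>R k)) - D y - D2 y (l + t *\<^sub>R k))
          - (D (y + t *\<^sub>R k) - D y - D2 y (t *\<^sub>R k))) k"
      by (simp add: blinfun.bilinear_simps add.assoc)
    also have "norm \<dots> \<le> norm ((D (y + (l + t *\<^sub>R k)) - D y - D2 y (l + t *\<^sub>R k))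
          - (D (y + t *\<^sub>R k) - D y - D2 y (t *\<^sub>R k))) * norm k"
      by (rule norm_blinfun)
    also have "\<dots> \<le> (C * ?K\<^sup>2 + C * ?K\<^sup>2) * ?K"
      using 1 2 C by (intro mult_mono order_trans[OF norm_triangle_ineq4 add_mono[OF 1 2]]) auto
    also have "\<dots> = 2 * C * ?K ^ 3"
      by (simp add: power2_eq_square power3_eq_cube algebra_simps)
    finally show "norm (D (y + l + t *\<^sub>R k) k - D (y + t *\<^sub>R k) k - D2 y l k) \<le> 2 * C * ?K ^ 3" .
  qed
  then show ?thesis by (simp add: algebra_simps)
qed

lemma second_derivative_symmetric:
  assumes der: "\<And>x. (h has_derivative blinfun_apply (D x)) (at x)"
    and der2: "\<And>x. (D has_derivative blinfun_apply (D2 x)) (at x)"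
    and lip: "\<And>x k. norm (D2 (x + k) - D2 x) \<le> C * norm k" and C: "0 \<le> C"
  shows "D2 y k l = D2 y l k"
proof -
  let ?K = "norm k + norm l"
  \<comment> \<open>Scaling both directions by \<open>e\<close> multiplies the commutator by e^2 but
    its bound by e^3, so a factor \<open>e\<close> survives the division.\<close>
  have bound: "norm (D2 y k l - D2 y l k) \<le> e * (4 * C * ?K ^ 3)" if e: "0 < e" for e
  proof -
    let ?A = "h (y + e *\<^sub>R k + e *\<^sub>R l) - h (y + e *\<^sub>R k) - h (y + e *\<^sub>R l) + h y"
    have nn: "norm (e *\<^sub>R k) + norm (e *\<^sub>R l) = e * ?K"
      using e by (simp add: algebra_simps)
    have 1: "norm (?A - D2 y (e *\<^sub>R l) (e *\<^sub>R k)) \<le> 2 * C * (e * ?K) ^ 3"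
      using mixed_difference_bound[OF der der2 lip C, of y "e *\<^sub>R k" "e *\<^sub>R l"] unfolding nn .
    have "norm (h (y + e *\<^sub>R l + e *\<^sub>R k) - h (y + e *\<^sub>R l) - h (y + e *\<^sub>R k) + h y
             - D2 y (e *\<^sub>R k) (e *\<^sub>R l)) \<le> 2 * C * (norm (e *\<^sub>R l) + norm (e *\<^sub>R k)) ^ 3"
      by (rule mixed_difference_bound[OF der der2 lip C])
    moreover have "norm (e *\<^sub>R l) + norm (e *\<^sub>R k) = e * ?K"
      using nn by simp
    moreover have "h (y + e *\<^sub>R l + e *\<^sub>R k) - h (y + e *\<^sub>R l) - h (y + e *\<^sub>R k) + h y = ?A"
      by (simp add: algebra_simps)
    ultimately have 2: "norm (?A - D2 y (e *\<^sub>R k) (e *\<^sub>R l)) \<le> 2 * C * (e * ?K) ^ 3"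
      by metis
    have "norm (D2 y (e *\<^sub>R k) (e *\<^sub>R l) - D2 y (e *\<^sub>R l) (e *\<^sub>R k)) \<le> 4 * C * (e * ?K) ^ 3"
      using norm_triangle_ineq4[of "?A - D2 y (e *\<^sub>R l) (e *\<^sub>R k)" "?A - D2 y (e *\<^sub>R k) (e *\<^sub>R l)"] 1 2
      by (simp add: algebra_simps)
    also have "D2 y (e *\<^sub>R k) (e *\<^sub>R l) - D2 y (e *\<^sub>R l) (e *\<^sub>R k) = e\<^sup>2 *\<^sub>R (D2 y k l - D2 y l k)"
      by (simp add: blinfun.bilinear_simps power2_eq_square algebra_simps)
    finally have "e\<^sup>2 * norm (D2 y k l - D2 y l k) \<le> e\<^sup>2 * (e * (4 * C * ?K ^ 3))"
      using e by (simp add: power_mult_distrib power2_eq_square power3_eq_cube mult_ac)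
    then show ?thesis using e by simp
  qed
  have "((\<lambda>e. e * (4 * C * ?K ^ 3)) \<longlongrightarrow> 0 * (4 * C * ?K ^ 3)) (at_right 0)"
    by (intro tendsto_intros)
  moreover have "eventually (\<lambda>e. norm (D2 y k l - D2 y l k) \<le> e * (4 * C * ?K ^ 3)) (at_right 0)"
    using bound by (simp add: eventually_at_right_less eventually_at_filter)
  ultimately have "norm (D2 y k l - D2 y l k) \<le> 0 * (4 * C * ?K ^ 3)"
    by (intro tendsto_lowerbound[where F="at_right 0"]) auto
  then show ?thesis by simp
qed

section \<open>Almost flows\<close>

text \<open>By Tychonoff's theorem. Over an uncountable index set pointwise compactness need not
  give convergent subsequences, so the limit is only a cluster point. Closed sets serve as
  interface: every eventual closed condition on finitely many coordinates is inherited.\<close>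

lemma cluster_point_product:
  fixes Y :: "nat \<Rightarrow> 'i \<Rightarrow> 'e::{real_normed_vector, heine_borel}"
  assumes "eventually (\<lambda>n. \<forall>t. norm (Y n t) \<le> R) sequentially"
  obtains y where "\<And>S. closed S \<Longrightarrow> eventually (\<lambda>n. Y n \<in> S) sequentially \<Longrightarrow> y \<in> S"
proof -
  let ?U = "PiE UNIV (\<lambda>_::'i. cball (0::'e) R)"
  have "compactin (product_topology (\<lambda>_::'i. euclidean :: 'e topology) UNIV) ?U"
    by (subst compactin_PiE) auto
  then have U: "compact ?U"
    by (metis compactin_euclidean_iff euclidean_product_topology)
  have "filtermap Y sequentially \<noteq> bot" by (simp add: filtermap_bot_iff)
  moreover have "filtermap Y sequentially \<le> principal ?U"
    unfolding le_principal eventually_filtermap using assms by (auto elim!: eventually_mono)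
  ultimately obtain y where y: "inf (nhds y) (filtermap Y sequentially) \<noteq> bot"
    using U unfolding compact_filter le_principal by blast
  show ?thesis
  proof
    fix S assume S: "closed S" "eventually (\<lambda>n. Y n \<in> S) sequentially"
    show "y \<in> S"
    proof (rule ccontr)
      assume "y \<notin> S"
      then have "eventually (\<lambda>z. z \<notin> S) (nhds y)"
        using S(1) by (intro eventually_nhds_in_open[of "- S", simplified]) (auto simp: open_closed)
      moreover have "eventually (\<lambda>z. z \<in> S) (filtermap Y sequentially)"
        using S(2) by (simp add: eventually_filtermap)
      ultimately have "eventually (\<lambda>z. False) (inf (nhds y) (filtermap Y sequentially))"
        unfolding eventually_inf by (intro exI conjI) (assumption | blast)+
      with y show False by (simp add: trivial_limit_def)
    qed
  qed
qed

text \<open>The gain from an exponent above 1: write x^\<theta> as x times x^(\<theta> - 1), bound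
  only the second factor by the larger part, and let the first factors add up.\<close>

lemma powr_add_le_split:
  fixes l\<^sub>1 l\<^sub>2 \<theta> \<rho> :: real
  assumes "0 \<le> l\<^sub>1" "0 \<le> l\<^sub>2" "l\<^sub>1 \<le> \<rho> * (l\<^sub>1 + l\<^sub>2)" "l\<^sub>2 \<le> \<rho> * (l\<^sub>1 + l\<^sub>2)" "1 < \<theta>" "0 \<le> \<rho>"
  shows "l\<^sub>1 powr \<theta> + l\<^sub>2 powr \<theta> \<le> \<rho> powr (\<theta> - 1) * (l\<^sub>1 + l\<^sub>2) powr \<theta>"
proof -
  let ?l = "l\<^sub>1 + l\<^sub>2"
  have eq: "x powr \<theta> = x * x powr (\<theta> - 1)" if "0 \<le> x" for x :: real
    using powr_mult_base[OF that, of "\<theta> - 1"] by simp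
  have le: "x powr \<theta> \<le> x * (\<rho> * ?l) powr (\<theta> - 1)" if "0 \<le> x" "x \<le> \<rho> * ?l" for x
    unfolding eq[OF that(1)] using that assms by (intro mult_left_mono powr_mono2) auto
  have "l\<^sub>1 powr \<theta> + l\<^sub>2 powr \<theta> \<le> ?l * (\<rho> * ?l) powr (\<theta> - 1)"
    using add_mono[OF le[OF assms(1,3)] le[OF assms(2,4)]] by (simp add: algebra_simps)
  also have "\<dots> = \<rho> powr (\<theta> - 1) * ?l powr \<theta>"
    using assms eq[of ?l] by (simp add: powr_mult)
  finally show ?thesis .
qed

text \<open>The weight \<open>w\<close> is what allows flows whose increments grow linearly in the base point.\<close>

locale almost_flow =
  fixes a b \<alpha> \<theta> C L :: real
    and \<mu> :: "real \<Rightarrow> real \<Rightarrow> 'e \<Rightarrow> 'e::{real_normed_vector, heine_borel}"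
    and w :: "'e \<Rightarrow> real"
  assumes ab: "a < b" and \<alpha>_pos: "0 < \<alpha>" and \<theta>_gt_1: "1 < \<theta>"
    and C_nonneg: "0 \<le> C" and L_nonneg: "0 \<le> L"
    and w_ge_1: "1 \<le> w y"
    and w_lipschitz: "\<bar>w y - w z\<bar> \<le> L * norm (y - z)"
    and flow_defect: "\<lbrakk>a \<le> s; s \<le> u; u \<le> t; t \<le> b\<rbrakk> \<Longrightarrow>
        norm (\<mu> u t (\<mu> s u y) - \<mu> s t y) \<le> C * w y * (t - s) powr \<theta>"
    and flow_lipschitz: "\<lbrakk>a \<le> s; s \<le> t; t \<le> b\<rbrakk> \<Longrightarrow>
        norm (\<mu> s t y - \<mu> s t z) \<le> (1 + C * (t - s) powr \<alpha>) * norm (y - z)"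
    and flow_increment: "\<lbrakk>a \<le> s; s \<le> t; t \<le> b\<rbrakk> \<Longrightarrow>
        norm (\<mu> s t y - y) \<le> C * w y * (t - s) powr \<alpha>"
begin

section \<open>The scheme on uniform grids\<close>

definition grid :: "nat \<Rightarrow> nat \<Rightarrow> real" where
  "grid n k = a + real k * ((b - a) / real n)"

primrec scheme :: "nat \<Rightarrow> 'e \<Rightarrow> nat \<Rightarrow> 'e" where
  "scheme n y 0 = y"
| "scheme n y (Suc k) = \<mu> (grid n k) (grid n (Suc k)) (scheme n y k)"

lemma grid_bounds:
  assumes "0 < n"
  shows "a \<le> grid n i" "i \<le> j \<Longrightarrow> grid n i \<le> grid n j" "i \<le> n \<Longrightarrow> grid n i \<le> b"
proof -
  show "a \<le> grid n i" using ab by (simp add: grid_def)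
  show "i \<le> j \<Longrightarrow> grid n i \<le> grid n j"
    using ab by (auto simp: grid_def intro!: mult_right_mono divide_right_mono)
  assume "i \<le> n"
  then have "real i * ((b - a) / real n) \<le> real n * ((b - a) / real n)"
    using ab by (intro mult_right_mono) auto
  then show "grid n i \<le> b" using assms by (simp add: grid_def)
qed

lemma w_pos: "0 < w y" "0 \<le> w y"
  using w_ge_1[of y] by linarith+

lemma flow_diag: "a \<le> s \<Longrightarrow> s \<le> b \<Longrightarrow> \<mu> s s y = y"
  using flow_increment[of s s y] by simp

text \<open>Induction on the number of steps: cutting the index interval near its middle leaves two parts
  of relative length at most \<open>2/3\<close>, so the two inherited errors add up to the fraction
  \<open>(2/3) powr (\<theta> - 1) < 1\<close> of the allowed one; the remainder absorbs the new defect if \<open>K\<close> is large.\<close>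

lemma scheme_local_bound:
  obtains K \<delta> where "0 \<le> K" "0 < \<delta>"
    "\<And>n y i j. \<lbrakk>0 < n; i \<le> j; j \<le> n; grid n j - grid n i \<le> \<delta>\<rbrakk> \<Longrightarrow>
       norm (scheme n y j - \<mu> (grid n i) (grid n j) (scheme n y i))
         \<le> K * w (scheme n y i) * (grid n j - grid n i) powr \<theta>"
proof -
  define \<kappa> where "\<kappa> = (2/3) powr (\<theta> - 1)"
  have \<kappa>: "0 < \<kappa>" "\<kappa> < 1"
    using powr_less_mono2[of "\<theta> - 1" "2/3" 1] \<theta>_gt_1 by (auto simp: \<kappa>_def)
  \<comment> \<open>\<open>\<epsilon>\<close> spends half of the gap between \<open>\<kappa>\<close>
    and 1, since (1 + \<epsilon>)\<kappa> is their midpoint. \<open>K\<close> is then the fixed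
    point of the recursion K = K(1 + \<epsilon>)\<kappa> + C which the induction step
    produces.\<close>
  define \<epsilon> where "\<epsilon> = (1 - \<kappa>) / (2 * \<kappa>)"
  define K where "K = C / (1 - (1 + \<kappa>) / 2)"
  have \<epsilon>: "0 < \<epsilon>" "(1 + \<epsilon>) * \<kappa> = (1 + \<kappa>) / 2"
    using \<kappa> by (auto simp: \<epsilon>_def field_simps)
  have K: "0 \<le> K" "K * ((1 + \<epsilon>) * \<kappa>) + C = K"
    unfolding \<epsilon> using \<kappa> C_nonneg by (auto simp: K_def field_simps)
  \<comment> \<open>\<open>\<delta>\<close> is chosen after \<open>K\<close> and independently of
    the mesh: the first condition keeps the Lipschitz constant of the flow below 1 + \<epsilon>, the
    second keeps the weight from growing by more than that factor up to the cut.\<close>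
  have "((\<lambda>d. C * d powr \<alpha>) \<longlongrightarrow> C * 0 powr \<alpha>) (at_right 0)"
    using \<alpha>_pos by (intro tendsto_intros tendsto_powr'[of _ 0]) (auto simp: eventually_at_filter)
  then have "eventually (\<lambda>d. C * d powr \<alpha> < \<epsilon>) (at_right 0)"
    using \<epsilon>(1) by (intro order_tendstoD(2)[where y="C * 0 powr \<alpha>"]) auto
  moreover
  have "((\<lambda>d. L * (K * d powr \<theta> + C * d powr \<alpha>)) \<longlongrightarrow> L * (K * 0 powr \<theta> + C * 0 powr \<alpha>)) (at_right 0)"
    using \<alpha>_pos \<theta>_gt_1 by (intro tendsto_intros tendsto_powr'[of _ 0]) (auto simp: eventually_at_filter)
  then have "eventually (\<lambda>d. L * (K * d powr \<theta> + C * d powr \<alpha>) < \<epsilon>) (at_right 0)"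
    using \<epsilon>(1) by (intro order_tendstoD(2)[where y="L * (K * 0 powr \<theta> + C * 0 powr \<alpha>)"]) auto
  moreover have "eventually (\<lambda>d. (0::real) < d) (at_right 0)"
    by (rule eventually_at_right_less)
  ultimately have "eventually (\<lambda>d. 0 < d \<and> C * d powr \<alpha> < \<epsilon> \<and> L * (K * d powr \<theta> + C * d powr \<alpha>) < \<epsilon>) (at_right 0)"
    by eventually_elim simp
  then obtain \<delta> where \<delta>: "0 < \<delta>" "C * \<delta> powr \<alpha> < \<epsilon>" "L * (K * \<delta> powr \<theta> + C * \<delta> powr \<alpha>) < \<epsilon>"
    using eventually_happens[of _ "at_right (0::real)"] by (auto simp: trivial_limit_at_right_real)
  have main: "norm (scheme n y (i + d) - \<mu> (grid n i) (grid n (i + d)) (scheme n y i))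
         \<le> K * w (scheme n y i) * (grid n (i + d) - grid n i) powr \<theta>"
    if n: "0 < n" and "i + d \<le> n" "grid n (i + d) - grid n i \<le> \<delta>" for n y i d
    using that(2,3)
  proof (induction d arbitrary: i rule: less_induct)
    case (less d)
    let ?t = "grid n" and ?y = "scheme n y"
    \<comment> \<open>A single step needs its own case: halving would return the same step and the
      induction would not descend. There the scheme is the flow, so the error vanishes.\<close>
    consider "d = 0" | "d = 1" | "2 \<le> d" by linarith
    then show ?case
    proof cases
      case 1
      then show ?thesis using flow_diag[of "?t i"] grid_bounds[OF n] less.prems by simp
    next
      case 2
      then show ?thesis using K w_pos[of "?y i"] by simp
    next
      case 3
      \<comment> \<open>The ratio 2/3 is attained for \<open>d = 3\<close>, cut into 1 and
        2.\<close>
      define m where "m = d div 2"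
      let ?s = "?t i" and ?u = "?t (i + m)" and ?v = "?t (i + d)"
      define l\<^sub>1 where "l\<^sub>1 = ?u - ?s"
      define l\<^sub>2 where "l\<^sub>2 = ?v - ?u"
      have m: "m < d" "d - m < d" "i + m + (d - m) = i + d" "3 * m \<le> 2 * d" "3 * (d - m) \<le> 2 * d"
        using 3 by (auto simp: m_def)
      have ord: "a \<le> ?s" "?s \<le> ?u" "?u \<le> ?v" "?v \<le> b"
        using grid_bounds[OF n] less.prems(1) m(1) by auto
      have l: "0 \<le> l\<^sub>1" "0 \<le> l\<^sub>2" "l\<^sub>1 + l\<^sub>2 = ?v - ?s" "l\<^sub>1 \<le> \<delta>" "l\<^sub>2 \<le> \<delta>"
        using ord less.prems(2) by (auto simp: l\<^sub>1_def l\<^sub>2_def)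
      define h where "h = (b - a) / real n"
      have h: "0 \<le> h" using ab by (simp add: h_def)
      have lh: "l\<^sub>1 = real m * h" "l\<^sub>2 = real (d - m) * h"
        using m(1) by (auto simp: l\<^sub>1_def l\<^sub>2_def grid_def h_def[symmetric] of_nat_diff algebra_simps)
      have lh': "l\<^sub>1 + l\<^sub>2 = real d * h"
        using m(1) by (simp add: lh of_nat_diff algebra_simps)
      have "3 * real m \<le> 2 * real d" "3 * real (d - m) \<le> 2 * real d"
        using m(4,5) by linarith+
      from mult_right_mono[OF this(1) h] mult_right_mono[OF this(2) h]
      have l3: "l\<^sub>1 \<le> 2/3 * (l\<^sub>1 + l\<^sub>2)" "l\<^sub>2 \<le> 2/3 * (l\<^sub>1 + l\<^sub>2)"
        unfolding lh' unfolding lh by simp_all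
      have split: "l\<^sub>1 powr \<theta> + l\<^sub>2 powr \<theta> \<le> \<kappa> * (l\<^sub>1 + l\<^sub>2) powr \<theta>"
        unfolding \<kappa>_def using l l3 \<theta>_gt_1 by (intro powr_add_le_split) auto
      let ?w = "w (?y i)"
      have IH1: "norm (?y (i + m) - \<mu> ?s ?u (?y i)) \<le> K * ?w * l\<^sub>1 powr \<theta>"
        using less.IH[OF m(1), of i] less.prems(1) m(1) l by (simp add: l\<^sub>1_def)
      have IH2: "norm (?y (i + d) - \<mu> ?u ?v (?y (i + m))) \<le> K * w (?y (i + m)) * l\<^sub>2 powr \<theta>"
        using less.IH[OF m(2), of "i + m"] less.prems(1) m(3) l by (simp add: l\<^sub>2_def)
      have mono: "l\<^sub>1 powr \<theta> \<le> \<delta> powr \<theta>" "l\<^sub>1 powr \<alpha> \<le> \<delta> powr \<alpha>" "l\<^sub>2 powr \<alpha> \<le> \<delta> powr \<alpha>"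
        using l \<theta>_gt_1 \<alpha>_pos by (auto intro!: powr_mono2)
      have "norm (?y (i + m) - ?y i) \<le> K * ?w * l\<^sub>1 powr \<theta> + C * ?w * l\<^sub>1 powr \<alpha>"
        using IH1 flow_increment[OF ord(1,2) order_trans[OF ord(3,4)], of "?y i"]
          norm_triangle_ineq[of "?y (i + m) - \<mu> ?s ?u (?y i)" "\<mu> ?s ?u (?y i) - ?y i"]
        by (simp add: l\<^sub>1_def)
      also have "\<dots> \<le> K * ?w * \<delta> powr \<theta> + C * ?w * \<delta> powr \<alpha>"
        using K C_nonneg w_pos[of "?y i"] by (intro add_mono mult_left_mono mono) auto
      finally have "L * norm (?y (i + m) - ?y i) \<le> L * (K * ?w * \<delta> powr \<theta> + C * ?w * \<delta> powr \<alpha>)"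
        using L_nonneg by (rule mult_left_mono)
      also have "\<dots> = ?w * (L * (K * \<delta> powr \<theta> + C * \<delta> powr \<alpha>))"
        by (simp add: algebra_simps)
      also have "\<dots> \<le> ?w * \<epsilon>"
        using \<delta>(3) w_pos[of "?y i"] by (intro mult_left_mono) auto
      finally have wm: "w (?y (i + m)) \<le> (1 + \<epsilon>) * ?w"
        using w_lipschitz[of "?y (i + m)" "?y i"] by (simp add: algebra_simps)
      have 1: "norm (?y (i + d) - \<mu> ?u ?v (?y (i + m))) \<le> K * ((1 + \<epsilon>) * ?w) * l\<^sub>2 powr \<theta>"
        by (rule order_trans[OF IH2]) (use K wm in \<open>auto intro!: mult_right_mono mult_left_mono\<close>)
      have "norm (\<mu> ?u ?v (?y (i + m)) - \<mu> ?u ?v (\<mu> ?s ?u (?y i)))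
          \<le> (1 + C * l\<^sub>2 powr \<alpha>) * norm (?y (i + m) - \<mu> ?s ?u (?y i))"
        using flow_lipschitz[of ?u ?v] ord by (simp add: l\<^sub>2_def)
      also have "C * l\<^sub>2 powr \<alpha> \<le> C * \<delta> powr \<alpha>"
        using C_nonneg by (intro mult_left_mono mono)
      then have "(1 + C * l\<^sub>2 powr \<alpha>) * norm (?y (i + m) - \<mu> ?s ?u (?y i))
          \<le> (1 + \<epsilon>) * (K * ?w * l\<^sub>1 powr \<theta>)"
        using \<delta>(2) \<epsilon>(1) by (intro mult_mono IH1) auto
      finally have 2: "norm (\<mu> ?u ?v (?y (i + m)) - \<mu> ?u ?v (\<mu> ?s ?u (?y i)))
          \<le> (1 + \<epsilon>) * (K * ?w * l\<^sub>1 powr \<theta>)" .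
      have 3: "norm (\<mu> ?u ?v (\<mu> ?s ?u (?y i)) - \<mu> ?s ?v (?y i)) \<le> C * ?w * (l\<^sub>1 + l\<^sub>2) powr \<theta>"
        unfolding l(3) by (rule flow_defect[OF ord])
      \<comment> \<open>Three links: the error of the second part, the error of the first part
        transported by the flow, and one new defect. Each inherited error has picked up one factor 1
        + \<epsilon>, through the weight or through the transport.\<close>
      have "norm (?y (i + d) - \<mu> ?s ?v (?y i))
         \<le> K * ((1 + \<epsilon>) * ?w) * l\<^sub>2 powr \<theta> + (1 + \<epsilon>) * (K * ?w * l\<^sub>1 powr \<theta>) + C * ?w * (l\<^sub>1 + l\<^sub>2) powr \<theta>"
        using norm_triangle_le[OF add_mono[OF norm_triangle_le[OF add_mono[OF 1 2]] 3]] by simp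
      also have "\<dots> = K * ((1 + \<epsilon>) * ?w) * (l\<^sub>1 powr \<theta> + l\<^sub>2 powr \<theta>) + C * ?w * (l\<^sub>1 + l\<^sub>2) powr \<theta>"
        by (simp add: algebra_simps)
      also have "\<dots> \<le> K * ((1 + \<epsilon>) * ?w) * (\<kappa> * (l\<^sub>1 + l\<^sub>2) powr \<theta>) + C * ?w * (l\<^sub>1 + l\<^sub>2) powr \<theta>"
        using K \<epsilon>(1) w_pos[of "?y i"] by (intro add_right_mono mult_left_mono split) auto
      also have "\<dots> = (K * ((1 + \<epsilon>) * \<kappa>) + C) * (?w * (l\<^sub>1 + l\<^sub>2) powr \<theta>)"
        by (simp add: algebra_simps)
      also have "\<dots> = K * ?w * (?v - ?s) powr \<theta>"
        unfolding K(2) l(3) by simp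
      finally show ?thesis .
    qed
  qed
  show ?thesis
  proof (rule that[of K \<delta>])
    fix n y i j assume "0 < n" "i \<le> j" "j \<le> n" "grid n j - grid n i \<le> \<delta>"
    then show "norm (scheme n y j - \<mu> (grid n i) (grid n j) (scheme n y i))
         \<le> K * w (scheme n y i) * (grid n j - grid n i) powr \<theta>"
      using main[of n i "j - i" y] by simp
  qed (use K \<delta> in auto)
qed


lemma scheme_bound_step:
  assumes K: "0 \<le> K" and step: "0 < n" "i \<le> j" "j \<le> n" "grid n j - grid n i \<le> \<delta>"
    and defect: "norm (scheme n y j - \<mu> (grid n i) (grid n j) (scheme n y i))
         \<le> K * w (scheme n y i) * (grid n j - grid n i) powr \<theta>"
  shows "norm (scheme n y j - scheme n y i) \<le> (K * \<delta> powr \<theta> + C * \<delta> powr \<alpha>) * w (scheme n y i)"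
proof -
  let ?s = "grid n i" and ?t = "grid n j" and ?w = "w (scheme n y i)"
  have ord: "a \<le> ?s" "?s \<le> ?t" "?t \<le> b"
    using grid_bounds[OF step(1)] step by auto
  have "norm (scheme n y j - scheme n y i) \<le> K * ?w * (?t - ?s) powr \<theta> + C * ?w * (?t - ?s) powr \<alpha>"
    using norm_triangle_le[OF add_mono[OF defect flow_increment[OF ord, of "scheme n y i"]]] by simp
  also have "\<dots> \<le> K * ?w * \<delta> powr \<theta> + C * ?w * \<delta> powr \<alpha>"
    using K C_nonneg w_pos step(4) ord \<theta>_gt_1 \<alpha>_pos
    by (intro add_mono mult_left_mono powr_mono2) auto
  finally show ?thesis by (simp add: algebra_simps)
qed

text \<open>A discrete Gronwall argument: [a,b] is covered by a number of blocks that does not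
  depend on \<open>n\<close>, and each block multiplies the bound by a fixed factor. Blocks have
  length \<delta>/2 because their ends need not be grid points; reaching back to the last grid point
  costs one more mesh, also at most \<delta>/2.\<close>

lemma scheme_bounded:
  assumes K: "0 \<le> K" and \<delta>: "0 < \<delta>"
    and defect: "\<And>n i j. \<lbrakk>0 < n; i \<le> j; j \<le> n; grid n j - grid n i \<le> \<delta>\<rbrakk> \<Longrightarrow>
       norm (scheme n y j - \<mu> (grid n i) (grid n j) (scheme n y i))
         \<le> K * w (scheme n y i) * (grid n j - grid n i) powr \<theta>"
  obtains W where "\<And>n j. \<lbrakk>0 < n; (b - a) / real n \<le> \<delta> / 2; j \<le> n\<rbrakk> \<Longrightarrow>
       w (scheme n y j) \<le> W \<and> norm (scheme n y j) \<le> W"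
proof -
  let ?P = "K * \<delta> powr \<theta> + C * \<delta> powr \<alpha>"
  have P: "0 \<le> ?P" using K C_nonneg by simp
  have ex: "\<exists>W. \<forall>n j. 0 < n \<and> (b - a) / real n \<le> \<delta> / 2 \<and> j \<le> n \<and> grid n j - a \<le> real k * (\<delta> / 2) \<longrightarrow>
       w (scheme n y j) \<le> W \<and> norm (scheme n y j) \<le> W" for k
  proof (induction k)
    case 0
    show ?case
    proof (intro exI[of _ "max (w y) (norm y)"] allI impI)
      fix n j assume n: "0 < n \<and> (b - a) / real n \<le> \<delta> / 2 \<and> j \<le> n \<and> grid n j - a \<le> real 0 * (\<delta> / 2)"
      moreover have "0 < (b - a) / real n" using ab n by simp
      moreover have "real j * ((b - a) / real n) \<le> 0" using n by (simp add: grid_def)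
      ultimately have "j = 0" by (simp only: mult_le_0_iff) auto
      then show "w (scheme n y j) \<le> max (w y) (norm y) \<and> norm (scheme n y j) \<le> max (w y) (norm y)"
        by simp
    qed
  next
    case (Suc k)
    then obtain W where W: "\<And>n j. 0 < n \<Longrightarrow> (b - a) / real n \<le> \<delta> / 2 \<Longrightarrow> j \<le> n \<Longrightarrow>
        grid n j - a \<le> real k * (\<delta> / 2) \<Longrightarrow> w (scheme n y j) \<le> W \<and> norm (scheme n y j) \<le> W"
      by blast
    \<comment> \<open>One constant serves both bounds: the norm grows by at most
      \<open>?P * W\<close> and the weight by \<open>L\<close> times that.\<close>
    show ?case
    proof (intro exI[of _ "W + (L + 1) * (?P * W)"] allI impI)
      fix n j assume "0 < n \<and> (b - a) / real n \<le> \<delta> / 2 \<and> j \<le> n \<and> grid n j - a \<le> real (Suc k) * (\<delta> / 2)"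
      then have n: "0 < n" and h2: "(b - a) / real n \<le> \<delta> / 2" and j: "j \<le> n"
        and le: "grid n j - a \<le> real (Suc k) * (\<delta> / 2)" by auto
      define h where "h = (b - a) / real n"
      have h: "0 < h" "h \<le> \<delta> / 2" using ab n h2 by (auto simp: h_def)
      have grid: "grid n i = a + real i * h" for i by (simp add: grid_def h_def)
      obtain i where i: "i \<le> j" "grid n i - a \<le> real k * (\<delta> / 2)" "grid n j - grid n i \<le> \<delta>"
      proof (cases "grid n j - a \<le> real k * (\<delta> / 2)")
        case True
        then show ?thesis using that[of j] \<delta> by simp
      next
        case False
        define i where "i = nat \<lfloor>real k * (\<delta> / 2) / h\<rfloor>"
        have "0 \<le> real k * (\<delta> / 2) / h" using \<delta> h by simp
        then have "real i \<le> real k * (\<delta> / 2) / h" "real k * (\<delta> / 2) / h < real i + 1"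
          by (auto simp: i_def)
        then have i: "real i * h \<le> real k * (\<delta> / 2)" "real k * (\<delta> / 2) < real i * h + h"
          using h by (auto simp: field_simps)
        have "real i * h < real j * h" using i(1) False by (simp add: grid)
        then have "i \<le> j" using h by simp
        moreover have "grid n j - grid n i \<le> \<delta>"
          using le i(2) h by (simp add: grid algebra_simps)
        ultimately show ?thesis using that[of i] i by (simp add: grid)
      qed
      let ?z = "scheme n y i"
      have Wi: "w ?z \<le> W" "norm ?z \<le> W" using W[OF n h2 order_trans[OF i(1) j] i(2)] by auto
      have "norm (scheme n y j - ?z) \<le> ?P * w ?z"
        by (rule scheme_bound_step[OF K n i(1) j i(3) defect[OF n i(1) j i(3)]])
      also have "\<dots> \<le> ?P * W" using P Wi by (intro mult_left_mono)
      finally have d: "norm (scheme n y j - ?z) \<le> ?P * W" .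
      have PW: "0 \<le> ?P * W" using order_trans[OF norm_ge_zero d] .
      have "w (scheme n y j) \<le> W + L * (?P * W)"
        using w_lipschitz[of "scheme n y j" ?z] mult_left_mono[OF d L_nonneg] Wi by linarith
      moreover have "norm (scheme n y j) \<le> W + ?P * W"
        using norm_triangle_sub[of "scheme n y j" ?z] d Wi by linarith
      ultimately show "w (scheme n y j) \<le> W + (L + 1) * (?P * W) \<and>
          norm (scheme n y j) \<le> W + (L + 1) * (?P * W)"
        using PW mult_nonneg_nonneg[OF L_nonneg PW] by (simp add: algebra_simps)
    qed
  qed
  obtain k where k: "(b - a) / (\<delta> / 2) \<le> real k" using real_arch_simple by blast
  obtain W where W: "\<And>n j. 0 < n \<Longrightarrow> (b - a) / real n \<le> \<delta> / 2 \<Longrightarrow> j \<le> n \<Longrightarrow>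
        grid n j - a \<le> real k * (\<delta> / 2) \<Longrightarrow> w (scheme n y j) \<le> W \<and> norm (scheme n y j) \<le> W"
    using ex[of k] by blast
  show ?thesis
  proof (rule that)
    fix n j assume n: "0 < n" "(b - a) / real n \<le> \<delta> / 2" "j \<le> n"
    have "grid n j - a \<le> b - a" using grid_bounds(3)[OF n(1,3)] by simp
    also have "\<dots> \<le> real k * (\<delta> / 2)" using k \<delta> by (simp add: field_simps)
    finally show "w (scheme n y j) \<le> W \<and> norm (scheme n y j) \<le> W" by (rule W[OF n])
  qed
qed

text \<open>The cap at \<open>n\<close>, like \<open>nat\<close> sending negative values to 0, gives
  the step functions values of the scheme at every real time, also outside [a,b]. The compactness
  argument needs a bound at all times.\<close>

definition idx :: "nat \<Rightarrow> real \<Rightarrow> nat" where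
  "idx n t = min n (nat \<lfloor>(t - a) / ((b - a) / real n)\<rfloor>)"

lemma idx_props:
  assumes n: "0 < n" and t: "a \<le> t" "t \<le> b"
  shows "idx n t \<le> n" "grid n (idx n t) \<le> t" "t \<le> grid n (idx n t) + (b - a) / real n"
    "t \<le> u \<Longrightarrow> idx n t \<le> idx n u"
proof -
  define h where "h = (b - a) / real n"
  have h: "0 < h" "real n * h = b - a" using ab n by (auto simp: h_def)
  define i where "i = nat \<lfloor>(t - a) / h\<rfloor>"
  have "0 \<le> (t - a) / h" using t h by simp
  then have "real i \<le> (t - a) / h" "(t - a) / h < real i + 1"
    by (auto simp: i_def)
  then have i: "real i * h \<le> t - a" "t - a < real i * h + h"
    using h by (auto simp: field_simps)
  have "real i * h \<le> real n * h" using i(1) t h(2) by linarith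
  then have "i \<le> n" using mult_right_le_imp_le[OF _ h(1)] of_nat_le_iff by blast
  then have idx: "idx n t = i" by (simp add: idx_def i_def h_def)
  show "idx n t \<le> n" "grid n (idx n t) \<le> t" "t \<le> grid n (idx n t) + (b - a) / real n"
    using \<open>i \<le> n\<close> i by (auto simp: idx grid_def h_def)
  assume "t \<le> u"
  then show "idx n t \<le> idx n u"
    unfolding idx_def using ab by (intro min.mono nat_mono floor_mono divide_right_mono) auto
qed

text \<open>The flow need not depend continuously on time: the endpoints \<open>s\<close>, \<open>t\<close> are moved to grid points
  by applying \<open>flow_defect\<close> twice.\<close>

lemma step_function_defect:
  assumes K: "0 \<le> K" and n: "0 < n" and st: "a \<le> s" "s < t" "t \<le> b" and h: "(b - a) / real n \<le> t - s"
    and defect: "norm (scheme n y (idx n t) - \<mu> (grid n (idx n s)) (grid n (idx n t)) (scheme n y (idx n s)))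
         \<le> K * w (scheme n y (idx n s)) * (grid n (idx n t) - grid n (idx n s)) powr \<theta>"
    and W: "w (scheme n y (idx n s)) \<le> W"
  defines "h \<equiv> (b - a) / real n"
  shows "norm (scheme n y (idx n t) - \<mu> s t (scheme n y (idx n s)))
    \<le> (K + 2 * C) * W * (t - s + h) powr \<theta>
       + (1 + (L + 1) * C * (b - a) powr \<alpha>) * (C * W) * h powr \<alpha>
       + (1 + C * (b - a) powr \<alpha>) * (C * W) * h powr \<alpha>"
proof -
  let ?s = "grid n (idx n s)" and ?t = "grid n (idx n t)" and ?z = "scheme n y (idx n s)"
  let ?A = "(b - a) powr \<alpha>" and ?R = "(t - s + h) powr \<theta>"
  \<comment> \<open>As the mesh is at most \<open>t - s\<close>, the grid point \<open>?t\<close>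
    does not fall below \<open>s\<close>. Hence \<open>?s\<close>, \<open>s\<close>,
    \<open>?t\<close>, \<open>t\<close> are ordered and every piece of the flow runs
    forward.\<close>
  have s: "a \<le> ?s" "?s \<le> s" "s \<le> ?s + h" and t: "s \<le> ?t" "?t \<le> t" "t \<le> ?t + h"
    using idx_props[OF n, of s] idx_props[OF n, of t] st h grid_bounds(1)[OF n] by (auto simp: h_def)
  have W0: "0 \<le> W" "0 \<le> w ?z" using W w_pos[of ?z] by auto
  have R: "(?t - ?s) powr \<theta> \<le> ?R" "(t - ?s) powr \<theta> \<le> ?R"
    using s t \<theta>_gt_1 by (auto intro!: powr_mono2)
  have A: "(?t - ?s) powr \<alpha> \<le> ?A" "(t - s) powr \<alpha> \<le> ?A"
    using s t st \<alpha>_pos by (auto intro!: powr_mono2)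
  have 1: "norm (scheme n y (idx n t) - \<mu> ?s ?t ?z) \<le> K * W * ?R"
    by (rule order_trans[OF defect]) (use K W W0 R in \<open>auto intro!: mult_mono\<close>)
  have "norm (\<mu> ?s ?t ?z - ?z) \<le> C * w ?z * (?t - ?s) powr \<alpha>"
    using flow_increment[of ?s ?t] s t st by auto
  also have "\<dots> \<le> C * W * ?A"
    using C_nonneg W W0 A by (intro mult_mono) auto
  finally have "L * norm (\<mu> ?s ?t ?z - ?z) \<le> L * (C * W * ?A)"
    using L_nonneg by (rule mult_left_mono)
  then have "w (\<mu> ?s ?t ?z) \<le> W + L * (C * W * ?A)"
    using w_lipschitz[of "\<mu> ?s ?t ?z" ?z] W by linarith
  also have "\<dots> = (1 + L * C * ?A) * W" by (simp add: algebra_simps)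
  also have "\<dots> \<le> (1 + (L + 1) * C * ?A) * W"
    using W0 C_nonneg L_nonneg by (intro mult_right_mono add_left_mono) auto
  finally have w': "w (\<mu> ?s ?t ?z) \<le> (1 + (L + 1) * C * ?A) * W" .
  have "norm (\<mu> ?t t (\<mu> ?s ?t ?z) - \<mu> ?s ?t ?z) \<le> C * w (\<mu> ?s ?t ?z) * (t - ?t) powr \<alpha>"
    using flow_increment[of ?t t] s t st by auto
  also have "\<dots> \<le> C * ((1 + (L + 1) * C * ?A) * W) * h powr \<alpha>"
    using C_nonneg w' w_pos[of "\<mu> ?s ?t ?z"] W0 s t \<alpha>_pos L_nonneg
    by (intro mult_mono powr_mono2) auto
  finally have 2: "norm (\<mu> ?s ?t ?z - \<mu> ?t t (\<mu> ?s ?t ?z)) \<le> (1 + (L + 1) * C * ?A) * (C * W) * h powr \<alpha>"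
    by (simp add: norm_minus_commute algebra_simps)
  have CR: "C * w ?z * (t - ?s) powr \<theta> \<le> C * W * ?R"
    using C_nonneg W W0 R by (intro mult_mono) auto
  have 3: "norm (\<mu> ?t t (\<mu> ?s ?t ?z) - \<mu> ?s t ?z) \<le> C * W * ?R"
    by (rule order_trans[OF flow_defect CR]) (use s t st in auto)
  have 4: "norm (\<mu> ?s t ?z - \<mu> s t (\<mu> ?s s ?z)) \<le> C * W * ?R"
    unfolding norm_minus_commute[of "\<mu> ?s t ?z"]
    by (rule order_trans[OF flow_defect CR]) (use s t st in auto)
  have "norm (\<mu> ?s s ?z - ?z) \<le> C * w ?z * (s - ?s) powr \<alpha>"
    using flow_increment[of ?s s] s st by auto
  also have "\<dots> \<le> C * W * h powr \<alpha>"
    using C_nonneg W W0 s \<alpha>_pos by (intro mult_mono powr_mono2) auto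
  finally have i5: "norm (\<mu> ?s s ?z - ?z) \<le> C * W * h powr \<alpha>" .
  have "norm (\<mu> s t (\<mu> ?s s ?z) - \<mu> s t ?z) \<le> (1 + C * (t - s) powr \<alpha>) * norm (\<mu> ?s s ?z - ?z)"
    using flow_lipschitz[of s t] st by auto
  also have "\<dots> \<le> (1 + C * ?A) * (C * W * h powr \<alpha>)"
    using C_nonneg A i5 by (intro mult_mono add_left_mono mult_left_mono) auto
  finally have 5: "norm (\<mu> s t (\<mu> ?s s ?z) - \<mu> s t ?z) \<le> (1 + C * ?A) * (C * W) * h powr \<alpha>"
    by (simp add: mult.assoc)
  \<comment> \<open>The five links: scheme error between grid points, the incomplete last step up to
    \<open>t\<close>, two defects (the source of \<open>2 * C\<close>), and the displacement of the
    base point from \<open>?s\<close> to \<open>s\<close>.\<close>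
  have "norm (scheme n y (idx n t) - \<mu> s t ?z) \<le> K * W * ?R + (1 + (L + 1) * C * ?A) * (C * W) * h powr \<alpha>
      + C * W * ?R + C * W * ?R + (1 + C * ?A) * (C * W) * h powr \<alpha>"
    using norm_triangle_le[OF add_mono[OF norm_triangle_le[OF add_mono[OF norm_triangle_le[OF
        add_mono[OF norm_triangle_le[OF add_mono[OF 1 2]] 3]] 4]] 5]] by simp
  then show ?thesis by (simp add: algebra_simps)
qed

theorem solution_exists:
  obtains y K where "y a = y0"
    "\<And>s t. \<lbrakk>a \<le> s; s \<le> t; t \<le> b\<rbrakk> \<Longrightarrow> norm (y t - \<mu> s t (y s)) \<le> K * (t - s) powr \<theta>"
proof -
  obtain K \<delta> where K: "0 \<le> K" and \<delta>: "0 < \<delta>"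
    and defect: "\<And>n i j. \<lbrakk>0 < n; i \<le> j; j \<le> n; grid n j - grid n i \<le> \<delta>\<rbrakk> \<Longrightarrow>
       norm (scheme n y0 j - \<mu> (grid n i) (grid n j) (scheme n y0 i))
         \<le> K * w (scheme n y0 i) * (grid n j - grid n i) powr \<theta>"
    using scheme_local_bound by metis
  obtain W where W: "\<And>n j. \<lbrakk>0 < n; (b - a) / real n \<le> \<delta> / 2; j \<le> n\<rbrakk> \<Longrightarrow>
       w (scheme n y0 j) \<le> W \<and> norm (scheme n y0 j) \<le> W"
    using scheme_bounded[OF K \<delta> defect] by blast
  define Y where "Y n t = scheme n y0 (idx n t)" for n t
  have h0: "(\<lambda>n. (b - a) / real n) \<longlonglongrightarrow> 0"
    by (rule lim_const_over_n)
  have small: "eventually (\<lambda>n. 0 < n \<and> (b - a) / real n \<le> d) sequentially" if "0 < d" for d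
    using eventually_gt_at_top[of 0] order_tendstoD(2)[OF h0 that] by eventually_elim simp
  have "eventually (\<lambda>n. \<forall>t. norm (Y n t) \<le> W) sequentially"
    using small[of "\<delta> / 2"] \<delta> W by (auto simp: Y_def idx_def elim!: eventually_mono)
  then obtain y where y: "\<And>S. closed S \<Longrightarrow> eventually (\<lambda>n. Y n \<in> S) sequentially \<Longrightarrow> y \<in> S"
    using cluster_point_product by blast
  have coord: "continuous_on UNIV (\<lambda>z::real \<Rightarrow> 'e. z t)" for t
    by (rule continuous_on_product_coordinates)
  have ya: "y a = y0"
  proof -
    have "closed {z::real \<Rightarrow> 'e. z a = y0}"
      by (intro closed_Collect_eq coord continuous_on_const)
    then show ?thesis using y[of "{z. z a = y0}"] by (simp add: Y_def idx_def)
  qed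
  have bounded: "norm (y t) \<le> W" for t
  proof -
    have "closed {z::real \<Rightarrow> 'e. norm (z t) \<le> W}"
      by (intro closed_Collect_le continuous_on_norm coord continuous_on_const)
    moreover have "eventually (\<lambda>n. norm (Y n t) \<le> W) sequentially"
      using small[of "\<delta> / 2"] \<delta> W by (auto simp: Y_def idx_def elim!: eventually_mono)
    ultimately show ?thesis using y[of "{z. norm (z t) \<le> W}"] by simp
  qed
  have "0 \<le> W" using bounded[of a] norm_ge_zero order_trans by blast
  \<comment> \<open>Moving to grid points may lengthen the interval by one mesh, at most \<delta>/2
    in the end, so starting from \<delta>/2 keeps the grid distance within \<delta>.\<close>
  have local_bound: "norm (y t - \<mu> s t (y s)) \<le> (K + 2 * C) * W * (t - s) powr \<theta>"
    if st: "a \<le> s" "s < t" "t \<le> b" "t - s \<le> \<delta> / 2" for s t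
  proof -
    define c where "c h = (K + 2 * C) * W * (t - s + h) powr \<theta>
       + (1 + (L + 1) * C * (b - a) powr \<alpha>) * (C * W) * h powr \<alpha>
       + (1 + C * (b - a) powr \<alpha>) * (C * W) * h powr \<alpha>" for h
    have \<mu>_cont: "continuous_on UNIV (\<mu> s t)"
    proof (rule lipschitz_on_continuous_on)
      show "(1 + C * (t - s) powr \<alpha>)-lipschitz_on UNIV (\<mu> s t)"
        using flow_lipschitz[of s t] st C_nonneg by (intro lipschitz_onI) (auto simp: dist_norm)
    qed
    have ev: "eventually (\<lambda>n. norm (Y n t - \<mu> s t (Y n s)) \<le> c ((b - a) / real n)) sequentially"
    proof (rule eventually_elim2[OF small[of "\<delta> / 2"] small[of "t - s"]])
      show "0 < \<delta> / 2" "0 < t - s" using \<delta> st by auto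
      fix n assume n1: "0 < n \<and> (b - a) / real n \<le> \<delta> / 2" and n2: "0 < n \<and> (b - a) / real n \<le> t - s"
      have le: "idx n s \<le> idx n t" "idx n t \<le> n" using idx_props[of n s] idx_props[of n t] st n1 by auto
      moreover have "grid n (idx n t) - grid n (idx n s) \<le> \<delta>"
        using idx_props(3)[of n s] idx_props(2)[of n t] st n1 by linarith
      ultimately show "norm (Y n t - \<mu> s t (Y n s)) \<le> c ((b - a) / real n)"
        unfolding Y_def c_def
        using n1 n2 st W by (intro step_function_defect[OF K] defect) auto
    qed
    have "(c \<longlongrightarrow> (K + 2 * C) * W * (t - s + 0) powr \<theta>
       + (1 + (L + 1) * C * (b - a) powr \<alpha>) * (C * W) * 0 powr \<alpha>
       + (1 + C * (b - a) powr \<alpha>) * (C * W) * 0 powr \<alpha>) (at_right 0)"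
      unfolding c_def using \<alpha>_pos \<theta>_gt_1 st
      by (intro tendsto_intros tendsto_powr'[of _ 0]) (auto simp: eventually_at_filter)
    then have c0: "(c \<longlongrightarrow> (K + 2 * C) * W * (t - s) powr \<theta>) (at_right 0)" by simp
    have "filterlim (\<lambda>n. (b - a) / real n) (at_right 0) sequentially"
      using h0 ab by (auto simp: filterlim_at intro!: eventually_mono[OF eventually_gt_at_top[of 0]])
    then have cn: "(\<lambda>n. c ((b - a) / real n)) \<longlonglongrightarrow> (K + 2 * C) * W * (t - s) powr \<theta>"
      by (rule filterlim_compose[OF c0])
    show ?thesis
    \<comment> \<open>The bound \<open>c\<close> changes with \<open>n\<close>; raising its limit by
      \<open>e\<close> gives one condition valid from some \<open>n\<close> on. It is closed because
      \<open>\<mu> s t\<close> is continuous in the base point.\<close>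
    proof (rule field_le_epsilon)
      fix e :: real assume "0 < e"
      let ?c = "(K + 2 * C) * W * (t - s) powr \<theta> + e"
      have "eventually (\<lambda>n. c ((b - a) / real n) < ?c) sequentially"
        using order_tendstoD(2)[OF cn, of ?c] \<open>0 < e\<close> by simp
      with ev have "eventually (\<lambda>n. norm (Y n t - \<mu> s t (Y n s)) \<le> ?c) sequentially"
        by eventually_elim simp
      moreover have "closed {z::real \<Rightarrow> 'e. norm (z t - \<mu> s t (z s)) \<le> ?c}"
        by (intro closed_Collect_le continuous_on_norm continuous_on_diff coord continuous_on_const
            continuous_on_compose2[OF \<mu>_cont coord]) auto
      ultimately show "norm (y t - \<mu> s t (y s)) \<le> ?c"
        using y[of "{z. norm (z t - \<mu> s t (z s)) \<le> ?c}"] by simp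
    qed
  qed
  define W' where "W' = w 0 + L * W"
  have W': "w (y t) \<le> W'" for t
    using w_lipschitz[of "y t" 0] mult_left_mono[OF bounded[of t] L_nonneg] by (simp add: W'_def)
  \<comment> \<open>The second summand covers \<open>t - s\<close> above \<delta>/2, where
    boundedness of the path and of the flow increment is enough.\<close>
  define K' where "K' = (K + 2 * C) * W + (2 * W + C * W' * (b - a) powr \<alpha>) / (\<delta> / 2) powr \<theta>"
  have "0 \<le> W'" using W'[of a] w_pos[of "y a"] by linarith
  show ?thesis
  proof (rule that[of y, OF ya])
    fix s t assume st: "a \<le> s" "s \<le> t" "t \<le> b"
    consider "s = t" | "s < t" "t - s \<le> \<delta> / 2" | "\<delta> / 2 < t - s" using st by linarith
    then show "norm (y t - \<mu> s t (y s)) \<le> K' * (t - s) powr \<theta>"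
    proof cases
      case 1
      then show ?thesis using flow_diag[of s] st by simp
    next
      case 2
      have "norm (y t - \<mu> s t (y s)) \<le> (K + 2 * C) * W * (t - s) powr \<theta>"
        using local_bound 2 st by simp
      also have "\<dots> \<le> K' * (t - s) powr \<theta>"
        unfolding K'_def using \<open>0 \<le> W\<close> \<open>0 \<le> W'\<close> C_nonneg \<delta> by (intro mult_right_mono) auto
      finally show ?thesis .
    next
      case 3
      have "norm (\<mu> s t (y s) - y s) \<le> C * w (y s) * (t - s) powr \<alpha>"
        by (rule flow_increment[OF st])
      also have "\<dots> \<le> C * W' * (b - a) powr \<alpha>"
        using C_nonneg W' \<open>0 \<le> W'\<close> st \<alpha>_pos w_pos[of "y s"] by (intro mult_mono powr_mono2) auto
      finally have "norm (y t - \<mu> s t (y s)) \<le> 2 * W + C * W' * (b - a) powr \<alpha>"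
        using norm_triangle_ineq4[of "y t" "\<mu> s t (y s)"] norm_triangle_sub[of "\<mu> s t (y s)" "y s"]
          bounded[of t] bounded[of s] by linarith
      also have "\<dots> = (2 * W + C * W' * (b - a) powr \<alpha>) / (\<delta> / 2) powr \<theta> * (\<delta> / 2) powr \<theta>"
        using \<delta> by simp
      also have "\<dots> \<le> (2 * W + C * W' * (b - a) powr \<alpha>) / (\<delta> / 2) powr \<theta> * (t - s) powr \<theta>"
        using 3 \<delta> \<theta>_gt_1 \<open>0 \<le> W\<close> \<open>0 \<le> W'\<close> C_nonneg by (intro mult_left_mono powr_mono2) auto
      also have "\<dots> \<le> K' * (t - s) powr \<theta>"
        unfolding K'_def using \<open>0 \<le> W\<close> C_nonneg K by (intro mult_right_mono) auto
      finally show ?thesis .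
    qed
  qed
qed

end

section \<open>The symmetric part of the second level\<close>

lemma norm_le_p_variation:
  assumes "a \<le> s" "s < t" "t \<le> b" "0 < q"
  shows "ennreal (norm (Z s t)) \<le> p_variation q a b Z"
proof -
  \<comment> \<open>Partitions are strictly increasing, so \<open>a\<close> and \<open>b\<close> may
    be added as separate points only if they differ from \<open>s\<close> and
    \<open>t\<close>.\<close>
  define n1 n2 where "n1 = (if a < s then 1 else 0 :: nat)" and "n2 = (if t < b then 1 else 0 :: nat)"
  define D where "D i = (if i < n1 then a else if i = n1 then s else if i = n1 + 1 then t else b)" for i
  let ?n = "n1 + 1 + n2"
  have part: "is_partition ?n D a b"
    using assms by (auto simp: is_partition_def D_def n1_def n2_def)
  have "norm (Z s t) = (norm (Z (D n1) (D (Suc n1))) powr q) powr (1 / q)"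
    using assms by (simp add: powr_powr D_def)
  also have "\<dots> \<le> (\<Sum>i<?n. norm (Z (D i) (D (Suc i))) powr q) powr (1 / q)"
    using assms by (intro powr_mono2 member_le_sum) auto
  finally have "ennreal (norm (Z s t)) \<le> ennreal ((\<Sum>i<?n. norm (Z (D i) (D (Suc i))) powr q) powr (1 / q))"
    by (rule ennreal_leI)
  also have "\<dots> \<le> p_variation q a b Z"
    unfolding p_variation_def by (rule SUP_upper2[of "(?n, D)"]) (use part in auto)
  finally show ?thesis .
qed

lemma p_variation_tendsto_zeroD:
  fixes Z :: "nat \<Rightarrow> real \<Rightarrow> real \<Rightarrow> 'v::real_normed_vector"
  assumes "(\<lambda>n. p_variation q a b (\<lambda>s t. Z n s t - Y s t)) \<longlonglongrightarrow> 0"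
    and "a \<le> s" "s < t" "t \<le> b" "0 < q"
  shows "(\<lambda>n. Z n s t) \<longlonglongrightarrow> Y s t"
proof -
  have le: "ennreal (norm (Z n s t - Y s t)) \<le> p_variation q a b (\<lambda>s t. Z n s t - Y s t)" for n
    by (rule norm_le_p_variation[OF assms(2-5), of "\<lambda>s t. Z n s t - Y s t"])
  have "(\<lambda>n. ennreal (norm (Z n s t - Y s t))) \<longlonglongrightarrow> 0"
    by (rule tendsto_sandwich[OF _ _ tendsto_const assms(1)]) (auto simp: le)
  then have "(\<lambda>n. norm (Z n s t - Y s t)) \<longlonglongrightarrow> 0"
    by (simp only: ennreal_tendsto_0_iff[OF norm_ge_zero])
  then show ?thesis by (rule LIM_zero_cancel[OF tendsto_norm_zero_cancel])
qed

text \<open>\<open>dyadic_approx\<close> selects half-open cells, so at the right end point it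
  already uses the next cell, whose formula gives the same value there. Closed cells are what the
  gluing argument for continuity needs.\<close>

lemma dyadic_approx_on_cell:
  assumes "a < b" and v: "dyadic_point a b n k \<le> v" "v \<le> dyadic_point a b n (Suc k)"
  shows "dyadic_approx a b n x v = x (dyadic_point a b n k) +
    ((v - dyadic_point a b n k) / ((b - a) / 2 ^ n)) *\<^sub>R
      (x (dyadic_point a b n (Suc k)) - x (dyadic_point a b n k))"
proof -
  define h where "h = (b - a) / 2 ^ n"
  have h: "0 < h" using assms by (simp add: h_def)
  have p: "dyadic_point a b n k = a + real k * h" for k by (simp add: dyadic_point_def h_def)
  have q: "2 ^ n * (v - a) / (b - a) = (v - a) / h" by (simp add: h_def)
  show ?thesis
  proof (cases "v = dyadic_point a b n (Suc k)")
    case True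
    then have "(v - a) / h = real (Suc k)" using h by (simp add: p)
    then have "nat \<lfloor>2 ^ n * (v - a) / (b - a)\<rfloor> = Suc k" unfolding q by simp
    with True h show ?thesis
      by (simp add: dyadic_approx_def Let_def h_def[symmetric]) (simp add: p algebra_simps)
  next
    case False
    have "real k \<le> (v - a) / h" "(v - a) / h < real k + 1"
      using v False h by (auto simp: p field_simps)
    then have "\<lfloor>(v - a) / h\<rfloor> = int k" by (simp add: floor_eq_iff)
    then have "nat \<lfloor>2 ^ n * (v - a) / (b - a)\<rfloor> = k" unfolding q by simp
    then show ?thesis
      by (simp add: dyadic_approx_def Let_def h_def[symmetric]) (simp add: p algebra_simps)
  qed
qed

text \<open>The bound on \<open>k\<close> is inclusive because \<open>b\<close> itself belongs to
  the cell that starts at \<open>b\<close>.\<close>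

lemma dyadic_cells_cover:
  assumes "a < b" "a \<le> v" "v \<le> b"
  obtains k where "k \<le> 2 ^ n" "dyadic_point a b n k \<le> v" "v < dyadic_point a b n (Suc k)"
proof -
  define h where "h = (b - a) / 2 ^ n"
  have h: "0 < h" "b - a = 2 ^ n * h" using assms by (auto simp: h_def)
  have p: "dyadic_point a b n k = a + real k * h" for k by (simp add: dyadic_point_def h_def)
  define k where "k = nat \<lfloor>(v - a) / h\<rfloor>"
  have "0 \<le> (v - a) / h" using assms h by simp
  then have k: "real k \<le> (v - a) / h" "(v - a) / h < real k + 1" by (auto simp: k_def)
  have "(v - a) / h \<le> 2 ^ n" using assms h by (simp add: field_simps)
  with k have "real k \<le> 2 ^ n" by linarith
  then have "k \<le> 2 ^ n" by (metis of_nat_le_iff of_nat_numeral of_nat_power)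
  then show ?thesis
    using that[of k] k h by (simp add: p field_simps)
qed

lemma dyadic_approx_continuous:
  assumes "a < b"
  shows "continuous_on {a..b} (dyadic_approx a b n x)"
proof -
  let ?I = "\<lambda>k. {dyadic_point a b n k..dyadic_point a b n (Suc k)}"
  have "continuous_on (\<Union>k\<le>2^n. ?I k) (dyadic_approx a b n x)"
  proof (rule continuous_on_closed_Union)
    fix k assume "k \<in> {..(2::nat)^n}"
    have "continuous_on (?I k) (\<lambda>v. x (dyadic_point a b n k) +
      ((v - dyadic_point a b n k) / ((b - a) / 2 ^ n)) *\<^sub>R
        (x (dyadic_point a b n (Suc k)) - x (dyadic_point a b n k)))"
      using assms by (intro continuous_intros) auto
    then show "continuous_on (?I k) (dyadic_approx a b n x)"
      by (rule continuous_on_eq) (use dyadic_approx_on_cell[OF assms, of n k _ x] in \<open>simp only: atLeastAtMost_iff\<close>)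
  qed auto
  moreover have "{a..b} \<subseteq> (\<Union>k\<le>2^n. ?I k)"
  proof
    fix v assume v: "v \<in> {a..b}"
    obtain k where "k \<le> 2 ^ n" "dyadic_point a b n k \<le> v" "v < dyadic_point a b n (Suc k)"
      by (rule dyadic_cells_cover[OF assms, of v n]) (use v in auto)
    then show "v \<in> (\<Union>k\<le>2^n. ?I k)" by (intro UN_I[of k]) auto
  qed
  ultimately show ?thesis by (rule continuous_on_subset)
qed

lemma dyadic_approx_derivative:
  assumes "a < b" and v: "a \<le> v" "v \<le> b" "v \<notin> dyadic_point a b n ` {..2^n}"
  obtains k where "k \<le> 2 ^ n" "(dyadic_approx a b n x has_vector_derivative
      (1 / ((b - a) / 2 ^ n)) *\<^sub>R (x (dyadic_point a b n (Suc k)) - x (dyadic_point a b n k))) (at v)"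
proof -
  obtain k where k: "k \<le> 2 ^ n" "dyadic_point a b n k \<le> v" "v < dyadic_point a b n (Suc k)"
    using dyadic_cells_cover[OF assms(1-3)] by blast
  with v(3) have k': "dyadic_point a b n k < v" by force
  define h where "h = (b - a) / 2 ^ n"
  have h: "0 < h" using assms by (simp add: h_def)
  have "((\<lambda>v. x (dyadic_point a b n k) + ((v - dyadic_point a b n k) / h) *\<^sub>R
        (x (dyadic_point a b n (Suc k)) - x (dyadic_point a b n k))) has_vector_derivative
      (1 / h) *\<^sub>R (x (dyadic_point a b n (Suc k)) - x (dyadic_point a b n k))) (at v)"
    using h by (auto intro!: derivative_eq_intros)
  then have "(dyadic_approx a b n x has_vector_derivative
      (1 / h) *\<^sub>R (x (dyadic_point a b n (Suc k)) - x (dyadic_point a b n k))) (at v)"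
  proof (rule has_vector_derivative_transform_within_open)
    show "v \<in> {dyadic_point a b n k<..<dyadic_point a b n (Suc k)}" using k k' by simp
    fix u assume "u \<in> {dyadic_point a b n k<..<dyadic_point a b n (Suc k)}"
    then show "x (dyadic_point a b n k) + ((u - dyadic_point a b n k) / h) *\<^sub>R
        (x (dyadic_point a b n (Suc k)) - x (dyadic_point a b n k)) = dyadic_approx a b n x u"
      unfolding h_def by (intro dyadic_approx_on_cell[OF assms(1), of n k u x, symmetric]) auto
  qed auto
  then show ?thesis using that k(1) by (simp add: h_def)
qed

text \<open>Integration by parts, as the sum of the two integrands is the derivative of a product.
  \<open>S\<close> holds the break points, at which nothing is known about
  \<open>vector_derivative\<close>.\<close>

lemma iter_int2_symmetric_part:
  fixes x :: "real \<Rightarrow> real ^ 'm::finite"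
  assumes st: "a \<le> s" "s \<le> t" "t \<le> b" and S: "finite S"
    and cont: "continuous_on {a..b} x"
    and der: "\<And>v. v \<in> {a..b} - S \<Longrightarrow> (x has_vector_derivative d v) (at v)"
    and bound: "\<And>v. v \<in> {a..b} - S \<Longrightarrow> norm (d v) \<le> C"
  shows "iter_int2 x s t $ i $ j + iter_int2 x s t $ j $ i = (x t - x s) $ i * (x t - x s) $ j"
proof -
  \<comment> \<open>Setting the derivative to 0 on \<open>S\<close> makes it bounded on the whole
    interval without changing any integral.\<close>
  define d0 where "d0 v = (if v \<in> S then 0 else d v)" for v
  have vd: "vector_derivative x (at v) = d0 v" if "v \<in> {s..t} - S" for v
    using vector_derivative_at[OF der, of v] that st by (auto simp: d0_def)
  have cont': "continuous_on {s..t} x" by (rule continuous_on_subset[OF cont]) (use st in auto)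
  have der': "(x has_vector_derivative d0 v) (at v)" if "v \<in> {s<..<t} - S" for v
    using der[of v] that st by (auto simp: d0_def)
  have contc: "continuous_on {s..t} (\<lambda>v. (x v - x s) $ i)" for i
    by (intro continuous_intros cont')
  have derc: "((\<lambda>v. (x v - x s) $ i) has_vector_derivative d0 v $ i) (at v)"
    if "v \<in> {s<..<t} - S" for v i
    using bounded_linear.has_vector_derivative[OF bounded_linear_vec_nth
        has_vector_derivative_diff[OF der'[OF that] has_vector_derivative_const], of "x s" i]
    by simp
  have "((\<lambda>v. d0 v $ i) has_integral (x t - x s) $ i - (x s - x s) $ i) {s..t}" for i
    using derc by (intro fundamental_theorem_of_calculus_interior_strong[OF S st(2)] contc) auto
  then have int_d: "(\<lambda>v. d0 v $ i) integrable_on {s..t}" for i by blast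
  \<comment> \<open>The fundamental theorem gives only gauge integrability. Boundedness upgrades it
    to absolute integrability, which survives multiplication by a bounded measurable
    function.\<close>
  have abs_d: "(\<lambda>v. d0 v $ i) absolutely_integrable_on {s..t}" for i
  proof (rule absolutely_integrable_integrable_bound[OF _ int_d])
    show "(\<lambda>v. \<bar>C\<bar>) integrable_on {s..t}" by (rule integrable_const_ivl)
    fix v assume "v \<in> {s..t}"
    then have "norm (d0 v) \<le> \<bar>C\<bar>" using bound[of v] st by (auto simp: d0_def)
    then show "norm (d0 v $ i) \<le> \<bar>C\<bar>" using component_le_norm_cart[of "d0 v" i] by simp
  qed
  have int: "(\<lambda>v. (x v - x s) $ i * d0 v $ j) integrable_on {s..t}" for i j
  proof -
    have "(\<lambda>v. (x v - x s) $ i * d0 v $ j) absolutely_integrable_on {s..t}"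
    proof (rule absolutely_integrable_bounded_measurable_product_real[OF _ _ _ abs_d])
      show "(\<lambda>v. (x v - x s) $ i) \<in> borel_measurable (lebesgue_on {s..t})"
        by (intro continuous_imp_measurable_on_sets_lebesgue contc) auto
      show "bounded ((\<lambda>v. (x v - x s) $ i) ` {s..t})"
        by (intro compact_imp_bounded compact_continuous_image contc) auto
    qed auto
    then show ?thesis unfolding absolutely_integrable_on_def ..
  qed
  let ?T = "\<lambda>v. tensor11 (x v - x s) (vector_derivative x (at v))"
  have comp: "?T v \<bullet> axis i (axis j 1) = (x v - x s) $ i * vector_derivative x (at v) $ j" for v i j
    by (simp add: tensor11_def inner_axis)
  have int': "(\<lambda>v. (x v - x s) $ i * vector_derivative x (at v) $ j) integrable_on {s..t}" for i j
    by (rule integrable_spike_finite[OF S _ int[of i j]]) (simp only: vd)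
  have intT: "?T integrable_on {s..t}"
  proof (rule integrable_componentwise)
    fix e :: "real^'m^'m" assume "e \<in> Basis"
    then obtain i j where "e = axis i (axis j 1)" by (auto simp: Basis_vec_def)
    then show "(\<lambda>v. ?T v \<bullet> e) integrable_on {s..t}" using int'[of i j] by (simp add: comp)
  qed
  have comp_int: "iter_int2 x s t $ i $ j = integral {s..t} (\<lambda>v. (x v - x s) $ i * d0 v $ j)" for i j
  proof -
    have "iter_int2 x s t $ i $ j = iter_int2 x s t \<bullet> axis i (axis j 1)"
      by (simp add: inner_axis)
    also have "\<dots> = integral {s..t} (\<lambda>v. ?T v \<bullet> axis i (axis j 1))"
      unfolding iter_int2_def by (rule integral_component_eq[OF intT, symmetric])
    also have "\<dots> = integral {s..t} (\<lambda>v. (x v - x s) $ i * d0 v $ j)"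
      unfolding comp by (rule integral_spike[of S]) (simp_all add: negligible_finite[OF S] vd)
    finally show ?thesis .
  qed
  have I1: "((\<lambda>v. (x v - x s) $ i * d0 v $ j + d0 v $ i * (x v - x s) $ j) has_integral
      (x t - x s) $ i * (x t - x s) $ j - (x s - x s) $ i * (x s - x s) $ j) {s..t}"
    by (rule fundamental_theorem_of_calculus_interior_strong[OF S st(2)
          has_vector_derivative_mult[OF derc derc] continuous_on_mult[OF contc contc]])
  have I2: "((\<lambda>v. (x v - x s) $ i * d0 v $ j + d0 v $ i * (x v - x s) $ j) has_integral
      iter_int2 x s t $ i $ j + iter_int2 x s t $ j $ i) {s..t}"
    unfolding comp_int
    using has_integral_add[OF integrable_integral[OF int[of i j]] integrable_integral[OF int[of j i]]]
    by (simp only: mult.commute[of "d0 _ $ i"])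
  show ?thesis using has_integral_unique[OF I2 I1] by simp
qed

lemma dyadic_lift_symmetric_part:
  fixes x :: "real \<Rightarrow> real ^ 'm::finite" and n :: nat
  assumes "a < b" "a \<le> s" "s \<le> t" "t \<le> b"
  defines "y \<equiv> dyadic_approx a b n x"
  shows "iter_int2 y s t $ i $ j + iter_int2 y s t $ j $ i = (y t - y s) $ i * (y t - y s) $ j"
proof -
  let ?p = "dyadic_point a b n"
  define slope where "slope k = (1 / ((b - a) / 2 ^ n)) *\<^sub>R (x (?p (Suc k)) - x (?p k))" for k
  define C where "C = Max ((\<lambda>k. norm (slope k)) ` {..2^n})"
  have "\<exists>d. (y has_vector_derivative d) (at v) \<and> norm d \<le> C" if v: "v \<in> {a..b} - ?p ` {..2^n}" for v
  proof -
    obtain k where "k \<le> 2 ^ n" "(y has_vector_derivative slope k) (at v)"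
      unfolding y_def slope_def
      by (rule dyadic_approx_derivative[OF assms(1), of v n x]) (use v in auto)
    then show ?thesis unfolding C_def by (intro exI[of _ "slope k"]) auto
  qed
  then obtain d where "\<And>v. v \<in> {a..b} - ?p ` {..2^n} \<Longrightarrow> (y has_vector_derivative d v) (at v)"
    "\<And>v. v \<in> {a..b} - ?p ` {..2^n} \<Longrightarrow> norm (d v) \<le> C"
    by metis
  then show ?thesis
    using assms dyadic_approx_continuous[OF assms(1)]
    by (intro iter_int2_symmetric_part[where a=a and b=b and S="?p ` {..2^n}" and d=d and C=C]) auto
qed

text \<open>An identity between finitely many entries passes to pointwise limits. For equal times
  the limit argument says nothing, and the Hoelder bounds give zero because \<open>0 powr\<close>
  any exponent is 0. From here on the dyadic approximations have served their purpose.\<close>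

lemma geometric_lift_symmetric_part:
  fixes x :: "real \<Rightarrow> real ^ 'm::finite"
  assumes X: "geometric_lift \<alpha> a b x X" and \<alpha>: "0 < \<alpha>" and st: "a \<le> s" "s \<le> t" "t \<le> b"
  shows "lev2 X s t $ i $ j + lev2 X s t $ j $ i = lev1 X s t $ i * lev1 X s t $ j"
proof (cases "s = t")
  case True
  from X have "holder2 \<alpha> a b (lev1 X)" "holder2 (2 * \<alpha>) a b (lev2 X)"
    by (auto simp: geometric_lift_def)
  then have "lev1 X s t = 0" "lev2 X s t = 0"
    using st True by (fastforce simp: holder2_def)+
  then show ?thesis by simp
next
  case False
  define y where "y n = dyadic_approx a b n x" for n
  have "s < t" "a < b" using False st by auto
  have 1: "(\<lambda>n. y n t - y n s) \<longlonglongrightarrow> lev1 X s t"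
    using X st \<open>s < t\<close> \<alpha>
    by (intro p_variation_tendsto_zeroD[where q="1/\<alpha>" and a=a and b=b and Z="\<lambda>n s t. y n t - y n s"])
       (auto simp: geometric_lift_def canonical_lift_def y_def Let_def)
  have 2: "(\<lambda>n. iter_int2 (y n) s t) \<longlonglongrightarrow> lev2 X s t"
    using X st \<open>s < t\<close> \<alpha>
    by (intro p_variation_tendsto_zeroD[where q="1/\<alpha>/2" and a=a and b=b and Z="\<lambda>n. iter_int2 (y n)"])
       (auto simp: geometric_lift_def canonical_lift_def y_def Let_def)
  have "(\<lambda>n. iter_int2 (y n) s t $ i $ j + iter_int2 (y n) s t $ j $ i)
      \<longlonglongrightarrow> lev2 X s t $ i $ j + lev2 X s t $ j $ i"
    by (intro tendsto_intros 2)
  moreover have "(\<lambda>n. (y n t - y n s) $ i * (y n t - y n s) $ j) \<longlonglongrightarrow> lev1 X s t $ i * lev1 X s t $ j"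
    by (intro tendsto_mult tendsto_vec_nth 1)
  moreover have "iter_int2 (y n) s t $ i $ j + iter_int2 (y n) s t $ j $ i
      = (y n t - y n s) $ i * (y n t - y n s) $ j" for n
    unfolding y_def using \<open>a < b\<close> st by (rule dyadic_lift_symmetric_part)
  ultimately show ?thesis by (simp add: LIMSEQ_unique)
qed

section \<open>Local expansion of the vector fields\<close>

lemma blinfun_basis_expansion:
  fixes A :: "(real ^ 'm) \<Rightarrow>\<^sub>L 'v::real_normed_vector"
  shows "(\<Sum>i\<in>UNIV. x $ i *\<^sub>R A (axis i 1)) = A x"
proof -
  have "A x = A (\<Sum>i\<in>UNIV. x $ i *\<^sub>R axis i 1)"
    using basis_expansion[of x] by (simp add: scalar_mult_eq_scaleR)
  then show ?thesis by (simp add: blinfun.sum_right blinfun.scaleR_right)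
qed

text \<open>This and the next two identities rewrite the cross terms of Chen's relations as
  applications of a coefficient to increments over the two subintervals; these are the terms that
  the expansions of g and Dg g must cancel.\<close>

lemma app2_tensor11: "app2 A (tensor11 x z) = A x z"
proof -
  have "app2 A (tensor11 x z) = (\<Sum>i\<in>UNIV. x $ i *\<^sub>R (\<Sum>j\<in>UNIV. z $ j *\<^sub>R A (axis i 1) (axis j 1)))"
    by (simp add: app2_def tensor11_def scaleR_sum_right)
  also have "\<dots> = (\<Sum>i\<in>UNIV. x $ i *\<^sub>R A (axis i 1) z)"
    by (simp only: blinfun_basis_expansion)
  also have "\<dots> = (\<Sum>i\<in>UNIV. x $ i *\<^sub>R A (axis i 1)) z"
    by (simp only: blinfun.sum_left blinfun.scaleR_left)
  finally show ?thesis by (simp only: blinfun_basis_expansion)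
qed

lemma app3_tensor12: "app3 A (tensor12 x T) = app2 (A x) T"
proof -
  have "app3 A (tensor12 x T) =
      (\<Sum>i\<in>UNIV. \<Sum>j\<in>UNIV. \<Sum>k\<in>UNIV. T $ j $ k *\<^sub>R x $ i *\<^sub>R A (axis i 1) (axis j 1) (axis k 1))"
    by (simp add: app3_def tensor12_def mult.commute)
  also have "\<dots> = (\<Sum>j\<in>UNIV. \<Sum>i\<in>UNIV. \<Sum>k\<in>UNIV. T $ j $ k *\<^sub>R x $ i *\<^sub>R A (axis i 1) (axis j 1) (axis k 1))"
    by (rule sum.swap)
  also have "\<dots> = (\<Sum>j\<in>UNIV. \<Sum>k\<in>UNIV. \<Sum>i\<in>UNIV. T $ j $ k *\<^sub>R x $ i *\<^sub>R A (axis i 1) (axis j 1) (axis k 1))"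
    by (intro sum.cong sum.swap refl)
  also have "\<dots> = (\<Sum>j\<in>UNIV. \<Sum>k\<in>UNIV. T $ j $ k *\<^sub>R (\<Sum>i\<in>UNIV. x $ i *\<^sub>R A (axis i 1)) (axis j 1) (axis k 1))"
    by (simp add: scaleR_sum_right blinfun.sum_left blinfun.scaleR_left)
  finally show ?thesis by (simp add: app2_def blinfun_basis_expansion)
qed

lemma app3_tensor21: "app3 A (tensor21 T z) = app2 A T z"
proof -
  have "app3 A (tensor21 T z) =
      (\<Sum>i\<in>UNIV. \<Sum>j\<in>UNIV. T $ i $ j *\<^sub>R (\<Sum>k\<in>UNIV. z $ k *\<^sub>R A (axis i 1) (axis j 1) (axis k 1)))"
    by (simp add: app3_def tensor21_def scaleR_sum_right)
  also have "\<dots> = (\<Sum>i\<in>UNIV. \<Sum>j\<in>UNIV. T $ i $ j *\<^sub>R A (axis i 1) (axis j 1) z)"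
    by (simp only: blinfun_basis_expansion)
  finally show ?thesis
    by (simp only: app2_def blinfun.sum_left blinfun.scaleR_left)
qed

lemma norm_blinfun_axis_le:
  fixes A :: "(real ^ 'm) \<Rightarrow>\<^sub>L 'v::real_normed_vector"
  shows "norm (A (axis i 1)) \<le> norm A"
  using norm_blinfun[of A "axis i 1"] by simp

lemma bounded_bilinear_app2:
  "bounded_bilinear (app2 :: ((real ^ 'm) \<Rightarrow>\<^sub>L ((real ^ 'm) \<Rightarrow>\<^sub>L 'v::real_normed_vector)) \<Rightarrow> _)"
proof
  show "\<exists>K. \<forall>(A :: (real ^ 'm) \<Rightarrow>\<^sub>L ((real ^ 'm) \<Rightarrow>\<^sub>L 'v)) T. norm (app2 A T) \<le> norm A * norm T * K"
  proof (intro exI allI)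
    fix A :: "(real ^ 'm) \<Rightarrow>\<^sub>L ((real ^ 'm) \<Rightarrow>\<^sub>L 'v)" and T
    have "norm (app2 A T) \<le> (\<Sum>i\<in>(UNIV::'m set). \<Sum>j\<in>(UNIV::'m set). norm A * norm T)"
      unfolding app2_def
    proof (intro sum_norm_le)
      fix i j
      have "norm (T $ i $ j) \<le> norm T"
        using Finite_Cartesian_Product.norm_nth_le[of "T $ i" j] Finite_Cartesian_Product.norm_nth_le[of T i] by linarith
      moreover have "norm (A (axis i 1) (axis j 1)) \<le> norm A"
        by (rule order_trans[OF norm_blinfun_axis_le norm_blinfun_axis_le])
      ultimately show "norm (T $ i $ j *\<^sub>R A (axis i 1) (axis j 1)) \<le> norm A * norm T"
        by (simp add: mult.commute[of "norm A"] mult_mono)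
    qed
    then show "norm (app2 A T) \<le> norm A * norm T * (real CARD('m) * real CARD('m))"
      by (simp add: mult_ac)
  qed
qed (simp_all add: app2_def blinfun.bilinear_simps algebra_simps sum.distrib scaleR_sum_right)

lemma bounded_bilinear_app3:
  "bounded_bilinear (app3 :: ((real ^ 'm) \<Rightarrow>\<^sub>L ((real ^ 'm) \<Rightarrow>\<^sub>L ((real ^ 'm) \<Rightarrow>\<^sub>L 'v::real_normed_vector))) \<Rightarrow> _)"
proof
  show "\<exists>K. \<forall>(A :: (real ^ 'm) \<Rightarrow>\<^sub>L ((real ^ 'm) \<Rightarrow>\<^sub>L ((real ^ 'm) \<Rightarrow>\<^sub>L 'v))) T. norm (app3 A T) \<le> norm A * norm T * K"
  proof (intro exI allI)
    fix A :: "(real ^ 'm) \<Rightarrow>\<^sub>L ((real ^ 'm) \<Rightarrow>\<^sub>L ((real ^ 'm) \<Rightarrow>\<^sub>L 'v))" and T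
    have "norm (app3 A T) \<le>
        (\<Sum>i\<in>(UNIV::'m set). \<Sum>j\<in>(UNIV::'m set). \<Sum>k\<in>(UNIV::'m set). norm A * norm T)"
      unfolding app3_def
    proof (intro sum_norm_le)
      fix i j k
      have "norm (T $ i $ j $ k) \<le> norm T"
        using Finite_Cartesian_Product.norm_nth_le[of "T $ i $ j" k] Finite_Cartesian_Product.norm_nth_le[of "T $ i" j] Finite_Cartesian_Product.norm_nth_le[of T i] by linarith
      moreover have "norm (A (axis i 1) (axis j 1) (axis k 1)) \<le> norm A"
        by (rule order_trans[OF norm_blinfun_axis_le order_trans[OF norm_blinfun_axis_le norm_blinfun_axis_le]])
      ultimately show "norm (T $ i $ j $ k *\<^sub>R A (axis i 1) (axis j 1) (axis k 1)) \<le> norm A * norm T"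
        by (simp add: mult.commute[of "norm A"] mult_mono)
    qed
    then show "norm (app3 A T) \<le> norm A * norm T * (real CARD('m) * (real CARD('m) * real CARD('m)))"
      by (simp add: mult_ac)
  qed
qed (simp_all add: app3_def blinfun.bilinear_simps algebra_simps sum.distrib scaleR_sum_right)

section \<open>O-estimates uniform over a parameter set\<close>

locale scale =
  fixes D :: "'p set" and r :: "'p \<Rightarrow> real" and R :: real
  assumes r_nonneg: "p \<in> D \<Longrightarrow> 0 \<le> r p" and r_le: "p \<in> D \<Longrightarrow> r p \<le> R"
begin

text \<open>\<open>ord v i F\<close> means \<open>F = O(v r\<^sup>i)\<close> uniformly on \<open>D\<close>.\<close>

definition ord :: "('p \<Rightarrow> real) \<Rightarrow> nat \<Rightarrow> ('p \<Rightarrow> 'v::real_normed_vector) \<Rightarrow> bool" where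
  "ord v i F \<longleftrightarrow> (\<exists>C\<ge>0. \<forall>p\<in>D. norm (F p) \<le> C * (v p * r p ^ i))"

abbreviation so :: "nat \<Rightarrow> ('p \<Rightarrow> 'v::real_normed_vector) \<Rightarrow> bool" where
  "so \<equiv> ord (\<lambda>_. 1)"

lemma ordI: "0 \<le> C \<Longrightarrow> (\<And>p. p \<in> D \<Longrightarrow> norm (F p) \<le> C * (v p * r p ^ i)) \<Longrightarrow> ord v i F"
  by (auto simp: ord_def)

lemma ordE:
  assumes "ord v i F"
  obtains C where "0 \<le> C" "\<And>p. p \<in> D \<Longrightarrow> norm (F p) \<le> C * (v p * r p ^ i)"
  using assms by (auto simp: ord_def)

lemma ord_add:
  assumes "ord v i F" "ord v i G" shows "ord v i (\<lambda>p. F p + G p)"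
proof -
  obtain C C' where "0 \<le> C" "\<And>p. p \<in> D \<Longrightarrow> norm (F p) \<le> C * (v p * r p ^ i)"
    "0 \<le> C'" "\<And>p. p \<in> D \<Longrightarrow> norm (G p) \<le> C' * (v p * r p ^ i)"
    using assms by (metis ordE)
  then show ?thesis
    by (intro ordI[of "C + C'"]) (auto simp: distrib_right intro!: norm_triangle_le add_mono)
qed

lemma ord_le:
  assumes G: "ord v i G" and c: "0 \<le> c" and le: "\<And>p. p \<in> D \<Longrightarrow> norm (F p) \<le> c * norm (G p)"
  shows "ord v i F"
proof -
  obtain C where C: "0 \<le> C" "\<And>p. p \<in> D \<Longrightarrow> norm (G p) \<le> C * (v p * r p ^ i)"
    using G by (metis ordE)
  show ?thesis
  proof (rule ordI[of "c * C"])
    fix p assume p: "p \<in> D"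
    show "norm (F p) \<le> c * C * (v p * r p ^ i)"
      using order_trans[OF le[OF p] mult_left_mono[OF C(2)[OF p] c]] by (simp add: mult.assoc)
  qed (use c C in auto)
qed

lemma ord_cong: "ord v i G \<Longrightarrow> (\<And>p. p \<in> D \<Longrightarrow> F p = G p) \<Longrightarrow> ord v i F"
  by (rule ord_le[of v i G 1]) auto

lemma ord_minus: "ord v i F \<Longrightarrow> ord v i (\<lambda>p. - F p)"
  by (rule ord_le[of v i F 1]) auto

lemma ord_diff: "ord v i F \<Longrightarrow> ord v i G \<Longrightarrow> ord v i (\<lambda>p. F p - G p)"
  using ord_add[OF _ ord_minus] by fastforce

lemma ord_scaleR: "ord v i F \<Longrightarrow> ord v i (\<lambda>p. c *\<^sub>R F p)"
  by (rule ord_le[of v i F "\<bar>c\<bar>"]) auto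

text \<open>Excess powers of \<open>r\<close> are absorbed into the constant; this is what the upper
  bound \<open>R\<close> on the scale is for.\<close>

lemma ord_mono:
  assumes F: "ord v i F" and ji: "j \<le> i" and v: "\<And>p. p \<in> D \<Longrightarrow> 0 \<le> v p"
  shows "ord v j F"
proof -
  obtain C where C: "0 \<le> C" "\<And>p. p \<in> D \<Longrightarrow> norm (F p) \<le> C * (v p * r p ^ i)"
    using F by (metis ordE)
  show ?thesis
  proof (rule ordI[of "C * \<bar>R\<bar> ^ (i - j)"])
    fix p assume p: "p \<in> D"
    have "r p ^ i = r p ^ (i - j) * r p ^ j" using ji by (simp add: power_add[symmetric])
    also have "\<dots> \<le> \<bar>R\<bar> ^ (i - j) * r p ^ j"
      using r_nonneg[OF p] r_le[OF p] by (intro mult_right_mono power_mono) auto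
    finally have "C * (v p * r p ^ i) \<le> C * (v p * (\<bar>R\<bar> ^ (i - j) * r p ^ j))"
      using C v[OF p] by (intro mult_left_mono)
    then show "norm (F p) \<le> C * \<bar>R\<bar> ^ (i - j) * (v p * r p ^ j)"
      using C(2)[OF p] by (simp add: mult_ac)
  qed (use C in auto)
qed

lemma so_mono: "so i F \<Longrightarrow> j \<le> i \<Longrightarrow> so j F"
  by (rule ord_mono) auto

lemma so_weaken:
  assumes F: "so i F" and v: "\<And>p. p \<in> D \<Longrightarrow> 1 \<le> v p"
  shows "ord v i F"
proof -
  obtain C where C: "0 \<le> C" "\<And>p. p \<in> D \<Longrightarrow> norm (F p) \<le> C * (1 * r p ^ i)"
    using F by (metis ordE)
  show ?thesis
  proof (rule ordI[OF C(1)])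
    fix p assume p: "p \<in> D"
    have "C * (1 * r p ^ i) \<le> C * (v p * r p ^ i)"
      using C r_nonneg[OF p] v[OF p] by (intro mult_left_mono mult_right_mono) auto
    then show "norm (F p) \<le> C * (v p * r p ^ i)" using C(2)[OF p] by simp
  qed
qed

lemma so_0: "(\<And>p. p \<in> D \<Longrightarrow> norm (F p) \<le> C) \<Longrightarrow> so 0 F"
  by (rule ordI[of "\<bar>C\<bar>"]) (auto intro: order_trans[OF _ abs_ge_self])

lemma so_power:
  assumes G: "so i G" and c: "0 \<le> c" and le: "\<And>p. p \<in> D \<Longrightarrow> norm (F p) \<le> c * norm (G p) ^ n"
  shows "so (i * n) F"
proof -
  obtain C where C: "0 \<le> C" "\<And>p. p \<in> D \<Longrightarrow> norm (G p) \<le> C * (1 * r p ^ i)"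
    using G by (metis ordE)
  show ?thesis
  proof (rule ordI[of "c * C ^ n"])
    fix p assume p: "p \<in> D"
    have "norm (G p) ^ n \<le> (C * (1 * r p ^ i)) ^ n"
      using C(2)[OF p] by (intro power_mono) auto
    then have "c * norm (G p) ^ n \<le> c * (C * (1 * r p ^ i)) ^ n"
      using c by (rule mult_left_mono)
    then show "norm (F p) \<le> c * C ^ n * (1 * r p ^ (i * n))"
      using le[OF p] by (simp add: power_mult_distrib power_mult mult_ac)
  qed (use c C in auto)
qed

text \<open>Only one factor may carry the weight, so products stay linear in it.\<close>

lemma ord_bilinear:
  assumes B: "bounded_bilinear bop" and F: "ord v i F" and G: "so j G"
  shows "ord v (i + j) (\<lambda>p. bop (F p) (G p))"
proof -
  obtain C where C: "0 \<le> C" "\<And>p. p \<in> D \<Longrightarrow> norm (F p) \<le> C * (v p * r p ^ i)"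
    using F by (metis ordE)
  obtain C' where C': "0 \<le> C'" "\<And>p. p \<in> D \<Longrightarrow> norm (G p) \<le> C' * (1 * r p ^ j)"
    using G by (metis ordE)
  obtain K where K: "0 \<le> K" "\<And>x y. norm (bop x y) \<le> norm x * norm y * K"
    using bounded_bilinear.nonneg_bounded[OF B] by blast
  show ?thesis
  proof (rule ordI[of "C * C' * K"])
    fix p assume p: "p \<in> D"
    have "norm (F p) * norm (G p) \<le> (C * (v p * r p ^ i)) * (C' * (1 * r p ^ j))"
      using C(2)[OF p] C'(2)[OF p] order_trans[OF norm_ge_zero C(2)[OF p]] by (intro mult_mono) auto
    then have "norm (F p) * norm (G p) * K \<le> (C * (v p * r p ^ i)) * (C' * (1 * r p ^ j)) * K"
      using K(1) by (rule mult_right_mono)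
    then show "norm (bop (F p) (G p)) \<le> C * C' * K * (v p * r p ^ (i + j))"
      using K(2)[of "F p" "G p"] by (simp add: power_add mult_ac)
  qed (use C C' K in auto)
qed

lemma ord_bilinear':
  assumes "bounded_bilinear bop" "so i F" "ord v j G"
  shows "ord v (i + j) (\<lambda>p. bop (F p) (G p))"
  using ord_bilinear[OF bounded_bilinear.flip[OF assms(1)] assms(3,2)] by (simp add: add.commute)

lemmas ord_apply = ord_bilinear[OF bounded_bilinear_blinfun_apply]
lemmas ord_compose = ord_bilinear[OF bounded_bilinear_blinfun_compose]
lemmas ord_app2 = ord_bilinear[OF bounded_bilinear_app2]
lemmas ord_app3 = ord_bilinear[OF bounded_bilinear_app3]

end

section \<open>Bounds for g, Dg g and the third-level coefficient\<close>

lemma C3_b_bound: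
  assumes "C3_b g"
  obtains M where "0 \<le> M" "\<And>x. norm (g x) \<le> M" "\<And>x. norm (fderiv g x) \<le> M"
    "\<And>x. norm (fderiv (fderiv g) x) \<le> M" "\<And>x. norm (fderiv (fderiv (fderiv g)) x) \<le> M"
proof -
  obtain M1 M2 M3 M4 where "\<And>x. norm (g x) \<le> M1" "\<And>x. norm (fderiv g x) \<le> M2"
    "\<And>x. norm (fderiv (fderiv g) x) \<le> M3" "\<And>x. norm (fderiv (fderiv (fderiv g)) x) \<le> M4"
    using assms unfolding C3_b_def bounded_iff by blast
  then show ?thesis
    by (intro that[of "max 0 (max (max M1 M2) (max M3 M4))"]) (auto simp: le_max_iff_disj)
qed

locale C3_field =
  fixes g :: "real ^ 'd \<Rightarrow> ((real ^ 'm) \<Rightarrow>\<^sub>L (real ^ 'd))" and M :: real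
  assumes C3: "C3_b g"
    and M: "0 \<le> M" "norm (g x) \<le> M" "norm (fderiv g x) \<le> M" "norm (fderiv (fderiv g) x) \<le> M"
      "norm (fderiv (fderiv (fderiv g)) x) \<le> M"
begin

abbreviation g' where "g' \<equiv> fderiv g"
abbreviation g'' where "g'' \<equiv> fderiv g'"
abbreviation \<Gamma> where "\<Gamma> \<equiv> Dg_g g"
abbreviation \<Lambda> where "\<Lambda> \<equiv> Dg_g2 g"

lemma derivatives:
  "(g has_derivative g' x) (at x)" "(g' has_derivative g'' x) (at x)"
  "(g'' has_derivative fderiv g'' x) (at x)"
  using C3 by (auto simp: C3_b_def intro: fderiv_works)

text \<open>The bound on the third derivative makes \<open>g''\<close> Lipschitz; the third-order
  Taylor remainder, the symmetry of \<open>g''\<close> and the Lipschitz bound for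
  \<open>\<Lambda>\<close> all rest on this.\<close>

lemma lipschitz:
  "norm (g (x + k) - g x) \<le> M * norm k"
  "norm (g' (x + k) - g' x) \<le> M * norm k"
  "norm (g'' (x + k) - g'' x) \<le> M * norm k"
  by (rule derivative_bound_lipschitz[OF derivatives(1) M(3)]
      derivative_bound_lipschitz[OF derivatives(2) M(4)]
      derivative_bound_lipschitz[OF derivatives(3) M(5)])+

lemmas g_taylor2 = taylor_order2[OF derivatives(1) lipschitz(2) M(1)]
lemmas g'_taylor2 = taylor_order2[OF derivatives(2) lipschitz(3) M(1)]
lemmas g_taylor3 = taylor_order3[OF derivatives(1,2) lipschitz(3) M(1)]
lemmas g''_symmetric = second_derivative_symmetric[OF derivatives(1,2) lipschitz(3) M(1)]

lemma \<Lambda>_apply: "\<Lambda> z u = (g' z o\<^sub>L g' z (g z u)) + (g'' z (g z u) o\<^sub>L g z)"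
  by (intro blinfun_eqI) (simp add: Dg_g2_apply blinfun.add_left)

lemma \<Gamma>_bounded: "norm (\<Gamma> z) \<le> M * M"
  unfolding Dg_g_def by (rule order_trans[OF norm_blinfun_compose]) (intro mult_mono M norm_ge_zero)

lemma \<Gamma>_lipschitz: "norm (\<Gamma> (x + k) - \<Gamma> x) \<le> 2 * M * M * norm k"
proof -
  have "\<Gamma> (x + k) - \<Gamma> x = (g' (x + k) o\<^sub>L (g (x + k) - g x)) + ((g' (x + k) - g' x) o\<^sub>L g x)"
    by (intro blinfun_eqI) (simp add: Dg_g_def blinfun.bilinear_simps)
  also have "norm \<dots> \<le> M * (M * norm k) + (M * norm k) * M"
    by (intro norm_triangle_le add_mono order_trans[OF norm_blinfun_compose] mult_mono M lipschitz
        norm_ge_zero mult_nonneg_nonneg)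
  finally show ?thesis by simp
qed

lemma \<Lambda>_bounded: "norm (\<Lambda> z) \<le> 2 * M ^ 3"
proof (rule norm_blinfun_bound)
  fix u
  have gu: "norm (g z u) \<le> M * norm u"
    by (rule order_trans[OF norm_blinfun]) (intro mult_right_mono M norm_ge_zero)
  have 1: "norm (g' z (g z u)) \<le> M * (M * norm u)"
    by (rule order_trans[OF norm_blinfun]) (intro mult_mono M gu norm_ge_zero)
  have 2: "norm (g'' z (g z u)) \<le> M * (M * norm u)"
    by (rule order_trans[OF norm_blinfun]) (intro mult_mono M gu norm_ge_zero)
  have "norm (\<Lambda> z u) \<le> M * (M * (M * norm u)) + (M * (M * norm u)) * M"
    unfolding \<Lambda>_apply
    by (intro norm_triangle_le add_mono order_trans[OF norm_blinfun_compose] mult_mono M 1 2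
        norm_ge_zero mult_nonneg_nonneg)
  then show "norm (\<Lambda> z u) \<le> 2 * M ^ 3 * norm u" by (simp add: power3_eq_cube)
qed (use M(1) in simp)

text \<open>Both terms of \<open>\<Lambda>\<close> are products of three fields. Changing one field
  at a time gives six differences, each of size at most M^3 times the norm of
  \<open>k\<close>.\<close>

lemma \<Lambda>_lipschitz: "norm (\<Lambda> (x + k) - \<Lambda> x) \<le> 6 * M ^ 3 * norm k"
proof (rule norm_blinfun_bound)
  fix u
  let ?z = "x + k"
  have gu: "norm (g z u) \<le> M * norm u" for z
    by (rule order_trans[OF norm_blinfun]) (intro mult_right_mono M norm_ge_zero)
  have dgu: "norm (g ?z u - g x u) \<le> M * norm k * norm u"
    using order_trans[OF norm_blinfun mult_right_mono[OF lipschitz(1)], of u x k]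
    by (simp add: blinfun.diff_left)
  have 1: "norm (g' z (g z u)) \<le> M * (M * norm u)" for z
    by (rule order_trans[OF norm_blinfun]) (intro mult_mono M gu norm_ge_zero)
  have 2: "norm (g'' z (g z u)) \<le> M * (M * norm u)" for z
    by (rule order_trans[OF norm_blinfun]) (intro mult_mono M gu norm_ge_zero)
  have "g' ?z (g ?z u) - g' x (g x u) = g' ?z (g ?z u - g x u) + (g' ?z - g' x) (g x u)"
    by (simp add: blinfun.bilinear_simps)
  also have "norm \<dots> \<le> M * (M * norm k * norm u) + M * norm k * (M * norm u)"
    by (intro norm_triangle_le add_mono order_trans[OF norm_blinfun] mult_mono M lipschitz gu dgu
        norm_ge_zero mult_nonneg_nonneg)
  finally have d1: "norm (g' ?z (g ?z u) - g' x (g x u)) \<le> 2 * M * M * norm k * norm u" by simp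
  have "g'' ?z (g ?z u) - g'' x (g x u) = g'' ?z (g ?z u - g x u) + (g'' ?z - g'' x) (g x u)"
    by (simp add: blinfun.bilinear_simps)
  also have "norm \<dots> \<le> M * (M * norm k * norm u) + M * norm k * (M * norm u)"
    by (intro norm_triangle_le add_mono order_trans[OF norm_blinfun] mult_mono M lipschitz gu dgu
        norm_ge_zero mult_nonneg_nonneg)
  finally have d2: "norm (g'' ?z (g ?z u) - g'' x (g x u)) \<le> 2 * M * M * norm k * norm u" by simp
  have "\<Lambda> ?z u - \<Lambda> x u = ((g' ?z o\<^sub>L (g' ?z (g ?z u) - g' x (g x u))) + ((g' ?z - g' x) o\<^sub>L g' x (g x u)))
     + ((g'' ?z (g ?z u) o\<^sub>L (g ?z - g x)) + ((g'' ?z (g ?z u) - g'' x (g x u)) o\<^sub>L g x))"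
    by (intro blinfun_eqI) (simp add: \<Lambda>_apply blinfun.bilinear_simps)
  also have "norm \<dots> \<le> (M * (2 * M * M * norm k * norm u) + M * norm k * (M * (M * norm u)))
     + (M * (M * norm u) * (M * norm k) + 2 * M * M * norm k * norm u * M)"
    by (intro norm_triangle_le add_mono order_trans[OF norm_blinfun_compose] mult_mono M lipschitz 1 2 d1 d2
        norm_ge_zero mult_nonneg_nonneg zero_le_numeral)
  finally show "norm ((\<Lambda> ?z - \<Lambda> x) u) \<le> 6 * M ^ 3 * norm k * norm u"
    by (simp add: blinfun.diff_left power3_eq_cube)
qed (use M(1) in simp)

text \<open>Geometricity enters here: \<open>g''\<close> is symmetric, so only the symmetric part of \<open>x2\<close> contributes.\<close>

lemma second_order_identity:
  assumes sym: "\<And>i j. x2 $ i $ j + x2 $ j $ i = x1 $ i * x1 $ j"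
  shows "app2 (\<Lambda> y) x2 = g' y (app2 (\<Gamma> y) x2) + (1/2) *\<^sub>R g'' y (g y x1) (g y x1)"
proof -
  define S where "S i j = g'' y (g y (axis i 1)) (g y (axis j 1))" for i j
  have S_sym: "S i j = S j i" for i j unfolding S_def by (rule g''_symmetric)
  define Q where "Q = (\<Sum>i\<in>UNIV. \<Sum>j\<in>UNIV. x2 $ i $ j *\<^sub>R S i j)"
  have "Q = (\<Sum>i\<in>UNIV. \<Sum>j\<in>UNIV. x2 $ j $ i *\<^sub>R S j i)"
    unfolding Q_def by (rule sum.swap)
  then have Q': "Q = (\<Sum>i\<in>UNIV. \<Sum>j\<in>UNIV. x2 $ j $ i *\<^sub>R S i j)"
    by (simp add: S_sym)
  \<comment> \<open>Averaging \<open>Q\<close> with its transposed form replaces \<open>x2\<close>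
    by its symmetric part, which is half of x1 (x) x1.\<close>
  have "2 *\<^sub>R Q = Q + Q" by (rule scaleR_2)
  also have "\<dots> = (\<Sum>i\<in>UNIV. \<Sum>j\<in>UNIV. (x1 $ i * x1 $ j) *\<^sub>R S i j)"
    by (subst (2) Q', subst Q_def) (simp add: sum.distrib[symmetric] scaleR_add_left[symmetric] sym)
  also have "\<dots> = (\<Sum>i\<in>UNIV. x1 $ i *\<^sub>R (\<Sum>j\<in>UNIV. x1 $ j *\<^sub>R (g'' y (g y (axis i 1)) o\<^sub>L g y) (axis j 1)))"
    by (simp add: S_def scaleR_sum_right)
  also have "\<dots> = (\<Sum>i\<in>UNIV. x1 $ i *\<^sub>R g'' y (g y x1) (g y (axis i 1)))"
    by (simp only: blinfun_basis_expansion) (simp add: g''_symmetric[of y "g y x1"])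
  also have "\<dots> = (\<Sum>i\<in>UNIV. x1 $ i *\<^sub>R (g'' y (g y x1) o\<^sub>L g y) (axis i 1))"
    by simp
  also have "\<dots> = g'' y (g y x1) (g y x1)"
    by (simp only: blinfun_basis_expansion) simp
  finally have Q2: "Q = (1/2) *\<^sub>R g'' y (g y x1) (g y x1)"
    by (metis (no_types) scaleR_half_double scaleR_2 scaleR_scaleR mult.commute)
  have 1: "\<Lambda> y (axis i 1) (axis j 1) = g' y (\<Gamma> y (axis i 1) (axis j 1)) + S i j" for i j
    by (intro blinfun_eqI) (simp add: Dg_g2_apply Dg_g_apply S_def blinfun.add_left)
  have "app2 (\<Lambda> y) x2 = g' y (app2 (\<Gamma> y) x2) + Q"
    by (simp add: app2_def 1 Q_def scaleR_add_right sum.distrib blinfun.sum_right blinfun.scaleR_right)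
  then show ?thesis by (simp add: Q2)
qed

end

text \<open>\<open>h\<close> is the increment of an Euler step from \<open>y\<close> with driver increments \<open>x1\<close>, \<open>x2\<close>, \<open>x3\<close> and drift part \<open>q\<close>.\<close>

locale field_expansion = C3_field g M + scale D r R
  for M :: real and g :: "real ^ 'd \<Rightarrow> ((real ^ 'm) \<Rightarrow>\<^sub>L (real ^ 'd))" and D :: "'p set" and r R +
  fixes v :: "'p \<Rightarrow> real" and y q h :: "'p \<Rightarrow> real ^ 'd"
    and x1 :: "'p \<Rightarrow> real ^ 'm" and x2 :: "'p \<Rightarrow> real ^ 'm ^ 'm" and x3 :: "'p \<Rightarrow> real ^ 'm ^ 'm ^ 'm"
  assumes v: "p \<in> D \<Longrightarrow> 1 \<le> v p"
    and x1: "so 1 x1" and x2: "so 2 x2" and x3: "so 3 x3" and q: "ord v 3 q"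
    and sym: "p \<in> D \<Longrightarrow> x2 p $ i $ j + x2 p $ j $ i = x1 p $ i * x1 p $ j"
    and h: "p \<in> D \<Longrightarrow> h p = q p + g (y p) (x1 p) + app2 (\<Gamma> (y p)) (x2 p) + app3 (\<Lambda> (y p)) (x3 p)"
begin

lemma so_weaken_v: "so i F \<Longrightarrow> ord v i F"
  by (rule so_weaken[OF _ v])

lemma ord_mono_v: "ord v i F \<Longrightarrow> j \<le> i \<Longrightarrow> ord v j F"
  by (rule ord_mono) (use v in force)+

lemma so_fields: "so 0 (\<lambda>p. g (y p))" "so 0 (\<lambda>p. g' (y p))" "so 0 (\<lambda>p. g'' (y p))"
  "so 0 (\<lambda>p. \<Gamma> (y p))" "so 0 (\<lambda>p. \<Lambda> (y p))"
  by (rule so_0, rule M \<Gamma>_bounded \<Lambda>_bounded)+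

text \<open>The increment sorted by order. The drift joins the third level, and \<open>k3\<close> is
  the only part that carries the weight.\<close>

definition "k1 p = g (y p) (x1 p)"
definition "k2 p = app2 (\<Gamma> (y p)) (x2 p)"
definition "k3 p = q p + app3 (\<Lambda> (y p)) (x3 p)"

lemma ord_k1: "so 1 k1"
  using ord_apply[OF so_fields(1) x1] by (simp add: k1_def[abs_def])

lemma ord_k2: "so 2 k2"
  using ord_app2[OF so_fields(4) x2] by (simp only: add_0 k2_def[abs_def])

lemma ord_k3: "ord v 3 k3"
  using ord_add[OF q so_weaken_v[OF ord_app3[OF so_fields(5) x3, simplified]]] by (simp add: k3_def[abs_def])

lemma h_eq: "p \<in> D \<Longrightarrow> h p = k1 p + k2 p + k3 p"
  by (simp add: h k1_def k2_def k3_def)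

lemma ord_h: "ord v 1 h"
proof (rule ord_cong[OF _ h_eq])
  show "ord v 1 (\<lambda>p. k1 p + k2 p + k3 p)"
    by (intro ord_add so_weaken_v ord_k1 so_mono[OF ord_k2] ord_mono_v[OF ord_k3]) auto
qed

lemma ord_h_minus_level2: "ord v 3 (\<lambda>p. h p - g (y p) (x1 p) - app2 (\<Gamma> (y p)) (x2 p))"
  by (rule ord_cong[OF ord_k3]) (simp add: h_eq k1_def k2_def)

text \<open>\<open>k3\<close> is removed by the Lipschitz bound before Taylor's formula is used,
  since a power of it would be a power of the weight. Of the quadratic terms only the one with
  \<open>k1\<close> twice has order below three; together with the linear term in \<open>k2\<close>
  it is the \<open>\<Lambda>\<close> term, by \<open>second_order_identity\<close>.\<close>

lemma ord_g_expansion: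
  "ord v 3 (\<lambda>p. g (y p + h p) - g (y p) - \<Gamma> (y p) (x1 p) - app2 (\<Lambda> (y p)) (x2 p))"
proof -
  let ?k = "\<lambda>p. k1 p + k2 p"
  have k: "so 1 ?k" by (intro ord_add ord_k1 so_mono[OF ord_k2]) auto
  have 1: "ord v 3 (\<lambda>p. g (y p + ?k p + k3 p) - g (y p + ?k p))"
    by (rule ord_le[OF ord_k3 M(1) lipschitz(1)])
  have 2: "so 3 (\<lambda>p. g (y p + ?k p) - g (y p) - g' (y p) (?k p) - (1/2) *\<^sub>R g'' (y p) (?k p) (?k p))"
    using so_power[OF k M(1) g_taylor3] by simp
  have quad: "so (i + j) (\<lambda>p. g'' (y p) (K p) (L p))" if "so i K" "so j L" for i j K L
    using ord_apply[OF ord_apply[OF so_fields(3) that(1)] that(2)] by simp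
  have 3: "so 3 (\<lambda>p. g'' (y p) (k1 p) (k2 p))"
    using quad[OF ord_k1 ord_k2] by (rule so_mono) simp
  have 4: "so 3 (\<lambda>p. g'' (y p) (k2 p) (k1 p))"
    using quad[OF ord_k2 ord_k1] by (rule so_mono) simp
  have 5: "so 3 (\<lambda>p. g'' (y p) (k2 p) (k2 p))"
    using quad[OF ord_k2 ord_k2] by (rule so_mono) simp
  have "ord v 3 (\<lambda>p. (g (y p + ?k p + k3 p) - g (y p + ?k p))
     + ((g (y p + ?k p) - g (y p) - g' (y p) (?k p) - (1/2) *\<^sub>R g'' (y p) (?k p) (?k p))
     + (1/2) *\<^sub>R (g'' (y p) (k1 p) (k2 p) + g'' (y p) (k2 p) (k1 p) + g'' (y p) (k2 p) (k2 p))))"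
    by (intro ord_add[OF 1] so_weaken_v[OF ord_add[OF 2]] ord_scaleR ord_add 3 4 5)
  then show ?thesis
  proof (rule ord_cong)
    fix p assume p: "p \<in> D"
    have 1: "\<Gamma> (y p) (x1 p) = g' (y p) (k1 p)" by (simp add: Dg_g_def k1_def)
    have 2: "app2 (\<Lambda> (y p)) (x2 p) = g' (y p) (k2 p) + (1/2) *\<^sub>R g'' (y p) (k1 p) (k1 p)"
      unfolding k1_def k2_def by (rule second_order_identity[OF sym[OF p]])
    show "g (y p + h p) - g (y p) - \<Gamma> (y p) (x1 p) - app2 (\<Lambda> (y p)) (x2 p) =
      (g (y p + ?k p + k3 p) - g (y p + ?k p))
     + ((g (y p + ?k p) - g (y p) - g' (y p) (?k p) - (1/2) *\<^sub>R g'' (y p) (?k p) (?k p))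
     + (1/2) *\<^sub>R (g'' (y p) (k1 p) (k2 p) + g'' (y p) (k2 p) (k1 p) + g'' (y p) (k2 p) (k2 p)))"
      unfolding h_eq[OF p] 1 2 by (simp add: blinfun.bilinear_simps scaleR_add_right algebra_simps)
  qed
qed

text \<open>By the product rule, \<Lambda>(y) x1 is the derivative of \<Gamma> at y in the direction
  k1. What remains is a Taylor remainder of each factor and the product of their two first-order
  increments; the rest of the increment is again split off by a Lipschitz bound.\<close>

lemma ord_\<Gamma>_expansion: "ord v 2 (\<lambda>p. \<Gamma> (y p + h p) - \<Gamma> (y p) - \<Lambda> (y p) (x1 p))"
proof -
  have k': "ord v 2 (\<lambda>p. k2 p + k3 p)"
    by (intro ord_add so_weaken_v ord_k2 ord_mono_v[OF ord_k3]) auto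
  have 1: "ord v 2 (\<lambda>p. \<Gamma> (y p + k1 p + (k2 p + k3 p)) - \<Gamma> (y p + k1 p))"
    by (rule ord_le[OF k' _ \<Gamma>_lipschitz]) (use M(1) in simp)
  have "so (1 * 2) (\<lambda>p. g (y p + k1 p) - g (y p) - g' (y p) (k1 p))"
    by (rule so_power[OF ord_k1 M(1) g_taylor2])
  from ord_compose[OF so_fields(2) this]
  have 2: "so 2 (\<lambda>p. g' (y p) o\<^sub>L (g (y p + k1 p) - g (y p) - g' (y p) (k1 p)))"
    by (simp only: add_0 mult_1)
  have "so (1 * 2) (\<lambda>p. g' (y p + k1 p) - g' (y p) - g'' (y p) (k1 p))"
    by (rule so_power[OF ord_k1 M(1) g'_taylor2])
  from ord_compose[OF this so_fields(1)]
  have 3: "so 2 (\<lambda>p. (g' (y p + k1 p) - g' (y p) - g'' (y p) (k1 p)) o\<^sub>L g (y p))"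
    by (simp only: add_0_right mult_1)
  have 4: "so 2 (\<lambda>p. (g' (y p + k1 p) - g' (y p)) o\<^sub>L (g (y p + k1 p) - g (y p)))"
    using ord_compose[OF ord_le[OF ord_k1 M(1) lipschitz(2)] ord_le[OF ord_k1 M(1) lipschitz(1)]]
    by (simp add: numeral_2_eq_2)
  have "ord v 2 (\<lambda>p. (\<Gamma> (y p + k1 p + (k2 p + k3 p)) - \<Gamma> (y p + k1 p))
      + ((g' (y p) o\<^sub>L (g (y p + k1 p) - g (y p) - g' (y p) (k1 p)))
      + ((g' (y p + k1 p) - g' (y p) - g'' (y p) (k1 p)) o\<^sub>L g (y p))
      + ((g' (y p + k1 p) - g' (y p)) o\<^sub>L (g (y p + k1 p) - g (y p)))))"
    by (rule ord_add[OF 1 so_weaken_v[OF ord_add[OF ord_add[OF 2 3] 4]]])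
  then show ?thesis
  proof (rule ord_cong)
    fix p assume p: "p \<in> D"
    have 1: "y p + h p = y p + k1 p + (k2 p + k3 p)"
      by (simp add: h_eq[OF p] add.assoc)
    have 2: "\<Gamma> (y p + k1 p) - \<Gamma> (y p) - \<Lambda> (y p) (x1 p) =
        (g' (y p) o\<^sub>L (g (y p + k1 p) - g (y p) - g' (y p) (k1 p)))
      + ((g' (y p + k1 p) - g' (y p) - g'' (y p) (k1 p)) o\<^sub>L g (y p))
      + ((g' (y p + k1 p) - g' (y p)) o\<^sub>L (g (y p + k1 p) - g (y p)))"
      unfolding \<Lambda>_apply k1_def[symmetric]
      by (intro blinfun_eqI) (simp add: Dg_g_def blinfun.bilinear_simps)
    show "\<Gamma> (y p + h p) - \<Gamma> (y p) - \<Lambda> (y p) (x1 p) = (\<Gamma> (y p + k1 p + (k2 p + k3 p)) - \<Gamma> (y p + k1 p))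
      + ((g' (y p) o\<^sub>L (g (y p + k1 p) - g (y p) - g' (y p) (k1 p)))
      + ((g' (y p + k1 p) - g' (y p) - g'' (y p) (k1 p)) o\<^sub>L g (y p))
      + ((g' (y p + k1 p) - g' (y p)) o\<^sub>L (g (y p + k1 p) - g (y p))))"
      unfolding 1 2[symmetric] by simp
  qed
qed

lemma ord_\<Lambda>_expansion: "ord v 1 (\<lambda>p. \<Lambda> (y p + h p) - \<Lambda> (y p))"
  by (rule ord_le[OF ord_h _ \<Lambda>_lipschitz]) (use M(1) in simp)

end

section \<open>The Euler step as an almost flow\<close>

text \<open>Translates Hoelder exponents k\<alpha> into the integer powers of (t-s)^\<alpha> that
  \<open>ord\<close> counts. Positivity of \<open>k\<close> matters at 0, where \<open>powr\<close>
  vanishes but the zeroth power is 1.\<close>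

lemma powr_of_nat_mult:
  fixes x :: real
  assumes "0 < k"
  shows "x powr (real k * \<beta>) = (x powr \<beta>) ^ k"
proof (cases "x = 0")
  case True
  then show ?thesis using assms by simp
next
  case False
  then show ?thesis by (simp add: powr_powr[symmetric] powr_realpow mult.commute[of "real k"])
qed

text \<open>What the analysis takes from the lift: Hoelder bounds, Chen's relations and the
  symmetric part of the second level. The path itself no longer occurs.\<close>

locale rough_equation = C3_field g M
  for g :: "real ^ 'd \<Rightarrow> ((real ^ 'm::finite) \<Rightarrow>\<^sub>L (real ^ 'd))" and M :: real +
  fixes a b \<alpha> L :: real and X :: "'m rough_path" and f :: "real ^ 'd \<Rightarrow> real ^ 'd"
  assumes ab: "a \<le> b" and \<alpha>: "1 / 4 < \<alpha>" "\<alpha> < 1 / 3"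
    and lev1_holder: "holder2 \<alpha> a b (lev1 X)" and lev2_holder: "holder2 (2 * \<alpha>) a b (lev2 X)"
    and lev3_holder: "holder2 (3 * \<alpha>) a b (lev3 X)"
    and chen: "chen_relations a b X"
    and symmetric_part: "\<lbrakk>a \<le> s; s \<le> t; t \<le> b\<rbrakk> \<Longrightarrow>
      lev2 X s t $ i $ j + lev2 X s t $ j $ i = lev1 X s t $ i * lev1 X s t $ j"
    and f_lipschitz: "L-lipschitz_on UNIV f"
begin

definition \<mu> :: "real \<Rightarrow> real \<Rightarrow> real ^ 'd \<Rightarrow> real ^ 'd" where
  "\<mu> s t y = y + ((t - s) *\<^sub>R f y + g y (lev1 X s t) + app2 (\<Gamma> y) (lev2 X s t) + app3 (\<Lambda> y) (lev3 X s t))"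

lemma f_bound: "norm (f y - f z) \<le> L * norm (y - z)" and L_nonneg: "0 \<le> L"
  using f_lipschitz lipschitz_on_nonneg by (auto simp: dist_norm dest: lipschitz_onD)

end

text \<open>Leaving the parameter type open lets one set of estimates serve base points, pairs of
  base points, an intermediate time, or time pairs along a fixed path.\<close>

locale interval_family = rough_equation g M a b \<alpha> L X f
  for g :: "real ^ 'd \<Rightarrow> ((real ^ 'm::finite) \<Rightarrow>\<^sub>L (real ^ 'd))" and M a b \<alpha> L X f +
  fixes D :: "'p set" and s t :: "'p \<Rightarrow> real"
  assumes st: "p \<in> D \<Longrightarrow> a \<le> s p" "p \<in> D \<Longrightarrow> s p \<le> t p" "p \<in> D \<Longrightarrow> t p \<le> b"
begin

abbreviation r :: "'p \<Rightarrow> real" where "r p \<equiv> (t p - s p) powr \<alpha>"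

sublocale scale D r "(b - a) powr \<alpha>"
proof
  fix p assume p: "p \<in> D"
  show "0 \<le> r p" by simp
  show "r p \<le> (b - a) powr \<alpha>" using st[OF p] \<alpha> by (intro powr_mono2) auto
qed

text \<open>Increments over subintervals are measured against the enclosing interval, so estimates
  over adjacent pieces share one scale and can be multiplied.\<close>

lemma holder2_imp_so:
  assumes Z: "holder2 (real k * \<alpha>) a b Z" and k: "0 < k"
    and uv: "\<And>p. p \<in> D \<Longrightarrow> s p \<le> u p" "\<And>p. p \<in> D \<Longrightarrow> u p \<le> v p" "\<And>p. p \<in> D \<Longrightarrow> v p \<le> t p"
  shows "so k (\<lambda>p. Z (u p) (v p))"
proof -
  obtain K where K: "\<And>s t. a \<le> s \<Longrightarrow> s \<le> t \<Longrightarrow> t \<le> b \<Longrightarrow> norm (Z s t) \<le> K * (t - s) powr (real k * \<alpha>)"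
    using Z unfolding holder2_def by blast
  show ?thesis
  proof (rule ordI[of "\<bar>K\<bar>"])
    fix p assume p: "p \<in> D"
    have "norm (Z (u p) (v p)) \<le> K * (v p - u p) powr (real k * \<alpha>)"
      using K[of "u p" "v p"] uv[OF p] st[OF p] by simp
    also have "\<dots> \<le> \<bar>K\<bar> * (t p - s p) powr (real k * \<alpha>)"
      using uv[OF p] k \<alpha> by (intro mult_mono powr_mono2) auto
    finally show "norm (Z (u p) (v p)) \<le> \<bar>K\<bar> * (1 * r p ^ k)"
      using k by (simp add: powr_of_nat_mult)
  qed simp
qed

context
  fixes u v :: "'p \<Rightarrow> real"
  assumes uv: "\<And>p. p \<in> D \<Longrightarrow> s p \<le> u p" "\<And>p. p \<in> D \<Longrightarrow> u p \<le> v p" "\<And>p. p \<in> D \<Longrightarrow> v p \<le> t p"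
begin

lemma so_lev1: "so 1 (\<lambda>p. lev1 X (u p) (v p))"
  by (rule holder2_imp_so[OF _ _ uv]) (use lev1_holder in simp_all)

lemma so_lev2: "so 2 (\<lambda>p. lev2 X (u p) (v p))"
  by (rule holder2_imp_so[OF _ _ uv]) (use lev2_holder in simp_all)

lemma so_lev3: "so 3 (\<lambda>p. lev3 X (u p) (v p))"
  by (rule holder2_imp_so[OF _ _ uv]) (use lev3_holder in simp_all)

text \<open>Here \<alpha> < 1/3 is used: the surplus power 1 - 3\<alpha> of the time increment is
  bounded on [a,b].\<close>

lemma so_time: "so 3 (\<lambda>p. v p - u p)"
proof (rule holder2_imp_so[OF _ _ uv])
  show "holder2 (real 3 * \<alpha>) a b (\<lambda>s t. t - s)"
    unfolding holder2_def
  proof (intro exI[of _ "(b - a) powr (1 - 3 * \<alpha>)"] allI impI)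
    fix s t assume st: "a \<le> s \<and> s \<le> t \<and> t \<le> b"
    have "norm (t - s) = (t - s) powr (1 - 3 * \<alpha>) * (t - s) powr (3 * \<alpha>)"
      using st by (simp add: powr_add[symmetric])
    also have "\<dots> \<le> (b - a) powr (1 - 3 * \<alpha>) * (t - s) powr (3 * \<alpha>)"
      using st \<alpha> by (intro mult_right_mono powr_mono2) auto
    finally show "norm (t - s) \<le> (b - a) powr (1 - 3 * \<alpha>) * (t - s) powr (real 3 * \<alpha>)" by simp
  qed
qed simp

lemma ord_time_scaleR: "ord w i F \<Longrightarrow> ord w (3 + i) (\<lambda>p. (v p - u p) *\<^sub>R F p)"
  by (rule ord_bilinear'[OF bounded_bilinear_scaleR so_time])

lemma field_expansion_\<mu>:
  assumes w: "\<And>p. p \<in> D \<Longrightarrow> 1 \<le> w p" "\<And>p. p \<in> D \<Longrightarrow> norm (f (y p)) \<le> w p"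
  shows "field_expansion M g D r ((b - a) powr \<alpha>) w y (\<lambda>p. (v p - u p) *\<^sub>R f (y p))
    (\<lambda>p. \<mu> (u p) (v p) (y p) - y p) (\<lambda>p. lev1 X (u p) (v p)) (\<lambda>p. lev2 X (u p) (v p)) (\<lambda>p. lev3 X (u p) (v p))"
proof
  have "ord w 0 (\<lambda>p. f (y p))"
    by (rule ordI[of 1]) (use w in auto)
  from ord_time_scaleR[OF this] show "ord w 3 (\<lambda>p. (v p - u p) *\<^sub>R f (y p))" by (simp only: add_0_right)
  fix p i j assume p: "p \<in> D"
  show "lev2 X (u p) (v p) $ i $ j + lev2 X (u p) (v p) $ j $ i = lev1 X (u p) (v p) $ i * lev1 X (u p) (v p) $ j"
    using uv[OF p] st[OF p] by (intro symmetric_part) auto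
qed (use w so_lev1 so_lev2 so_lev3 in \<open>auto simp: \<mu>_def\<close>)

end

lemma ord_f_lipschitz: "ord w i F \<Longrightarrow> ord w i (\<lambda>p. f (y p + F p) - f (y p))"
  by (rule ord_le[OF _ L_nonneg]) (auto intro: order_trans[OF f_bound])

end

context rough_equation
begin

text \<open>The summand 1 accounts for the bounded terms coming from g, and \<open>w\<close>
  inherits the Lipschitz constant of f.\<close>

definition w :: "real ^ 'd \<Rightarrow> real" where "w y = 1 + norm (f y)"

lemma \<mu>_increment:
  obtains C where "0 \<le> C"
    "\<And>s t y. \<lbrakk>a \<le> s; s \<le> t; t \<le> b\<rbrakk> \<Longrightarrow> norm (\<mu> s t y - y) \<le> C * w y * (t - s) powr \<alpha>"
proof -
  define D where "D = {p :: real \<times> real \<times> (real ^ 'd). a \<le> fst p \<and> fst p \<le> fst (snd p) \<and> fst (snd p) \<le> b}"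
  interpret interval_family g M a b \<alpha> L X f D fst "\<lambda>p. fst (snd p)"
    by unfold_locales (auto simp: D_def)
  interpret field_expansion M g D r "(b - a) powr \<alpha>" "\<lambda>p. w (snd (snd p))" "\<lambda>p. snd (snd p)"
    "\<lambda>p. (fst (snd p) - fst p) *\<^sub>R f (snd (snd p))" "\<lambda>p. \<mu> (fst p) (fst (snd p)) (snd (snd p)) - snd (snd p)"
    "\<lambda>p. lev1 X (fst p) (fst (snd p))" "\<lambda>p. lev2 X (fst p) (fst (snd p))" "\<lambda>p. lev3 X (fst p) (fst (snd p))"
    by (rule field_expansion_\<mu>) (auto simp: D_def w_def)
  obtain C where "0 \<le> C" "\<And>p. p \<in> D \<Longrightarrow> norm (\<mu> (fst p) (fst (snd p)) (snd (snd p)) - snd (snd p))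
      \<le> C * (w (snd (snd p)) * r p ^ 1)"
    using ord_h by (rule ordE) blast
  then show ?thesis
    by (intro that[of C]) (force simp: D_def mult.assoc)+
qed

lemma \<mu>_lipschitz:
  obtains C where "0 \<le> C"
    "\<And>s t y z. \<lbrakk>a \<le> s; s \<le> t; t \<le> b\<rbrakk> \<Longrightarrow> norm (\<mu> s t y - \<mu> s t z) \<le> (1 + C * (t - s) powr \<alpha>) * norm (y - z)"
proof -
  define D where "D = {p :: real \<times> real \<times> (real ^ 'd) \<times> (real ^ 'd). a \<le> fst p \<and> fst p \<le> fst (snd p) \<and> fst (snd p) \<le> b}"
  define s t :: "real \<times> real \<times> (real ^ 'd) \<times> (real ^ 'd) \<Rightarrow> real" where "s = fst" and "t = (\<lambda>p. fst (snd p))"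
  define y z :: "real \<times> real \<times> (real ^ 'd) \<times> (real ^ 'd) \<Rightarrow> real ^ 'd"
    where "y = (\<lambda>p. fst (snd (snd p)))" and "z = (\<lambda>p. snd (snd (snd p)))"
  interpret interval_family g M a b \<alpha> L X f D s t
    by unfold_locales (auto simp: D_def s_def t_def)
  \<comment> \<open>The distance of the two base points takes the role of the weight, so linearity
    in the weight becomes the Lipschitz bound. The identity part of the step supplies the leading
    1.\<close>
  let ?v = "\<lambda>p. norm (y p - z p)"
  have lip: "ord ?v 0 (\<lambda>p. F (y p) - F (z p))"
    if "0 \<le> c" "\<And>x k. norm (F (x + k) - F x) \<le> c * norm k" for F :: "real ^ 'd \<Rightarrow> 'x::real_normed_vector" and c
  proof (rule ordI[OF that(1)])
    fix p
    show "norm (F (y p) - F (z p)) \<le> c * (norm (y p - z p) * r p ^ 0)"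
      using that(2)[of "z p" "y p - z p"] by simp
  qed
  have f_lip: "norm (f (x + k) - f x) \<le> L * norm k" for x k using f_bound[of "x + k" x] by simp
  have 0: "0 \<le> 2 * M * M" "0 \<le> 6 * M ^ 3" using M(1) by auto
  note mono = ord_mono[of ?v _ _ 1]
  have 1: "ord ?v 1 (\<lambda>p. (t p - s p) *\<^sub>R (f (y p) - f (z p)))"
    using ord_time_scaleR[of s t ?v 0, OF _ _ _ lip[OF L_nonneg f_lip]] st by (intro mono) auto
  have 2: "ord ?v 1 (\<lambda>p. (g (y p) - g (z p)) (lev1 X (s p) (t p)))"
    using ord_apply[OF lip[OF M(1) lipschitz(1)] so_lev1[of s t]] st by auto
  have 3: "ord ?v 1 (\<lambda>p. app2 (\<Gamma> (y p) - \<Gamma> (z p)) (lev2 X (s p) (t p)))"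
    using ord_app2[OF lip[OF 0(1) \<Gamma>_lipschitz] so_lev2[of s t]] st by (intro mono) auto
  have 4: "ord ?v 1 (\<lambda>p. app3 (\<Lambda> (y p) - \<Lambda> (z p)) (lev3 X (s p) (t p)))"
    using ord_app3[OF lip[OF 0(2) \<Lambda>_lipschitz] so_lev3[of s t]] st by (intro mono) auto
  have "ord ?v 1 (\<lambda>p. (\<mu> (s p) (t p) (y p) - y p) - (\<mu> (s p) (t p) (z p) - z p))"
  proof (rule ord_cong[OF ord_add[OF ord_add[OF ord_add[OF 1 2] 3] 4]])
    fix p
    show "(\<mu> (s p) (t p) (y p) - y p) - (\<mu> (s p) (t p) (z p) - z p) =
        (t p - s p) *\<^sub>R (f (y p) - f (z p)) + (g (y p) - g (z p)) (lev1 X (s p) (t p))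
        + app2 (\<Gamma> (y p) - \<Gamma> (z p)) (lev2 X (s p) (t p)) + app3 (\<Lambda> (y p) - \<Lambda> (z p)) (lev3 X (s p) (t p))"
      by (simp add: \<mu>_def blinfun.diff_left scaleR_diff_right bounded_bilinear.diff_left[OF bounded_bilinear_app2]
          bounded_bilinear.diff_left[OF bounded_bilinear_app3])
  qed
  then obtain C where C: "0 \<le> C" "\<And>p. p \<in> D \<Longrightarrow> norm ((\<mu> (s p) (t p) (y p) - y p) - (\<mu> (s p) (t p) (z p) - z p))
      \<le> C * (?v p * r p ^ 1)"
    by (rule ordE) blast
  show ?thesis
  proof (rule that[OF C(1)])
    fix s' t' y' z' assume "a \<le> s'" "s' \<le> t'" "t' \<le> b"
    then have "norm ((\<mu> s' t' y' - y') - (\<mu> s' t' z' - z')) \<le> C * (norm (y' - z') * (t' - s') powr \<alpha>)"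
      using C(2)[of "(s', t', y', z')"] by (simp add: D_def s_def t_def y_def z_def)
    then show "norm (\<mu> s' t' y' - \<mu> s' t' z') \<le> (1 + C * (t' - s') powr \<alpha>) * norm (y' - z')"
      using norm_triangle_sub[of "\<mu> s' t' y' - \<mu> s' t' z'" "y' - z'"] by (simp add: algebra_simps)
  qed
qed

text \<open>Chen's relations regroup the difference into four products of total order four:
  remainders of g, \<Gamma> and \<Lambda> of orders 3, 2 and 1 against levels 1, 2 and 3, and the
  first-order change of f against the time increment.\<close>

lemma \<mu>_defect:
  obtains C where "0 \<le> C"
    "\<And>s u t y. \<lbrakk>a \<le> s; s \<le> u; u \<le> t; t \<le> b\<rbrakk> \<Longrightarrow>
      norm (\<mu> u t (\<mu> s u y) - \<mu> s t y) \<le> C * w y * (t - s) powr (4 * \<alpha>)"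
proof -
  define D where "D = {p :: real \<times> real \<times> real \<times> (real ^ 'd).
    a \<le> fst p \<and> fst p \<le> fst (snd p) \<and> fst (snd p) \<le> fst (snd (snd p)) \<and> fst (snd (snd p)) \<le> b}"
  define s u t :: "real \<times> real \<times> real \<times> (real ^ 'd) \<Rightarrow> real"
    where "s = fst" and "u = (\<lambda>p. fst (snd p))" and "t = (\<lambda>p. fst (snd (snd p)))"
  define y :: "real \<times> real \<times> real \<times> (real ^ 'd) \<Rightarrow> real ^ 'd" where "y = (\<lambda>p. snd (snd (snd p)))"
  have D: "a \<le> s p" "s p \<le> u p" "u p \<le> t p" "t p \<le> b" if "p \<in> D" for p
    using that by (auto simp: D_def s_def u_def t_def)
  interpret interval_family g M a b \<alpha> L X f D s t
    by unfold_locales (auto simp: D_def s_def t_def)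
  define h where "h = (\<lambda>p. \<mu> (s p) (u p) (y p) - y p)"
  let ?v = "\<lambda>p. w (y p)"
  interpret field_expansion M g D r "(b - a) powr \<alpha>" ?v y
    "\<lambda>p. (u p - s p) *\<^sub>R f (y p)" h
    "\<lambda>p. lev1 X (s p) (u p)" "\<lambda>p. lev2 X (s p) (u p)" "\<lambda>p. lev3 X (s p) (u p)"
    unfolding h_def by (rule field_expansion_\<mu>[of s u ?v y]) (auto simp: D_def s_def u_def t_def w_def)
  have 1: "ord ?v 4 (\<lambda>p. (t p - u p) *\<^sub>R (f (y p + h p) - f (y p)))"
    using ord_time_scaleR[of u t, OF _ _ _ ord_f_lipschitz[OF ord_h, of y]] D by simp
  have 2: "ord ?v 4 (\<lambda>p. (g (y p + h p) - g (y p) - \<Gamma> (y p) (lev1 X (s p) (u p)) - app2 (\<Lambda> (y p)) (lev2 X (s p) (u p)))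
      (lev1 X (u p) (t p)))"
    using ord_apply[OF ord_g_expansion so_lev1[of u t]] D by simp
  have 3: "ord ?v 4 (\<lambda>p. app2 (\<Gamma> (y p + h p) - \<Gamma> (y p) - \<Lambda> (y p) (lev1 X (s p) (u p))) (lev2 X (u p) (t p)))"
    using ord_app2[OF ord_\<Gamma>_expansion so_lev2[of u t]] D by simp
  have 4: "ord ?v 4 (\<lambda>p. app3 (\<Lambda> (y p + h p) - \<Lambda> (y p)) (lev3 X (u p) (t p)))"
    using ord_app3[OF ord_\<Lambda>_expansion so_lev3[of u t]] D by simp
  have "ord ?v 4 (\<lambda>p. \<mu> (u p) (t p) (\<mu> (s p) (u p) (y p)) - \<mu> (s p) (t p) (y p))"
  proof (rule ord_cong[OF ord_add[OF ord_add[OF ord_add[OF 1 2] 3] 4]])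
    fix p assume p: "p \<in> D"
    let ?x1 = "lev1 X (s p) (u p)" and ?x2 = "lev2 X (s p) (u p)" and ?x3 = "lev3 X (s p) (u p)"
    let ?z1 = "lev1 X (u p) (t p)" and ?z2 = "lev2 X (u p) (t p)" and ?z3 = "lev3 X (u p) (t p)"
    have chen_p: "lev1 X (s p) (t p) = ?x1 + ?z1" "lev2 X (s p) (t p) = ?x2 + ?z2 + tensor11 ?x1 ?z1"
      "lev3 X (s p) (t p) = ?x3 + ?z3 + tensor21 ?x2 ?z1 + tensor12 ?x1 ?z2"
      using chen D[OF p] by (auto simp: chen_relations_def)
    have yh: "\<mu> (s p) (u p) (y p) = y p + h p" by (simp add: h_def)
    let ?A = "(\<mu> (u p) (t p) (y p + h p) - (y p + h p)) - (\<mu> (s p) (t p) (y p) - y p)"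
    let ?H = "(u p - s p) *\<^sub>R f (y p) + g (y p) ?x1 + app2 (\<Gamma> (y p)) ?x2 + app3 (\<Lambda> (y p)) ?x3"
    have 1: "\<mu> (u p) (t p) (\<mu> (s p) (u p) (y p)) - \<mu> (s p) (t p) (y p) = ?A + h p"
      unfolding yh by simp
    \<comment> \<open>\<open>h p\<close> is expanded only where it stands as a free summand; inside
      the arguments of f, g, \<Gamma> and \<Lambda> it has to stay folded for the expansions to
      apply.\<close>
    have 2: "h p = ?H" by (simp add: h_def \<mu>_def)
    have 3: "?A + ?H =
        (t p - u p) *\<^sub>R (f (y p + h p) - f (y p))
        + (g (y p + h p) - g (y p) - \<Gamma> (y p) ?x1 - app2 (\<Lambda> (y p)) ?x2) ?z1
        + app2 (\<Gamma> (y p + h p) - \<Gamma> (y p) - \<Lambda> (y p) ?x1) ?z2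
        + app3 (\<Lambda> (y p + h p) - \<Lambda> (y p)) ?z3"
      unfolding \<mu>_def chen_p
      by (simp add: blinfun.bilinear_simps
          bounded_bilinear.diff_left[OF bounded_bilinear_app2] bounded_bilinear.diff_left[OF bounded_bilinear_app3]
          bounded_bilinear.add_left[OF bounded_bilinear_app2]
          bounded_bilinear.add_right[OF bounded_bilinear_app2] bounded_bilinear.add_right[OF bounded_bilinear_app3]
          app2_tensor11 app3_tensor12 app3_tensor21 algebra_simps)
    show "\<mu> (u p) (t p) (\<mu> (s p) (u p) (y p)) - \<mu> (s p) (t p) (y p) =
        (t p - u p) *\<^sub>R (f (y p + h p) - f (y p))
        + (g (y p + h p) - g (y p) - \<Gamma> (y p) ?x1 - app2 (\<Lambda> (y p)) ?x2) ?z1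
        + app2 (\<Gamma> (y p + h p) - \<Gamma> (y p) - \<Lambda> (y p) ?x1) ?z2
        + app3 (\<Lambda> (y p + h p) - \<Lambda> (y p)) ?z3"
      by (rule trans[OF 1 trans[OF arg_cong[OF 2, of "(+) ?A"] 3]])
  qed
  then obtain C where C: "0 \<le> C"
    "\<And>p. p \<in> D \<Longrightarrow> norm (\<mu> (u p) (t p) (\<mu> (s p) (u p) (y p)) - \<mu> (s p) (t p) (y p)) \<le> C * (?v p * r p ^ 4)"
    by (rule ordE) blast
  show ?thesis
  proof (rule that[OF C(1)])
    fix s' u' t' y' assume "a \<le> s'" "s' \<le> u'" "u' \<le> t'" "t' \<le> b"
    then show "norm (\<mu> u' t' (\<mu> s' u' y') - \<mu> s' t' y') \<le> C * w y' * (t' - s') powr (4 * \<alpha>)"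
      using C(2)[of "(s', u', t', y')"] powr_of_nat_mult[of 4 "t' - s'" \<alpha>]
      by (simp add: D_def s_def u_def t_def y_def mult.assoc)
  qed
qed

lemma davie_solution_exists:
  obtains y K where "y a = y0"
    "\<And>s t. \<lbrakk>a \<le> s; s \<le> t; t \<le> b\<rbrakk> \<Longrightarrow> norm (y t - \<mu> s t (y s)) \<le> K * (t - s) powr (4 * \<alpha>)"
proof -
  obtain C1 where C1: "0 \<le> C1"
    "\<And>s t y. \<lbrakk>a \<le> s; s \<le> t; t \<le> b\<rbrakk> \<Longrightarrow> norm (\<mu> s t y - y) \<le> C1 * w y * (t - s) powr \<alpha>"
    using \<mu>_increment by blast
  show ?thesis
  proof (cases "a = b")
    case True
    show ?thesis
    proof (rule that[of "\<lambda>_. y0" 0])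
      fix s t assume "a \<le> s" "s \<le> t" "t \<le> b"
      with True have "s = a" "t = a" by auto
      then show "norm (y0 - \<mu> s t y0) \<le> 0 * (t - s) powr (4 * \<alpha>)"
        using C1(2)[of a a y0] ab by simp
    qed simp
  next
    case False
    obtain C2 where C2: "0 \<le> C2" "\<And>s t y z. \<lbrakk>a \<le> s; s \<le> t; t \<le> b\<rbrakk> \<Longrightarrow>
        norm (\<mu> s t y - \<mu> s t z) \<le> (1 + C2 * (t - s) powr \<alpha>) * norm (y - z)"
      using \<mu>_lipschitz by blast
    obtain C3 where C3: "0 \<le> C3" "\<And>s u t y. \<lbrakk>a \<le> s; s \<le> u; u \<le> t; t \<le> b\<rbrakk> \<Longrightarrow>
        norm (\<mu> u t (\<mu> s u y) - \<mu> s t y) \<le> C3 * w y * (t - s) powr (4 * \<alpha>)"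
      using \<mu>_defect by blast
    define C where "C = max C1 (max C2 C3)"
    have C: "C1 \<le> C" "C2 \<le> C" "C3 \<le> C" by (auto simp: C_def)
    have w: "1 \<le> w y" for y by (simp add: w_def)
    then have w0: "0 \<le> w y" for y using order_trans zero_le_one by blast
    interpret almost_flow a b \<alpha> "4 * \<alpha>" C L \<mu> w
    proof
      show "a < b" "0 < \<alpha>" "1 < 4 * \<alpha>" "0 \<le> C" "0 \<le> L" using ab False \<alpha> C1(1) C(1) L_nonneg by auto
      show "1 \<le> w y" for y by (rule w)
      show "\<bar>w y - w z\<bar> \<le> L * norm (y - z)" for y z
        using norm_triangle_ineq3[of "f y" "f z"] f_bound[of y z] by (simp add: w_def)
      fix s t y z assume st: "a \<le> s" "s \<le> t" "t \<le> b"
      show "norm (\<mu> s t y - y) \<le> C * w y * (t - s) powr \<alpha>"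
        by (rule order_trans[OF C1(2)[OF st]]) (intro mult_right_mono C w0 powr_ge_zero)
      show "norm (\<mu> s t y - \<mu> s t z) \<le> (1 + C * (t - s) powr \<alpha>) * norm (y - z)"
        by (rule order_trans[OF C2(2)[OF st]]) (intro mult_right_mono add_left_mono C norm_ge_zero powr_ge_zero)
    next
      fix s u t y assume st: "a \<le> s" "s \<le> u" "u \<le> t" "t \<le> b"
      show "norm (\<mu> u t (\<mu> s u y) - \<mu> s t y) \<le> C * w y * (t - s) powr (4 * \<alpha>)"
        by (rule order_trans[OF C3(2)[OF st]]) (intro mult_right_mono C w0 powr_ge_zero)
    qed
    show ?thesis using solution_exists that by blast
  qed
qed

end

section \<open>From the local estimate to the rough differential equation\<close>

lemma holder_imp_continuous_on:
  fixes y :: "real \<Rightarrow> 'v::real_normed_vector"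
  assumes "holder \<beta> a b y" and "0 < \<beta>"
  shows "continuous_on {a..b} y"
proof -
  obtain K where K: "\<And>s t. a \<le> s \<Longrightarrow> s \<le> t \<Longrightarrow> t \<le> b \<Longrightarrow> norm (y t - y s) \<le> K * (t - s) powr \<beta>"
    using assms(1) unfolding holder_def holder2_def by blast
  have K': "norm (y t - y s) \<le> K * \<bar>t - s\<bar> powr \<beta>" if "s \<in> {a..b}" "t \<in> {a..b}" for s t
    using K[of s t] K[of t s] that by (cases "s \<le> t") (auto simp: norm_minus_commute)
  show ?thesis
    unfolding continuous_on_def
  proof
    fix s assume s: "s \<in> {a..b}"
    have "((\<lambda>t. K * \<bar>t - s\<bar> powr \<beta>) \<longlongrightarrow> K * \<bar>s - s\<bar> powr \<beta>) (at s within {a..b})"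
      using assms(2) by (intro tendsto_intros tendsto_powr') auto
    then have lim: "((\<lambda>t. K * \<bar>t - s\<bar> powr \<beta>) \<longlongrightarrow> 0) (at s within {a..b})" by simp
    have "eventually (\<lambda>t. norm (y t - y s) \<le> K * \<bar>t - s\<bar> powr \<beta>) (at s within {a..b})"
      using K'[OF s] by (simp add: eventually_at_filter)
    then have "((\<lambda>t. y t - y s) \<longlongrightarrow> 0) (at s within {a..b})"
      by (rule Lim_null_comparison[OF _ lim])
    then show "(y \<longlongrightarrow> y s) (at s within {a..b})" by (rule LIM_zero_cancel)
  qed
qed

lemma partition_mono:
  assumes D: "is_partition n D s t" and ij: "i \<le> j" "j \<le> n"
  shows "D i \<le> D j"
  using ij
proof (induction j)
  case (Suc j)
  show ?case
  proof (cases "i = Suc j")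
    case False
    then have "D i \<le> D j" using Suc by auto
    also have "\<dots> < D (Suc j)" using D Suc.prems(2) by (auto simp: is_partition_def)
    finally show ?thesis by simp
  qed simp
qed simp

text \<open>The increments of \<open>\<Phi>\<close> telescope, so the error of a Riemann sum is a
  sum of local errors. One factor v - u of each adds up to t - s, and the remaining power \<theta> -
  1 is bounded through the mesh.\<close>

lemma has_rough_integral_of_almost_additive:
  fixes y :: "real \<Rightarrow> ((real ^ 'm::finite) \<Rightarrow>\<^sub>L 'v::real_normed_vector)"
    and y' :: "real \<Rightarrow> ((real ^ 'm) \<Rightarrow>\<^sub>L ((real ^ 'm) \<Rightarrow>\<^sub>L 'v))"
    and y'' :: "real \<Rightarrow> ((real ^ 'm) \<Rightarrow>\<^sub>L ((real ^ 'm) \<Rightarrow>\<^sub>L ((real ^ 'm) \<Rightarrow>\<^sub>L 'v)))"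
    and \<Phi> :: "real \<Rightarrow> 'v"
  assumes \<theta>: "1 < \<theta>"
    and germ: "\<And>u v. \<lbrakk>s \<le> u; u \<le> v; v \<le> t\<rbrakk> \<Longrightarrow>
      norm (y u (lev1 X u v) + app2 (y' u) (lev2 X u v) + app3 (y'' u) (lev3 X u v) - (\<Phi> v - \<Phi> u))
        \<le> K * (v - u) powr \<theta>"
  shows "has_rough_integral X y y' y'' s t (\<Phi> t - \<Phi> s)"
  unfolding has_rough_integral_def
proof (intro allI impI)
  fix \<epsilon> :: real assume \<epsilon>: "0 < \<epsilon>"
  have "((\<lambda>d. \<bar>K\<bar> * \<bar>t - s\<bar> * d powr (\<theta> - 1)) \<longlongrightarrow> \<bar>K\<bar> * \<bar>t - s\<bar> * 0 powr (\<theta> - 1)) (at_right 0)"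
    using \<theta> by (intro tendsto_intros tendsto_powr'[of _ 0]) (auto simp: eventually_at_filter)
  then have "eventually (\<lambda>d. \<bar>K\<bar> * \<bar>t - s\<bar> * d powr (\<theta> - 1) < \<epsilon>) (at_right 0)"
    using \<epsilon> by (intro order_tendstoD(2)[where y="\<bar>K\<bar> * \<bar>t - s\<bar> * 0 powr (\<theta> - 1)"]) auto
  then have "eventually (\<lambda>d. 0 < d \<and> \<bar>K\<bar> * \<bar>t - s\<bar> * d powr (\<theta> - 1) < \<epsilon>) (at_right 0)"
    using eventually_at_right_less[of "0::real"] by eventually_elim simp
  then obtain \<delta> where \<delta>: "0 < \<delta>" "\<bar>K\<bar> * \<bar>t - s\<bar> * \<delta> powr (\<theta> - 1) < \<epsilon>"
    using eventually_happens[of _ "at_right (0::real)"] by (auto simp: trivial_limit_at_right_real)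
  let ?\<Xi> = "\<lambda>u v. y u (lev1 X u v) + app2 (y' u) (lev2 X u v) + app3 (y'' u) (lev3 X u v)"
  show "\<exists>\<delta>>0. \<forall>n D. is_partition n D s t \<and> (\<forall>i<n. D (Suc i) - D i < \<delta>) \<longrightarrow>
        norm ((\<Sum>i<n. let u = D i; v = D (Suc i) in ?\<Xi> u v) - (\<Phi> t - \<Phi> s)) < \<epsilon>"
  proof (intro exI[of _ \<delta>] conjI allI impI \<delta>(1))
    fix n D assume "is_partition n D s t \<and> (\<forall>i<n. D (Suc i) - D i < \<delta>)"
    then have part: "is_partition n D s t" and mesh: "\<And>i. i < n \<Longrightarrow> D (Suc i) - D i < \<delta>" by auto
    have ends: "D 0 = s" "D n = t" using part by (auto simp: is_partition_def)
    have "(\<Sum>i<n. ?\<Xi> (D i) (D (Suc i))) - (\<Phi> t - \<Phi> s)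
        = (\<Sum>i<n. ?\<Xi> (D i) (D (Suc i)) - (\<Phi> (D (Suc i)) - \<Phi> (D i)))"
      using sum_lessThan_telescope[of "\<lambda>i. \<Phi> (D i)" n] ends by (simp add: sum_subtractf)
    also have "norm \<dots> \<le> (\<Sum>i<n. \<bar>K\<bar> * \<delta> powr (\<theta> - 1) * (D (Suc i) - D i))"
    proof (rule sum_norm_le)
      fix i assume "i \<in> {..<n}"
      then have i: "i < n" by simp
      define d where "d = D (Suc i) - D i"
      have d: "0 \<le> d" "d \<le> \<delta>" using partition_mono[OF part, of i "Suc i"] mesh[OF i] i by (auto simp: d_def)
      have "s \<le> D i" "D i \<le> D (Suc i)" "D (Suc i) \<le> t"
        using partition_mono[OF part, of 0 i] partition_mono[OF part, of i "Suc i"]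
          partition_mono[OF part, of "Suc i" n] i ends by auto
      then have "norm (?\<Xi> (D i) (D (Suc i)) - (\<Phi> (D (Suc i)) - \<Phi> (D i))) \<le> K * d powr \<theta>"
        unfolding d_def by (rule germ)
      also have "\<dots> \<le> \<bar>K\<bar> * d powr \<theta>" by (intro mult_right_mono) auto
      also have "d powr \<theta> = d * d powr (\<theta> - 1)"
        using powr_mult_base[OF d(1), of "\<theta> - 1"] by simp
      also have "\<bar>K\<bar> * (d * d powr (\<theta> - 1)) \<le> \<bar>K\<bar> * (d * \<delta> powr (\<theta> - 1))"
        using d \<theta> by (intro mult_left_mono powr_mono2) auto
      finally show "norm (?\<Xi> (D i) (D (Suc i)) - (\<Phi> (D (Suc i)) - \<Phi> (D i)))
          \<le> \<bar>K\<bar> * \<delta> powr (\<theta> - 1) * (D (Suc i) - D i)"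
        by (simp add: d_def mult_ac)
    qed
    also have "\<dots> = \<bar>K\<bar> * \<delta> powr (\<theta> - 1) * (t - s)"
      unfolding sum_distrib_left[symmetric] sum_lessThan_telescope ends ..
    also have "\<dots> \<le> \<bar>K\<bar> * \<delta> powr (\<theta> - 1) * \<bar>t - s\<bar>"
      by (intro mult_left_mono) auto
    also have "\<dots> < \<epsilon>" using \<delta>(2) by (simp only: mult_ac)
    finally show "norm ((\<Sum>i<n. let u = D i; v = D (Suc i) in ?\<Xi> u v) - (\<Phi> t - \<Phi> s)) < \<epsilon>"
      by (simp only: Let_def)
  qed
qed

context rough_equation
begin

lemma davie_solution_is_solution:
  assumes y: "\<And>s t. \<lbrakk>a \<le> s; s \<le> t; t \<le> b\<rbrakk> \<Longrightarrow> norm (y t - \<mu> s t (y s)) \<le> K * (t - s) powr (4 * \<alpha>)"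
  shows "rde_solution \<alpha> a b X f g (y a) y"
proof -
  define D where "D = {p :: real \<times> real. a \<le> fst p \<and> fst p \<le> snd p \<and> snd p \<le> b}"
  interpret interval_family g M a b \<alpha> L X f D fst snd
    by unfold_locales (auto simp: D_def)
  have D: "fst p \<le> fst p" "fst p \<le> snd p" "snd p \<le> snd p" if "p \<in> D" for p
    using that by (auto simp: D_def)
  have to_holder2: "holder2 (real k * \<alpha>) a b Z"
    if Z: "so k (\<lambda>p. Z (fst p) (snd p))" and k: "0 < k"
    for k and Z :: "real \<Rightarrow> real \<Rightarrow> 'x::real_normed_vector"
  proof -
    obtain C where C: "\<And>p. p \<in> D \<Longrightarrow> norm (Z (fst p) (snd p)) \<le> C * (1 * r p ^ k)"
      using Z by (rule ordE) blast
    show ?thesis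
      unfolding holder2_def
    proof (intro exI[of _ C] allI impI)
      fix s t assume "a \<le> s \<and> s \<le> t \<and> t \<le> b"
      then show "norm (Z s t) \<le> C * (t - s) powr (real k * \<alpha>)"
        using C[of "(s, t)"] k by (simp add: D_def powr_of_nat_mult)
    qed
  qed
  have e: "so 4 (\<lambda>p. y (snd p) - \<mu> (fst p) (snd p) (y (fst p)))"
  proof (rule ordI[of "\<bar>K\<bar>"])
    fix p assume p: "p \<in> D"
    have "norm (y (snd p) - \<mu> (fst p) (snd p) (y (fst p))) \<le> K * (snd p - fst p) powr (4 * \<alpha>)"
      using p by (intro y) (auto simp: D_def)
    also have "\<dots> \<le> \<bar>K\<bar> * (snd p - fst p) powr (4 * \<alpha>)"
      by (intro mult_right_mono) auto
    finally show "norm (y (snd p) - \<mu> (fst p) (snd p) (y (fst p))) \<le> \<bar>K\<bar> * (1 * r p ^ 4)"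
      using powr_of_nat_mult[of 4 "snd p - fst p" \<alpha>] by simp
  qed simp
  obtain W where W: "1 \<le> W" "\<And>t. a \<le> t \<Longrightarrow> t \<le> b \<Longrightarrow> norm (f (y t)) \<le> W"
  proof -
    obtain C where C: "0 \<le> C"
      "\<And>s t y. \<lbrakk>a \<le> s; s \<le> t; t \<le> b\<rbrakk> \<Longrightarrow> norm (\<mu> s t y - y) \<le> C * w y * (t - s) powr \<alpha>"
      using \<mu>_increment by blast
    define N where "N = \<bar>K\<bar> * (b - a) powr (4 * \<alpha>) + C * w (y a) * (b - a) powr \<alpha>"
    have w0: "0 \<le> w (y a)" by (simp add: w_def)
    have "norm (f (y t)) \<le> max 1 (norm (f (y a)) + L * N)" if t: "a \<le> t" "t \<le> b" for t
    proof -
      have "norm (y t - y a) \<le> K * (t - a) powr (4 * \<alpha>) + C * w (y a) * (t - a) powr \<alpha>"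
        using norm_triangle_le[OF add_mono[OF y[of a t] C(2)[of a t "y a"]]] t by simp
      also have "\<dots> \<le> N"
        unfolding N_def using t C(1) w0 \<alpha> by (intro add_mono mult_mono powr_mono2) auto
      finally have "L * norm (y t - y a) \<le> L * N" using L_nonneg by (rule mult_left_mono)
      then show ?thesis
        using f_bound[of "y t" "y a"] norm_triangle_sub[of "f (y t)" "f (y a)"] by linarith
    qed
    then show ?thesis by (intro that[of "max 1 (norm (f (y a)) + L * N)"]) auto
  qed
  define h where "h = (\<lambda>p. \<mu> (fst p) (snd p) (y (fst p)) - y (fst p))"
  let ?W = "\<lambda>p::real \<times> real. W"
  let ?x1 = "\<lambda>p. lev1 X (fst p) (snd p)" and ?x2 = "\<lambda>p. lev2 X (fst p) (snd p)"
    and ?x3 = "\<lambda>p. lev3 X (fst p) (snd p)"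
  interpret field_expansion M g D r "(b - a) powr \<alpha>" ?W "\<lambda>p. y (fst p)"
    "\<lambda>p. (snd p - fst p) *\<^sub>R f (y (fst p))" h ?x1 ?x2 ?x3
    unfolding h_def by (rule field_expansion_\<mu>[of fst snd ?W "\<lambda>p. y (fst p)"]) (auto simp: D_def intro: W)
  have to_so: "so i F" if "ord ?W i F" for i and F :: "real \<times> real \<Rightarrow> 'x::real_normed_vector"
  proof -
    obtain C where "0 \<le> C" "\<And>p. p \<in> D \<Longrightarrow> norm (F p) \<le> C * (W * r p ^ i)"
      using \<open>ord ?W i F\<close> by (rule ordE) blast
    then show ?thesis using W(1) by (intro ordI[of "C * W"]) (auto simp: mult.assoc)
  qed
  let ?e = "\<lambda>p. y (snd p) - \<mu> (fst p) (snd p) (y (fst p))"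
  \<comment> \<open>The field expansions are available at the end point of the Euler step; the true
    path differs from it by an error of order four, which Lipschitz bounds carry through every
    field.\<close>
  have y_end: "y (snd p) = y (fst p) + h p + ?e p" for p by (simp add: h_def)
  have inc: "so 1 (\<lambda>p. y (snd p) - y (fst p))"
    by (rule ord_cong[OF ord_add[OF to_so[OF ord_h] so_mono[OF e]]]) (auto simp: h_def)
  have lip: "so 1 (\<lambda>p. F (y (snd p)) - F (y (fst p)))"
    if c: "0 \<le> c" and le: "\<And>x k. norm (F (x + k) - F x) \<le> c * norm k"
    for F :: "real ^ 'd \<Rightarrow> 'x::real_normed_vector" and c
  proof (rule ord_le[OF inc c])
    fix p
    show "norm (F (y (snd p)) - F (y (fst p))) \<le> c * norm (y (snd p) - y (fst p))"
      using le[of "y (fst p)" "y (snd p) - y (fst p)"] by simp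
  qed
  have lip_e: "so 4 (\<lambda>p. F (y (snd p)) - F (y (fst p) + h p))"
    if c: "0 \<le> c" and le: "\<And>x k. norm (F (x + k) - F x) \<le> c * norm k"
    for F :: "real ^ 'd \<Rightarrow> 'x::real_normed_vector" and c
  proof (rule ord_le[OF e c])
    fix p
    show "norm (F (y (snd p)) - F (y (fst p) + h p)) \<le> c * norm (?e p)"
      using le[of "y (fst p) + h p" "?e p"] by (simp add: y_end[symmetric])
  qed
  have c0: "0 \<le> 2 * M * M" "0 \<le> 6 * M ^ 3" using M(1) by auto
  have \<alpha>1: "\<alpha> = real 1 * \<alpha>" and \<alpha>2: "2 * \<alpha> = real 2 * \<alpha>" and \<alpha>3: "3 * \<alpha> = real 3 * \<alpha>" by auto
  have hy: "holder \<alpha> a b y"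
    unfolding holder_def by (subst \<alpha>1, rule to_holder2[OF inc]) simp
  have hg: "holder \<alpha> a b (\<lambda>t. g (y t))"
    unfolding holder_def by (subst \<alpha>1, rule to_holder2[OF lip[OF M(1) lipschitz(1)]]) simp
  have h\<Gamma>: "holder \<alpha> a b (\<lambda>t. \<Gamma> (y t))"
    unfolding holder_def by (subst \<alpha>1, rule to_holder2[OF lip[OF c0(1) \<Gamma>_lipschitz]]) simp
  have h\<Lambda>: "holder \<alpha> a b (\<lambda>t. \<Lambda> (y t))"
    unfolding holder_def by (subst \<alpha>1, rule to_holder2[OF lip[OF c0(2) \<Lambda>_lipschitz]]) simp
  have "so 3 (\<lambda>p. y (snd p) - y (fst p) - g (y (fst p)) (?x1 p) - app2 (\<Gamma> (y (fst p))) (?x2 p))"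
    by (rule ord_cong[OF ord_add[OF to_so[OF ord_h_minus_level2] so_mono[OF e]]]) (auto simp: h_def)
  then have y3: "holder2 (3 * \<alpha>) a b (\<lambda>s t. y t - y s - g (y s) (lev1 X s t) - app2 (\<Gamma> (y s)) (lev2 X s t))"
    by (subst \<alpha>3, intro to_holder2) auto
  have so3_g: "so 3 (\<lambda>p. g (y (snd p)) - g (y (fst p)) - \<Gamma> (y (fst p)) (?x1 p) - app2 (\<Lambda> (y (fst p))) (?x2 p))"
    by (rule ord_cong[OF ord_add[OF to_so[OF ord_g_expansion] so_mono[OF lip_e[OF M(1) lipschitz(1)]]]]) auto
  from so3_g have g3: "holder2 (3 * \<alpha>) a b (\<lambda>s t. g (y t) - g (y s) - \<Gamma> (y s) (lev1 X s t) - app2 (\<Lambda> (y s)) (lev2 X s t))"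
    by (subst \<alpha>3, intro to_holder2) auto
  have "so 2 (\<lambda>p. g (y (snd p)) - g (y (fst p)) - \<Gamma> (y (fst p)) (?x1 p))"
  proof (rule ord_cong[OF ord_add])
    show "so 2 (\<lambda>p. app2 (\<Lambda> (y (fst p))) (?x2 p))"
      using ord_app2[OF so_fields(5) x2] by (simp only: add_0)
    show "so 2 (\<lambda>p. g (y (snd p)) - g (y (fst p)) - \<Gamma> (y (fst p)) (?x1 p) - app2 (\<Lambda> (y (fst p))) (?x2 p))"
      by (rule so_mono[OF so3_g]) simp
  qed simp
  then have g2: "holder2 (2 * \<alpha>) a b (\<lambda>s t. g (y t) - g (y s) - \<Gamma> (y s) (lev1 X s t))"
    by (subst \<alpha>2, intro to_holder2) auto
  have "so 2 (\<lambda>p. \<Gamma> (y (snd p)) - \<Gamma> (y (fst p)) - \<Lambda> (y (fst p)) (?x1 p))"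
    by (rule ord_cong[OF ord_add[OF to_so[OF ord_\<Gamma>_expansion] so_mono[OF lip_e[OF c0(1) \<Gamma>_lipschitz]]]]) auto
  then have \<Gamma>2: "holder2 (2 * \<alpha>) a b (\<lambda>s t. \<Gamma> (y t) - \<Gamma> (y s) - \<Lambda> (y s) (lev1 X s t))"
    by (subst \<alpha>2, intro to_holder2) auto
  have cont_f: "continuous_on {a..b} (\<lambda>t. f (y t))"
    using \<alpha> by (intro continuous_on_compose2[OF lipschitz_on_continuous_on[OF f_lipschitz]
          holder_imp_continuous_on[OF hy]]) auto
  \<comment> \<open>If y solves the equation, the rough integral must be what is left of y after
    removing the drift.\<close>
  define \<Phi> where "\<Phi> t = y t - integral {a..t} (\<lambda>x. f (y x))" for t
  have integrable: "(\<lambda>x. f (y x)) integrable_on {s..t}" if "a \<le> s" "t \<le> b" for s t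
    using that by (intro integrable_continuous_real continuous_on_subset[OF cont_f]) auto
  have \<Phi>_diff: "\<Phi> v - \<Phi> u = y v - y u - integral {u..v} (\<lambda>x. f (y x))" if "a \<le> u" "u \<le> v" "v \<le> b" for u v
    using Henstock_Kurzweil_Integration.integral_combine[OF that(1,2) integrable[of a v]] that
    by (simp add: \<Phi>_def algebra_simps)
  obtain K1 where K1: "0 \<le> K1" "\<And>s t. a \<le> s \<Longrightarrow> s \<le> t \<Longrightarrow> t \<le> b \<Longrightarrow> norm (y t - y s) \<le> K1 * (t - s) powr \<alpha>"
  proof -
    obtain C where "0 \<le> C" "\<And>p. p \<in> D \<Longrightarrow> norm (y (snd p) - y (fst p)) \<le> C * (1 * r p ^ 1)"
      using inc by (rule ordE) blast
    then show ?thesis by (intro that[of C]) (force simp: D_def)+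
  qed
  \<comment> \<open>f(y) is \<alpha>-Hoelder, so freezing it at the left end costs a time increment,
    of order three, times one more power of (t-s)^\<alpha>.\<close>
  have drift: "so 4 (\<lambda>p. integral {fst p..snd p} (\<lambda>x. f (y x)) - (snd p - fst p) *\<^sub>R f (y (fst p)))"
  proof (rule ord_le)
    have "so 1 r" by (rule ordI[of 1]) auto
    from ord_time_scaleR[OF D this] show "so 4 (\<lambda>p. (snd p - fst p) *\<^sub>R r p)" by simp
    show "0 \<le> L * K1" using L_nonneg K1 by simp
    fix p assume p: "p \<in> D"
    let ?s = "fst p" and ?t = "snd p"
    have st: "a \<le> ?s" "?s \<le> ?t" "?t \<le> b" using p by (auto simp: D_def)
    have int: "((\<lambda>x. f (y x) - f (y ?s)) has_integral integral {?s..?t} (\<lambda>x. f (y x)) - (?t - ?s) *\<^sub>R f (y ?s)) {?s..?t}"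
      using st has_integral_const_real[of "f (y ?s)" ?s ?t]
      by (intro has_integral_diff integrable_integral integrable) auto
    have "norm (integral {?s..?t} (\<lambda>x. f (y x)) - (?t - ?s) *\<^sub>R f (y ?s))
        \<le> L * (K1 * r p) * measure lborel {?s..?t}"
    proof (rule has_integral_bound_real[OF _ finite.emptyI int])
      show "0 \<le> L * (K1 * r p)" using L_nonneg K1 by simp
      fix x assume "x \<in> {?s..?t} - {}"
      then have x: "x \<in> {?s..?t}" by simp
      have "norm (y x - y ?s) \<le> K1 * (x - ?s) powr \<alpha>" using K1(2)[of ?s x] x st by auto
      also have "\<dots> \<le> K1 * r p" using x K1(1) \<alpha> by (intro mult_left_mono powr_mono2) auto
      finally show "norm (f (y x) - f (y ?s)) \<le> L * (K1 * r p)"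
        using order_trans[OF f_bound mult_left_mono[OF _ L_nonneg]] by blast
    qed
    then show "norm (integral {?s..?t} (\<lambda>x. f (y x)) - (?t - ?s) *\<^sub>R f (y ?s)) \<le> L * K1 * norm ((?t - ?s) *\<^sub>R r p)"
      using st by (simp add: mult_ac)
  qed
  let ?\<Xi> = "\<lambda>s t. g (y s) (lev1 X s t) + app2 (\<Gamma> (y s)) (lev2 X s t) + app3 (\<Lambda> (y s)) (lev3 X s t)"
  \<comment> \<open>The summand of the Riemann sum is the Euler increment without its drift, so the
    discrepancy is the freezing error of the drift minus the error of the Euler step.\<close>
  have "so 4 (\<lambda>p. ?\<Xi> (fst p) (snd p) - (\<Phi> (snd p) - \<Phi> (fst p)))"
  proof (rule ord_cong[OF ord_diff[OF drift e]])
    fix p assume "p \<in> D"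
    then show "?\<Xi> (fst p) (snd p) - (\<Phi> (snd p) - \<Phi> (fst p)) =
        integral {fst p..snd p} (\<lambda>x. f (y x)) - (snd p - fst p) *\<^sub>R f (y (fst p)) - ?e p"
      by (subst \<Phi>_diff) (auto simp: D_def \<mu>_def)
  qed
  then obtain C where C: "\<And>p. p \<in> D \<Longrightarrow> norm (?\<Xi> (fst p) (snd p) - (\<Phi> (snd p) - \<Phi> (fst p))) \<le> C * (1 * r p ^ 4)"
    by (rule ordE) blast
  have germ: "norm (?\<Xi> u v - (\<Phi> v - \<Phi> u)) \<le> C * (v - u) powr (4 * \<alpha>)" if "a \<le> u" "u \<le> v" "v \<le> b" for u v
    using C[of "(u, v)"] that powr_of_nat_mult[of 4 "v - u" \<alpha>] by (simp add: D_def)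
  show ?thesis
    unfolding rde_solution_def controlled_def
  proof (intro conjI allI impI hy hg h\<Gamma> h\<Lambda> y3 g3 g2 \<Gamma>2 refl)
    fix s t assume "a \<le> s \<and> s \<le> t \<and> t \<le> b"
    then have st: "a \<le> s" "s \<le> t" "t \<le> b" by auto
    show "\<exists>J I. ((\<lambda>u. f (y u)) has_integral J) {s..t} \<and>
        has_rough_integral X (\<lambda>u. g (y u)) (\<lambda>u. \<Gamma> (y u)) (\<lambda>u. \<Lambda> (y u)) s t I \<and> y t - y s = J + I"
    proof (intro exI conjI)
      show "((\<lambda>u. f (y u)) has_integral integral {s..t} (\<lambda>u. f (y u))) {s..t}"
        using st by (intro integrable_integral integrable)
      show "has_rough_integral X (\<lambda>u. g (y u)) (\<lambda>u. \<Gamma> (y u)) (\<lambda>u. \<Lambda> (y u)) s t (\<Phi> t - \<Phi> s)"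
        using \<alpha> st by (intro has_rough_integral_of_almost_additive[where \<theta> = "4 * \<alpha>" and K = C] germ) auto
      show "y t - y s = integral {s..t} (\<lambda>u. f (y u)) + (\<Phi> t - \<Phi> s)"
        unfolding \<Phi>_diff[OF st] by simp
    qed
  qed
qed

end

lemma rde_solution_exists:
  fixes f :: "real ^ 'd \<Rightarrow> real ^ 'd"
    and g :: "real ^ 'd \<Rightarrow> ((real ^ 'm::finite) \<Rightarrow>\<^sub>L (real ^ 'd))"
  assumes \<alpha>: "1 / 4 < \<alpha>" "\<alpha> < 1 / 3" and ab: "a \<le> b"
    and f: "L-lipschitz_on UNIV f" and g: "C3_b g" and X: "geometric_lift \<alpha> a b x X"
  obtains y where "rde_solution \<alpha> a b X f g y0 y"
proof -
  obtain M where "0 \<le> M" "\<And>x. norm (g x) \<le> M" "\<And>x. norm (fderiv g x) \<le> M"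
    "\<And>x. norm (fderiv (fderiv g) x) \<le> M" "\<And>x. norm (fderiv (fderiv (fderiv g)) x) \<le> M"
    using C3_b_bound[OF g] by blast
  moreover have "lev2 X s t $ i $ j + lev2 X s t $ j $ i = lev1 X s t $ i * lev1 X s t $ j"
    if "a \<le> s" "s \<le> t" "t \<le> b" for s t i j
    using geometric_lift_symmetric_part[OF X _ that] \<alpha> by simp
  ultimately interpret rough_equation g M a b \<alpha> L X f
    using assms by unfold_locales (auto simp: geometric_lift_def)
  obtain y K where "y a = y0"
    "\<And>s t. \<lbrakk>a \<le> s; s \<le> t; t \<le> b\<rbrakk> \<Longrightarrow> norm (y t - \<mu> s t (y s)) \<le> K * (t - s) powr (4 * \<alpha>)"
    using davie_solution_exists by blast
  then show ?thesis using davie_solution_is_solution that by blast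
qed

theorem theorem4p5:
  fixes M :: "'w measure"
    and B :: "real \<Rightarrow> 'w \<Rightarrow> real ^ 'm"
    and H lam \<alpha> a b :: real
    and f :: "real ^ 'd \<Rightarrow> real ^ 'd"
    and g :: "real ^ 'd \<Rightarrow> ((real ^ 'm) \<Rightarrow>\<^sub>L (real ^ 'd))"
  assumes "prob_space M"
    and "1 / 4 < H" and "H < 1 / 3" and "0 < lam"
    and "tfbm M H lam B"
    and "1 / 4 < \<alpha>" and "\<alpha> < H"
    and "0 \<le> a" and "a \<le> b"
    and "\<exists>L. L-lipschitz_on UNIV f"
    and "C3_b g"
  shows "AE \<omega> in M. \<forall>X. geometric_lift \<alpha> a b (\<lambda>t. B t \<omega>) X \<longrightarrow>
           (\<forall>y\<^sub>a. \<exists>y. rde_solution \<alpha> a b X f g y\<^sub>a y)"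
proof (rule AE_I2, intro allI impI)
  fix \<omega> X y\<^sub>a
  assume X: "geometric_lift \<alpha> a b (\<lambda>t. B t \<omega>) X"
  obtain L where L: "L-lipschitz_on UNIV f" using assms by blast
  have \<alpha>: "1 / 4 < \<alpha>" "\<alpha> < 1 / 3" using assms by auto
  obtain y where "rde_solution \<alpha> a b X f g y\<^sub>a y"
    using rde_solution_exists[OF \<alpha> \<open>a \<le> b\<close> L \<open>C3_b g\<close> X] by blast
  then show "\<exists>y. rde_solution \<alpha> a b X f g y\<^sub>a y" by blast
qed

end
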